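(* Let $\mathbb{X}$ be a distributive restriction category. The following are equivalent: (i) $\mathbb{X}$ is a classical restriction category; (ii) $\mathbb{X}$ has classical products; (iii) $\mathbb{X}$ is classically classified; (iv) there is a distributive category $\mathbb{D}$ such that $\mathbb{X}$ is restriction equivalent to the Kleisli category $\mathbb{D}_{\_\oplus\mathsf{1}}$ of the exception monad $\_\oplus\mathsf{1}$ on $\mathbb{D}$.
   Context: Composition is written in diagrammatic order: for $f:A\to B$ and $g:B\to C$, $fg:A\to C$ is first $f$, then $g$. **Restriction categories.** A restriction category is a category $\mathbb{X}$ with an operator assigning to each map $f:A\to B$ a map $\overline{f}:A\to A$ such that (whenever the expressions are well-typed) [R.1] $\overline{f}f=f$; [R.2] $\overline{f}\,\overline{g}=\overline{g}\,\overline{f}$; [R.3] $\overline{\overline{g}f}=\overline{g}\,\overline{f}$; [R.4] $f\overline{g}=\overline{fg}f$. A map $f:A\to B$ is total if $\overline{f}=1_A$. $\mathbb{X}$ has restriction zeroes if it has zero maps $0:A\to B$ for all $A,B$ (so $f0=0=0f$ for all $f$) and $\overline{0}=0$. **Distributive restriction categories.** A Cartesian restriction category is a restriction category with (a) a restriction terminal object: an object $\mathsf{1}$ such that for each $A$ there is a unique total map $t_A:A\to\mathsf{1}$, and $f t_B=\overline{f}t_A$ for every $f:A\to B$; and (b) binary restriction products: for all $A,B$ an object $A\times B$ with total maps $\pi_0:A\times B\to A$, $\pi_1:A\times B\to B$ such that for all $f:C\to A$, $g:C\to B$ there is a unique $\langle f,g\rangle:C\to A\times B$ with $\langle f,g\rangle\pi_0=\overline{g}f$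 and $\langle f,g\rangle\pi_1=\overline{f}g$. A coCartesian restriction category is a restriction category with finite coproducts $\oplus$ (initial object $\mathsf{0}$ with unique maps $z_A:\mathsf{0}\to A$, injections $\iota_j$, copairing $[-,\dots,-]$) whose injections are all total. A distributive restriction category is a restriction category that is both Cartesian and coCartesian and such that the canonical maps $[1_A\times\iota_0,\,1_A\times\iota_1]:(A\times B)\oplus(A\times C)\to A\times(B\oplus C)$ and $\langle z_A,1_{\mathsf{0}}\rangle:\mathsf{0}\to A\times\mathsf{0}$ are isomorphisms, where $1_A\times h=\langle\pi_0,\pi_1h\rangle$. **Classical products.** A distributive restriction category has classical products if it has restriction zeroes and, for all objects $A,B$, the object $A\& B:=A\oplus B\oplus(A\times B)$ with the maps $p_0:=[1_A,0,\pi_0]:A\& B\to A$ and $p_1:=[0,1_B,\pi_1]:A\& B\to B$ is a (genuine categorical) product of $A$ and $B$. **Classical restriction categories.** For parallel $f,g:A\to B$ in a restriction category: $f\le g$ means $\overline{f}g=f$; $f\smile g$ (compatible) means $\overline{f}g=\overline{g}f$; if there are restriction zeroes, $f\perp g$ (disjoint) means $\overline{f}g=0$. The join of a finite family of pairwise compatible parallel maps $f_0,\dots,f_n:A\to B$ is their least upper bound $f_0\vee\dots\vee f_n$ with respect to $\le$. A join restriction category is a restriction category in which every finite (possibly empty) pairwise compatible family of parallel maps has a join and joins are preserved by precomposition: $h(f_0\vee\dots\vee f_n)=hf_0\vee\dots\vee hf_n$. (Such a category has restriction zeroes, given by empty joins.) A classical restriction category is a join restriction category in which for all parallel $f\le g$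 there is a (necessarily unique) map $g\backslash f$ (the relative complement) with $g\backslash f\perp f$ and $g\backslash f\vee f=g$. **Classically classified.** A distributive restriction category is classically classified if it has restriction zeroes and for every map $f:A\to B$ there is a unique total map $\mathcal{T}(f):A\to B\oplus\mathsf{1}$ with $\mathcal{T}(f)\,\iota_0^\circ=f$, where $\iota_0^\circ:=[1_B,0]:B\oplus\mathsf{1}\to B$. **Exception monad.** A distributive category $\mathbb{D}$ is a category with finite products ($\times$, terminal object $\mathsf{1}$) and finite coproducts ($\oplus$, initial object $\mathsf{0}$) such that the canonical maps $(A\times B)\oplus(A\times C)\to A\times(B\oplus C)$ and $\mathsf{0}\to A\times\mathsf{0}$ are isomorphisms. Its exception monad is $A\mapsto A\oplus\mathsf{1}$ with unit $\iota_0:A\to A\oplus\mathsf{1}$ and multiplication $[\iota_0,\iota_1,\iota_1]:A\oplus\mathsf{1}\oplus\mathsf{1}\to A\oplus\mathsf{1}$. Its Kleisli category $\mathbb{D}_{\_\oplus\mathsf{1}}$ has the objects of $\mathbb{D}$; a map $A\to B$ in it is a map $A\to B\oplus\mathsf{1}$ in $\mathbb{D}$; the identity on $A$ is $\iota_0$, and the composite of $f:A\to B\oplus\mathsf{1}$ and $g:B\to C\oplus\mathsf{1}$ is $f[g,\iota_1]$. It is a restriction category where the restriction of the Kleisli map given by $f:A\to B\oplus\mathsf{1}$ is the Kleisli map $A\to A$ given by the composite in $\mathbb{D}$: $A\xrightarrow{\langle 1_A,f\rangle}A\times(B\oplus\mathsf{1})\cong(A\times B)\oplus(A\times\mathsf{1})\xrightarrow{\pi_0\oplus\pi_1}A\oplus\mathsf{1}$.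 **Restriction equivalence.** An equivalence of categories between restriction categories such that the functors preserve the restriction operator and both the unit and counit have total components. *)

theory Defs
  imports Main
begin

section \<open>Categories\<close>

text \<open>Composition is written in diagrammatic order: \<open>f \<cdot> g\<close> is first \<open>f\<close>, then \<open>g\<close>.
  The values of \<open>Dom\<close>, \<open>Cod\<close>, \<open>Ide\<close> and \<open>Comp\<close> outside \<open>Obj\<close> and \<open>Arr\<close> (or on
  non-composable pairs) are irrelevant.\<close>

record ('o, 'a) category =
  Obj :: "'o set"
  Arr :: "'a set"
  Dom :: "'a \<Rightarrow> 'o"
  Cod :: "'a \<Rightarrow> 'o"
  Ide :: "'o \<Rightarrow> 'a"
  Comp :: "'a \<Rightarrow> 'a \<Rightarrow> 'a"  (infixl "\<cdot>\<index>" 70)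

definition hom :: "('o, 'a, 'm) category_scheme \<Rightarrow> 'o \<Rightarrow> 'o \<Rightarrow> 'a set"
  where "hom C A B = {f \<in> Arr C. Dom C f = A \<and> Cod C f = B}"

locale category =
  fixes C :: "('o, 'a, 'm) category_scheme" (structure)
  assumes Dom_Obj: "f \<in> Arr C \<Longrightarrow> Dom C f \<in> Obj C"
    and Cod_Obj: "f \<in> Arr C \<Longrightarrow> Cod C f \<in> Obj C"
    and Ide_hom: "A \<in> Obj C \<Longrightarrow> Ide C A \<in> hom C A A"
    and Comp_hom: "\<lbrakk>f \<in> hom C A B; g \<in> hom C B D\<rbrakk> \<Longrightarrow> f \<cdot> g \<in> hom C A D"
    and Ide_Comp: "f \<in> hom C A B \<Longrightarrow> Ide C A \<cdot> f = f"
    and Comp_Ide: "f \<in> hom C A B \<Longrightarrow> f \<cdot> Ide C B = f"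
    and Comp_assoc:
      "\<lbrakk>f \<in> hom C A B; g \<in> hom C B D; h \<in> hom C D E\<rbrakk> \<Longrightarrow> (f \<cdot> g) \<cdot> h = f \<cdot> (g \<cdot> h)"

definition inverse_arrows :: "('o, 'a, 'm) category_scheme \<Rightarrow> 'a \<Rightarrow> 'a \<Rightarrow> bool"
  where "inverse_arrows C f g \<longleftrightarrow>
    f \<in> Arr C \<and> g \<in> hom C (Cod C f) (Dom C f) \<and>
    f \<cdot>\<^bsub>C\<^esub> g = Ide C (Dom C f) \<and> g \<cdot>\<^bsub>C\<^esub> f = Ide C (Cod C f)"

definition is_iso :: "('o, 'a, 'm) category_scheme \<Rightarrow> 'a \<Rightarrow> bool"
  where "is_iso C f \<longleftrightarrow> (\<exists>g. inverse_arrows C f g)"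

definition inv_arrow :: "('o, 'a, 'm) category_scheme \<Rightarrow> 'a \<Rightarrow> 'a"
  where "inv_arrow C f = (THE g. inverse_arrows C f g)"

definition is_terminal :: "('o, 'a, 'm) category_scheme \<Rightarrow> 'o \<Rightarrow> bool"
  where "is_terminal C T \<longleftrightarrow> T \<in> Obj C \<and> (\<forall>A \<in> Obj C. \<exists>!t. t \<in> hom C A T)"

definition is_initial :: "('o, 'a, 'm) category_scheme \<Rightarrow> 'o \<Rightarrow> bool"
  where "is_initial C I \<longleftrightarrow> I \<in> Obj C \<and> (\<forall>A \<in> Obj C. \<exists>!z. z \<in> hom C I A)"

definition is_product ::
    "('o, 'a, 'm) category_scheme \<Rightarrow> 'o \<Rightarrow> 'o \<Rightarrow> 'o \<Rightarrow> 'a \<Rightarrow> 'a \<Rightarrow> bool"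
  where "is_product C A B P p q \<longleftrightarrow>
    P \<in> Obj C \<and> p \<in> hom C P A \<and> q \<in> hom C P B \<and>
    (\<forall>D \<in> Obj C. \<forall>f \<in> hom C D A. \<forall>g \<in> hom C D B.
      \<exists>!h. h \<in> hom C D P \<and> h \<cdot>\<^bsub>C\<^esub> p = f \<and> h \<cdot>\<^bsub>C\<^esub> q = g)"

definition is_coproduct ::
    "('o, 'a, 'm) category_scheme \<Rightarrow> 'o \<Rightarrow> 'o \<Rightarrow> 'o \<Rightarrow> 'a \<Rightarrow> 'a \<Rightarrow> bool"
  where "is_coproduct C A B Q i j \<longleftrightarrow>
    Q \<in> Obj C \<and> i \<in> hom C A Q \<and> j \<in> hom C B Q \<and>
    (\<forall>D \<in> Obj C. \<forall>f \<in> hom C A D. \<forall>g \<in> hom C B D.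
      \<exists>!h. h \<in> hom C Q D \<and> i \<cdot>\<^bsub>C\<^esub> h = f \<and> j \<cdot>\<^bsub>C\<^esub> h = g)"


section \<open>Chosen products and coproducts\<close>

text \<open>A choice of \<open>\<one>\<close>, \<open>A \<times> B\<close>, \<open>\<zero>\<close>, \<open>A \<oplus> B\<close> with projections and injections. The
  same record carries ordinary products (of a distributive category) and restriction
  products (of a distributive restriction category); the universal properties are
  imposed by the locales below.\<close>

record ('o, 'a) prod_coprod =
  Terminal :: 'o
  Prod :: "'o \<Rightarrow> 'o \<Rightarrow> 'o"
  Proj0 :: "'o \<Rightarrow> 'o \<Rightarrow> 'a"
  Proj1 :: "'o \<Rightarrow> 'o \<Rightarrow> 'a"
  Initial :: 'o
  Coprod :: "'o \<Rightarrow> 'o \<Rightarrow> 'o"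
  Inj0 :: "'o \<Rightarrow> 'o \<Rightarrow> 'a"
  Inj1 :: "'o \<Rightarrow> 'o \<Rightarrow> 'a"

definition finite_coproducts ::
    "('o, 'a, 'm) category_scheme \<Rightarrow> ('o, 'a) prod_coprod \<Rightarrow> bool"
  where "finite_coproducts C S \<longleftrightarrow>
    is_initial C (Initial S) \<and>
    (\<forall>A \<in> Obj C. \<forall>B \<in> Obj C. is_coproduct C A B (Coprod S A B) (Inj0 S A B) (Inj1 S A B))"

definition finite_products ::
    "('o, 'a, 'm) category_scheme \<Rightarrow> ('o, 'a) prod_coprod \<Rightarrow> bool"
  where "finite_products C S \<longleftrightarrow>
    is_terminal C (Terminal S) \<and>
    (\<forall>A \<in> Obj C. \<forall>B \<in> Obj C. is_product C A B (Prod S A B) (Proj0 S A B) (Proj1 S A B))"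

definition from_initial ::
    "('o, 'a, 'm) category_scheme \<Rightarrow> ('o, 'a) prod_coprod \<Rightarrow> 'o \<Rightarrow> 'a"
  where "from_initial C S A = (THE z. z \<in> hom C (Initial S) A)"

definition copair ::
    "('o, 'a, 'm) category_scheme \<Rightarrow> ('o, 'a) prod_coprod \<Rightarrow> 'a \<Rightarrow> 'a \<Rightarrow> 'a"
  where "copair C S f g = (THE h.
    h \<in> hom C (Coprod S (Dom C f) (Dom C g)) (Cod C f) \<and>
    Inj0 S (Dom C f) (Dom C g) \<cdot>\<^bsub>C\<^esub> h = f \<and> Inj1 S (Dom C f) (Dom C g) \<cdot>\<^bsub>C\<^esub> h = g)"

definition coprod_map ::
    "('o, 'a, 'm) category_scheme \<Rightarrow> ('o, 'a) prod_coprod \<Rightarrow> 'a \<Rightarrow> 'a \<Rightarrow> 'a"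
  where "coprod_map C S f g =
    copair C S (f \<cdot>\<^bsub>C\<^esub> Inj0 S (Cod C f) (Cod C g)) (g \<cdot>\<^bsub>C\<^esub> Inj1 S (Cod C f) (Cod C g))"

definition pair ::
    "('o, 'a, 'm) category_scheme \<Rightarrow> ('o, 'a) prod_coprod \<Rightarrow> 'a \<Rightarrow> 'a \<Rightarrow> 'a"
  where "pair C S f g = (THE h.
    h \<in> hom C (Dom C f) (Prod S (Cod C f) (Cod C g)) \<and>
    h \<cdot>\<^bsub>C\<^esub> Proj0 S (Cod C f) (Cod C g) = f \<and> h \<cdot>\<^bsub>C\<^esub> Proj1 S (Cod C f) (Cod C g) = g)"

text \<open>The canonical maps
  \<open>[1 \<times> \<iota>\<^sub>0, 1 \<times> \<iota>\<^sub>1] : (A \<times> B) \<oplus> (A \<times> B') \<longrightarrow> A \<times> (B \<oplus> B')\<close>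
  and \<open>\<langle>z\<^sub>A, 1\<rangle> : \<zero> \<longrightarrow> A \<times> \<zero>\<close>. The argument \<open>pr\<close> is the pairing operation
  \<open>\<langle>-, -\<rangle>\<close>, either that of ordinary products or that of restriction products.\<close>

definition distributor ::
    "('o, 'a, 'm) category_scheme \<Rightarrow> ('o, 'a) prod_coprod \<Rightarrow> ('a \<Rightarrow> 'a \<Rightarrow> 'a)
      \<Rightarrow> 'o \<Rightarrow> 'o \<Rightarrow> 'o \<Rightarrow> 'a"
  where "distributor C S pr A B B' =
    copair C S (pr (Proj0 S A B) (Proj1 S A B \<cdot>\<^bsub>C\<^esub> Inj0 S B B'))
               (pr (Proj0 S A B') (Proj1 S A B' \<cdot>\<^bsub>C\<^esub> Inj1 S B B'))"

definition annihilator ::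
    "('o, 'a, 'm) category_scheme \<Rightarrow> ('o, 'a) prod_coprod \<Rightarrow> ('a \<Rightarrow> 'a \<Rightarrow> 'a) \<Rightarrow> 'o \<Rightarrow> 'a"
  where "annihilator C S pr A = pr (from_initial C S A) (Ide C (Initial S))"

locale distributive_category = category C
  for C :: "('o, 'a, 'm) category_scheme" (structure) +
  fixes S :: "('o, 'a) prod_coprod"
  assumes products: "finite_products C S"
    and coproducts: "finite_coproducts C S"
    and distributor_iso: "\<lbrakk>A \<in> Obj C; B \<in> Obj C; B' \<in> Obj C\<rbrakk>
      \<Longrightarrow> is_iso C (distributor C S (pair C S) A B B')"
    and annihilator_iso: "A \<in> Obj C \<Longrightarrow> is_iso C (annihilator C S (pair C S) A)"


section \<open>Restriction categories\<close>

record ('o, 'a) rcategory = "('o, 'a) category" +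
  Rst :: "'a \<Rightarrow> 'a"

locale restriction_category = category X
  for X :: "('o, 'a, 'm) rcategory_scheme" (structure) +
  assumes Rst_hom: "f \<in> hom X A B \<Longrightarrow> Rst X f \<in> hom X A A"
    and R1: "f \<in> hom X A B \<Longrightarrow> Rst X f \<cdot> f = f"
    and R2: "\<lbrakk>f \<in> hom X A B; g \<in> hom X A D\<rbrakk> \<Longrightarrow> Rst X f \<cdot> Rst X g = Rst X g \<cdot> Rst X f"
    and R3: "\<lbrakk>f \<in> hom X A B; g \<in> hom X A D\<rbrakk>
      \<Longrightarrow> Rst X (Rst X g \<cdot> f) = Rst X g \<cdot> Rst X f"
    and R4: "\<lbrakk>f \<in> hom X A B; g \<in> hom X B D\<rbrakk> \<Longrightarrow> f \<cdot> Rst X g = Rst X (f \<cdot> g) \<cdot> f"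

definition is_total :: "('o, 'a, 'm) rcategory_scheme \<Rightarrow> 'a \<Rightarrow> bool"
  where "is_total X f \<longleftrightarrow> f \<in> Arr X \<and> Rst X f = Ide X (Dom X f)"

text \<open>\<open>Z A B\<close> is the zero map \<open>A \<longrightarrow> B\<close>. Such a \<open>Z\<close> is unique on objects.\<close>

definition restriction_zeroes ::
    "('o, 'a, 'm) rcategory_scheme \<Rightarrow> ('o \<Rightarrow> 'o \<Rightarrow> 'a) \<Rightarrow> bool"
  where "restriction_zeroes X Z \<longleftrightarrow>
    (\<forall>A \<in> Obj X. \<forall>B \<in> Obj X. Z A B \<in> hom X A B \<and> Rst X (Z A B) = Z A A) \<and>
    (\<forall>A \<in> Obj X. \<forall>B \<in> Obj X. \<forall>f \<in> hom X A B. \<forall>D \<in> Obj X.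
      f \<cdot>\<^bsub>X\<^esub> Z B D = Z A D \<and> Z D A \<cdot>\<^bsub>X\<^esub> f = Z D B)"

definition restriction_terminal :: "('o, 'a, 'm) rcategory_scheme \<Rightarrow> 'o \<Rightarrow> bool"
  where "restriction_terminal X T \<longleftrightarrow>
    T \<in> Obj X \<and>
    (\<forall>A \<in> Obj X. \<exists>!t. t \<in> hom X A T \<and> is_total X t) \<and>
    (\<forall>A \<in> Obj X. \<forall>B \<in> Obj X. \<forall>f \<in> hom X A B. \<forall>s \<in> hom X A T. \<forall>t \<in> hom X B T.
      is_total X s \<and> is_total X t \<longrightarrow> f \<cdot>\<^bsub>X\<^esub> t = Rst X f \<cdot>\<^bsub>X\<^esub> s)"

definition is_restriction_product ::
    "('o, 'a, 'm) rcategory_scheme \<Rightarrow> 'o \<Rightarrow> 'o \<Rightarrow> 'o \<Rightarrow> 'a \<Rightarrow> 'a \<Rightarrow> bool"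
  where "is_restriction_product X A B P p q \<longleftrightarrow>
    P \<in> Obj X \<and> p \<in> hom X P A \<and> q \<in> hom X P B \<and> is_total X p \<and> is_total X q \<and>
    (\<forall>D \<in> Obj X. \<forall>f \<in> hom X D A. \<forall>g \<in> hom X D B.
      \<exists>!h. h \<in> hom X D P \<and> h \<cdot>\<^bsub>X\<^esub> p = Rst X g \<cdot>\<^bsub>X\<^esub> f \<and> h \<cdot>\<^bsub>X\<^esub> q = Rst X f \<cdot>\<^bsub>X\<^esub> g)"

definition restriction_pair ::
    "('o, 'a, 'm) rcategory_scheme \<Rightarrow> ('o, 'a) prod_coprod \<Rightarrow> 'a \<Rightarrow> 'a \<Rightarrow> 'a"
  where "restriction_pair X S f g = (THE h.
    h \<in> hom X (Dom X f) (Prod S (Cod X f) (Cod X g)) \<and>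
    h \<cdot>\<^bsub>X\<^esub> Proj0 S (Cod X f) (Cod X g) = Rst X g \<cdot>\<^bsub>X\<^esub> f \<and>
    h \<cdot>\<^bsub>X\<^esub> Proj1 S (Cod X f) (Cod X g) = Rst X f \<cdot>\<^bsub>X\<^esub> g)"

locale cartesian_restriction_category = restriction_category X
  for X :: "('o, 'a, 'm) rcategory_scheme" (structure) +
  fixes S :: "('o, 'a) prod_coprod"
  assumes restriction_terminal: "restriction_terminal X (Terminal S)"
    and restriction_products: "\<lbrakk>A \<in> Obj X; B \<in> Obj X\<rbrakk>
      \<Longrightarrow> is_restriction_product X A B (Prod S A B) (Proj0 S A B) (Proj1 S A B)"

locale cocartesian_restriction_category = restriction_category X
  for X :: "('o, 'a, 'm) rcategory_scheme" (structure) +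
  fixes S :: "('o, 'a) prod_coprod"
  assumes coproducts: "finite_coproducts X S"
    and total_Inj0: "\<lbrakk>A \<in> Obj X; B \<in> Obj X\<rbrakk> \<Longrightarrow> is_total X (Inj0 S A B)"
    and total_Inj1: "\<lbrakk>A \<in> Obj X; B \<in> Obj X\<rbrakk> \<Longrightarrow> is_total X (Inj1 S A B)"

locale distributive_restriction_category =
  cartesian_restriction_category X S + cocartesian_restriction_category X S
  for X :: "('o, 'a, 'm) rcategory_scheme" (structure) and S :: "('o, 'a) prod_coprod" +
  assumes distributor_iso: "\<lbrakk>A \<in> Obj X; B \<in> Obj X; B' \<in> Obj X\<rbrakk>
      \<Longrightarrow> is_iso X (distributor X S (restriction_pair X S) A B B')"
    and annihilator_iso: "A \<in> Obj X \<Longrightarrow> is_iso X (annihilator X S (restriction_pair X S) A)"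


section \<open>Classical products\<close>

text \<open>The ternary coproduct \<open>A \<oplus> B \<oplus> (A \<times> B)\<close> is bracketed to the right.\<close>

definition has_classical_products ::
    "('o, 'a, 'm) rcategory_scheme \<Rightarrow> ('o, 'a) prod_coprod \<Rightarrow> bool"
  where "has_classical_products X S \<longleftrightarrow>
    (\<exists>Z. restriction_zeroes X Z \<and>
      (\<forall>A \<in> Obj X. \<forall>B \<in> Obj X.
        is_product X A B
          (Coprod S A (Coprod S B (Prod S A B)))
          (copair X S (Ide X A) (copair X S (Z B A) (Proj0 S A B)))
          (copair X S (Z A B) (copair X S (Ide X B) (Proj1 S A B)))))"


section \<open>Classical restriction categories\<close>

text \<open>The relations below are meant for parallel maps.\<close>

definition restriction_le :: "('o, 'a, 'm) rcategory_scheme \<Rightarrow> 'a \<Rightarrow> 'a \<Rightarrow> bool"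
  where "restriction_le X f g \<longleftrightarrow> Rst X f \<cdot>\<^bsub>X\<^esub> g = f"

definition compatible :: "('o, 'a, 'm) rcategory_scheme \<Rightarrow> 'a \<Rightarrow> 'a \<Rightarrow> bool"
  where "compatible X f g \<longleftrightarrow> Rst X f \<cdot>\<^bsub>X\<^esub> g = Rst X g \<cdot>\<^bsub>X\<^esub> f"

definition disjoint_maps ::
    "('o, 'a, 'm) rcategory_scheme \<Rightarrow> ('o \<Rightarrow> 'o \<Rightarrow> 'a) \<Rightarrow> 'a \<Rightarrow> 'a \<Rightarrow> bool"
  where "disjoint_maps X Z f g \<longleftrightarrow> Rst X f \<cdot>\<^bsub>X\<^esub> g = Z (Dom X f) (Cod X g)"

definition is_join ::
    "('o, 'a, 'm) rcategory_scheme \<Rightarrow> 'o \<Rightarrow> 'o \<Rightarrow> 'a set \<Rightarrow> 'a \<Rightarrow> bool"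
  where "is_join X A B F j \<longleftrightarrow>
    j \<in> hom X A B \<and> (\<forall>f \<in> F. restriction_le X f j) \<and>
    (\<forall>k \<in> hom X A B. (\<forall>f \<in> F. restriction_le X f k) \<longrightarrow> restriction_le X j k)"

definition compatible_family ::
    "('o, 'a, 'm) rcategory_scheme \<Rightarrow> 'o \<Rightarrow> 'o \<Rightarrow> 'a set \<Rightarrow> bool"
  where "compatible_family X A B F \<longleftrightarrow>
    finite F \<and> F \<subseteq> hom X A B \<and> (\<forall>f \<in> F. \<forall>g \<in> F. compatible X f g)"

locale join_restriction_category = restriction_category X
  for X :: "('o, 'a, 'm) rcategory_scheme" (structure) +
  assumes join_exists:
      "\<lbrakk>A \<in> Obj X; B \<in> Obj X; compatible_family X A B F\<rbrakk> \<Longrightarrow> \<exists>j. is_join X A B F j"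
    and join_precomp:
      "\<lbrakk>compatible_family X A B F; is_join X A B F j; h \<in> hom X D A\<rbrakk>
        \<Longrightarrow> is_join X D B ((\<lambda>f. h \<cdot> f) ` F) (h \<cdot> j)"

text \<open>A join restriction category always has restriction zeroes, namely the empty joins,
  so the existential quantifier below only names them.\<close>

locale classical_restriction_category = join_restriction_category X
  for X :: "('o, 'a, 'm) rcategory_scheme" (structure) +
  assumes relative_complements:
    "\<exists>Z. restriction_zeroes X Z \<and>
      (\<forall>A \<in> Obj X. \<forall>B \<in> Obj X. \<forall>f \<in> hom X A B. \<forall>g \<in> hom X A B. restriction_le X f g \<longrightarrow>
        (\<exists>c \<in> hom X A B. disjoint_maps X Z c f \<and> is_join X A B {c, f} g))"


section \<open>Classical classification\<close>

definition classically_classified ::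
    "('o, 'a, 'm) rcategory_scheme \<Rightarrow> ('o, 'a) prod_coprod \<Rightarrow> bool"
  where "classically_classified X S \<longleftrightarrow>
    (\<exists>Z. restriction_zeroes X Z \<and>
      (\<forall>A \<in> Obj X. \<forall>B \<in> Obj X. \<forall>f \<in> hom X A B.
        \<exists>!t. t \<in> hom X A (Coprod S B (Terminal S)) \<and> is_total X t \<and>
          t \<cdot>\<^bsub>X\<^esub> copair X S (Ide X B) (Z (Terminal S) B) = f))"


section \<open>The Kleisli category of the exception monad\<close>

text \<open>A Kleisli map \<open>A \<longrightarrow> B\<close> is a triple \<open>(A, f, B)\<close> with \<open>f : A \<longrightarrow> B \<oplus> \<one>\<close> in \<open>D\<close>; the
  tags are needed because \<open>B \<oplus> \<one>\<close> need not determine \<open>B\<close>. The restriction of \<open>f\<close> is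
  \<open>A \<longrightarrow> A \<times> (B \<oplus> \<one>) \<longrightarrow> (A \<times> B) \<oplus> (A \<times> \<one>) \<longrightarrow> A \<oplus> \<one>\<close>, where the middle map is the inverse
  of the distributor.\<close>

definition exception_kleisli ::
    "('o, 'a, 'm) category_scheme \<Rightarrow> ('o, 'a) prod_coprod \<Rightarrow> ('o, 'o \<times> 'a \<times> 'o) rcategory"
  where "exception_kleisli D S = (let I = Terminal S in
    \<lparr> Obj = Obj D,
      Arr = {(A, f, B). A \<in> Obj D \<and> B \<in> Obj D \<and> f \<in> hom D A (Coprod S B I)},
      Dom = (\<lambda>(A, f, B). A),
      Cod = (\<lambda>(A, f, B). B),
      Ide = (\<lambda>A. (A, Inj0 S A I, A)),
      Comp = (\<lambda>(A, f, B) (B', g, E). (A, f \<cdot>\<^bsub>D\<^esub> copair D S g (Inj1 S E I), E)),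
      Rst = (\<lambda>(A, f, B). (A,
        pair D S (Ide D A) f \<cdot>\<^bsub>D\<^esub>
        inv_arrow D (distributor D S (pair D S) A B I) \<cdot>\<^bsub>D\<^esub>
        coprod_map D S (Proj0 S A B) (Proj1 S A I), A)) \<rparr>)"


section \<open>Restriction equivalence\<close>

definition is_functor ::
    "('o, 'a, 'm) category_scheme \<Rightarrow> ('p, 'b, 'n) category_scheme
      \<Rightarrow> ('o \<Rightarrow> 'p) \<Rightarrow> ('a \<Rightarrow> 'b) \<Rightarrow> bool"
  where "is_functor C D Fo Fa \<longleftrightarrow>
    (\<forall>A \<in> Obj C. Fo A \<in> Obj D \<and> Fa (Ide C A) = Ide D (Fo A)) \<and>
    (\<forall>A \<in> Obj C. \<forall>B \<in> Obj C. \<forall>f \<in> hom C A B. Fa f \<in> hom D (Fo A) (Fo B)) \<and>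
    (\<forall>A \<in> Obj C. \<forall>B \<in> Obj C. \<forall>E \<in> Obj C. \<forall>f \<in> hom C A B. \<forall>g \<in> hom C B E.
      Fa (f \<cdot>\<^bsub>C\<^esub> g) = Fa f \<cdot>\<^bsub>D\<^esub> Fa g)"

definition is_restriction_functor ::
    "('o, 'a, 'm) rcategory_scheme \<Rightarrow> ('p, 'b, 'n) rcategory_scheme
      \<Rightarrow> ('o \<Rightarrow> 'p) \<Rightarrow> ('a \<Rightarrow> 'b) \<Rightarrow> bool"
  where "is_restriction_functor X Y Fo Fa \<longleftrightarrow>
    is_functor X Y Fo Fa \<and> (\<forall>f \<in> Arr X. Fa (Rst X f) = Rst Y (Fa f))"

definition is_natural_iso ::
    "('o, 'a, 'm) category_scheme \<Rightarrow> ('p, 'b, 'n) category_scheme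
      \<Rightarrow> ('o \<Rightarrow> 'p) \<Rightarrow> ('a \<Rightarrow> 'b) \<Rightarrow> ('o \<Rightarrow> 'p) \<Rightarrow> ('a \<Rightarrow> 'b) \<Rightarrow> ('o \<Rightarrow> 'b) \<Rightarrow> bool"
  where "is_natural_iso C D Fo Fa Go Ga \<tau> \<longleftrightarrow>
    (\<forall>A \<in> Obj C. \<tau> A \<in> hom D (Fo A) (Go A) \<and> is_iso D (\<tau> A)) \<and>
    (\<forall>A \<in> Obj C. \<forall>B \<in> Obj C. \<forall>f \<in> hom C A B. Fa f \<cdot>\<^bsub>D\<^esub> \<tau> B = \<tau> A \<cdot>\<^bsub>D\<^esub> Ga f)"

definition restriction_equivalent ::
    "('o, 'a, 'm) rcategory_scheme \<Rightarrow> ('p, 'b, 'n) rcategory_scheme \<Rightarrow> bool"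
  where "restriction_equivalent X Y \<longleftrightarrow>
    restriction_category X \<and> restriction_category Y \<and>
    (\<exists>Fo Fa Go Ga \<eta> \<epsilon>.
      is_restriction_functor X Y Fo Fa \<and> is_restriction_functor Y X Go Ga \<and>
      is_natural_iso X X (\<lambda>A. A) (\<lambda>f. f) (\<lambda>A. Go (Fo A)) (\<lambda>f. Ga (Fa f)) \<eta> \<and>
      is_natural_iso Y Y (\<lambda>B. Fo (Go B)) (\<lambda>g. Fa (Ga g)) (\<lambda>B. B) (\<lambda>g. g) \<epsilon> \<and>
      (\<forall>A \<in> Obj X. is_total X (\<eta> A)) \<and> (\<forall>B \<in> Obj Y. is_total Y (\<epsilon> B)))"

end

theory Submission
  imports Defs
begin

text \<open>Two ideas carry the proof that the four conditions are equivalent. The implications form a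
  cycle: a classical restriction category has classical products, these give classifying maps,
  classifying maps give an exception monad, and Kleisli categories of exception monads are classical.

  The first idea is that a classical restriction category allows definition by cases. Every
  restriction \<open>Rst X f\<close> has a complement \<open>c\<close>, the two together cover the identity, and maps can be
  compared (\<open>eq_on_cover\<close>) and glued (\<open>glue_on_cover\<close>) along such a cover. A pair of partial maps
  \<open>f : D \<longrightarrow> A\<close>, \<open>g : D \<longrightarrow> B\<close> splits \<open>D\<close> into the parts where only \<open>f\<close>, only \<open>g\<close>, both or neither
  are defined, and the first three parts are what the summands of \<open>A \<oplus> (B \<oplus> (A \<times> B))\<close> record; so this
  object is the product (\<open>classical_products_if_classical\<close>). With this product, a
  partial map \<open>f : A \<longrightarrow> B\<close> is totalised by pairing it with the total map \<open>A \<longrightarrow> \<one>\<close>: the pair is always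
  defined, and folding \<open>B \<oplus> (\<one> \<oplus> (B \<times> \<one>))\<close> onto \<open>B \<oplus> \<one>\<close> gives the classifying map of \<open>f\<close>
  (\<open>classified_if_classical_products\<close>). Classification says that partial maps \<open>A \<longrightarrow> B\<close> are the same as
  total maps \<open>A \<longrightarrow> B \<oplus> \<one>\<close>, so the category is isomorphic to the Kleisli category of the exception
  monad on its total maps, which form a distributive category
  (\<open>equivalent_exception_kleisli_if_classified\<close>).

  The second idea closes the cycle: a map \<open>p : A \<longrightarrow> P \<oplus> \<one>\<close> in a distributive category can be used as
  a test. Distributivity turns \<open>\<langle>1, p\<rangle>\<close> into a map \<open>A \<longrightarrow> (A \<times> P) \<oplus> (A \<times> \<one>)\<close>, which gives an
  operation \<open>cond P p h k\<close> (\<open>h\<close> where \<open>p\<close> is defined, \<open>k\<close> elsewhere) that satisfies the usual laws of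
  if-then-else. In the Kleisli category the composite of the restriction of \<open>f\<close> with \<open>g\<close> is
  \<open>cond f g undef\<close>, the join of compatible \<open>f\<close> and \<open>g\<close> is \<open>cond f f g\<close>, and the
  complement of \<open>f\<close> in \<open>g\<close> is \<open>cond f undef g\<close>, so all axioms of a classical restriction category
  become equations about \<open>cond\<close> (\<open>classical_Kl\<close>). No appeal is made to disjointness of coproducts,
  which fails in general: a distributive lattice is a distributive category, and total Kleisli maps
  need not come from maps of the base. Being classical is a property of
  hom-sets and precomposition, hence it is reflected by full and faithful restriction functors
  (\<open>classical_if_fully_faithful\<close>), in particular by restriction equivalences.\<close>

section \<open>Calculating in categories with coproducts\<close>

text \<open>The laws of composition are restated with equations between domains and codomains in place of
  membership in hom-sets. In this form they are conditional rewrite rules whose side conditions the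
  simplifier can discharge. Equations between composites come with a variant for a further map on the
  right, because composites are normalised to right-nested form.\<close>

lemma hom_iff: "f \<in> hom C A B \<longleftrightarrow> f \<in> Arr C \<and> Dom C f = A \<and> Cod C f = B"
  by (auto simp: hom_def)

context category
begin

lemma Ide_simps [simp]:
  "A \<in> Obj C \<Longrightarrow> Ide C A \<in> Arr C"
  "A \<in> Obj C \<Longrightarrow> Dom C (Ide C A) = A"
  "A \<in> Obj C \<Longrightarrow> Cod C (Ide C A) = A"
  using Ide_hom by (auto simp: hom_iff)

lemma Comp_simps [simp]:
  assumes "f \<in> Arr C" "g \<in> Arr C" "Cod C f = Dom C g"
  shows "f \<cdot> g \<in> Arr C" "Dom C (f \<cdot> g) = Dom C f" "Cod C (f \<cdot> g) = Cod C g"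
  using Comp_hom[of f "Dom C f" "Cod C f" g "Cod C g"] assms by (auto simp: hom_iff)

lemma Ide_Comp_simp [simp]: "\<lbrakk>f \<in> Arr C; Dom C f = A\<rbrakk> \<Longrightarrow> Ide C A \<cdot> f = f"
  by (rule Ide_Comp) (auto simp: hom_iff)

lemma Comp_Ide_simp [simp]: "\<lbrakk>f \<in> Arr C; Cod C f = A\<rbrakk> \<Longrightarrow> f \<cdot> Ide C A = f"
  by (rule Comp_Ide) (auto simp: hom_iff)

lemma Comp_assoc_simp [simp]:
  "\<lbrakk>f \<in> Arr C; g \<in> Arr C; h \<in> Arr C; Cod C f = Dom C g; Cod C g = Dom C h\<rbrakk>
    \<Longrightarrow> (f \<cdot> g) \<cdot> h = f \<cdot> (g \<cdot> h)"
  by (rule Comp_assoc[of _ "Dom C f" "Cod C f" _ "Cod C g"]) (auto simp: hom_iff)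

lemma Obj_simps [simp]: "f \<in> Arr C \<Longrightarrow> Dom C f \<in> Obj C" "f \<in> Arr C \<Longrightarrow> Cod C f \<in> Obj C"
  by (simp_all add: Dom_Obj Cod_Obj)

lemma hom_Obj: "f \<in> hom C A B \<Longrightarrow> A \<in> Obj C" "f \<in> hom C A B \<Longrightarrow> B \<in> Obj C"
  by (auto simp: hom_iff)

lemma Comp_eq_Comp:
  assumes "a \<cdot> h = b" "a \<in> Arr C" "h \<in> Arr C" "Cod C a = Dom C h" "p \<in> Arr C" "Dom C p = Cod C h"
  shows "a \<cdot> (h \<cdot> p) = b \<cdot> p"
  using assms Comp_assoc_simp[of a h p] by (simp del: Comp_assoc_simp)

lemma inverse_arrows_unique:
  assumes "inverse_arrows C f g" "inverse_arrows C f g'"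
  shows "g = g'"
proof -
  have "(g \<cdot> f) \<cdot> g' = g \<cdot> (f \<cdot> g')"
    using assms by (intro Comp_assoc_simp) (auto simp: inverse_arrows_def hom_iff)
  then show ?thesis
    using assms by (simp add: inverse_arrows_def hom_iff del: Comp_assoc_simp)
qed

lemma inv_arrow_eq: "inverse_arrows C f g \<Longrightarrow> inv_arrow C f = g"
  unfolding inv_arrow_def using inverse_arrows_unique by blast

lemma inv_arrow_simps:
  assumes "is_iso C f"
  shows "f \<in> Arr C" "inv_arrow C f \<in> Arr C"
    "Dom C (inv_arrow C f) = Cod C f" "Cod C (inv_arrow C f) = Dom C f"
    "f \<cdot> inv_arrow C f = Ide C (Dom C f)" "inv_arrow C f \<cdot> f = Ide C (Cod C f)"
proof -
  have "inverse_arrows C f (inv_arrow C f)"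
    using assms inv_arrow_eq unfolding is_iso_def by metis
  then show "f \<in> Arr C" "inv_arrow C f \<in> Arr C"
    "Dom C (inv_arrow C f) = Cod C f" "Cod C (inv_arrow C f) = Dom C f"
    "f \<cdot> inv_arrow C f = Ide C (Dom C f)" "inv_arrow C f \<cdot> f = Ide C (Cod C f)"
    by (auto simp: inverse_arrows_def hom_iff)
qed

lemma iso_cancel_left:
  assumes "is_iso C f" "u \<in> Arr C" "v \<in> Arr C" "Dom C u = Cod C f" "Dom C v = Cod C f"
    and "f \<cdot> u = f \<cdot> v"
  shows "u = v"
proof -
  note f = inv_arrow_simps[OF assms(1)]
  have "u = (inv_arrow C f \<cdot> f) \<cdot> u"
    using f assms by (simp del: Comp_assoc_simp)
  also have "\<dots> = (inv_arrow C f \<cdot> f) \<cdot> v"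
    using f(1-4) assms by simp
  also have "\<dots> = v"
    using f assms by (simp del: Comp_assoc_simp)
  finally show ?thesis .
qed

end

text \<open>The part of the structure that distributive categories and coCartesian restriction categories have
  in common.\<close>

locale category_with_coproducts = category C
  for C :: "('o, 'a, 'm) category_scheme" (structure) +
  fixes S :: "('o, 'a) prod_coprod"
  assumes finite_coproducts: "finite_coproducts C S"
begin

lemma Initial_Obj [simp]: "Initial S \<in> Obj C"
  using finite_coproducts by (simp add: finite_coproducts_def is_initial_def)

lemma Initial_eqI:
  "\<lbrakk>u \<in> hom C (Initial S) A; v \<in> hom C (Initial S) A\<rbrakk> \<Longrightarrow> u = v"
  using finite_coproducts hom_Obj(2)[of u "Initial S" A]
  unfolding finite_coproducts_def is_initial_def by blast

lemma from_initial_hom: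
  assumes "A \<in> Obj C"
  shows "from_initial C S A \<in> hom C (Initial S) A"
proof -
  have "\<exists>!z. z \<in> hom C (Initial S) A"
    using finite_coproducts assms by (simp add: finite_coproducts_def is_initial_def)
  from theI'[OF this] show ?thesis by (simp add: from_initial_def)
qed

lemma Inj_simps [simp]:
  assumes "A \<in> Obj C" "B \<in> Obj C"
  shows "Coprod S A B \<in> Obj C"
    "Inj0 S A B \<in> Arr C" "Dom C (Inj0 S A B) = A" "Cod C (Inj0 S A B) = Coprod S A B"
    "Inj1 S A B \<in> Arr C" "Dom C (Inj1 S A B) = B" "Cod C (Inj1 S A B) = Coprod S A B"
  using finite_coproducts assms
  by (auto simp: finite_coproducts_def is_coproduct_def hom_iff)

lemma copair_ex1:
  assumes "f \<in> hom C A E" "g \<in> hom C B E"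
  shows "\<exists>!h. h \<in> hom C (Coprod S A B) E \<and> Inj0 S A B \<cdot> h = f \<and> Inj1 S A B \<cdot> h = g"
  using finite_coproducts assms hom_Obj[of f A E] hom_Obj[of g B E]
  unfolding finite_coproducts_def is_coproduct_def by blast

lemma copair_props:
  assumes "f \<in> Arr C" "g \<in> Arr C" "Cod C f = Cod C g"
  shows "copair C S f g \<in> hom C (Coprod S (Dom C f) (Dom C g)) (Cod C f) \<and>
    Inj0 S (Dom C f) (Dom C g) \<cdot> copair C S f g = f \<and>
    Inj1 S (Dom C f) (Dom C g) \<cdot> copair C S f g = g"
  unfolding copair_def
  by (rule theI', rule copair_ex1) (use assms in \<open>auto simp: hom_iff\<close>)

lemma copair_simps [simp]:
  assumes "f \<in> Arr C" "g \<in> Arr C" "Cod C f = Cod C g"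
  shows "copair C S f g \<in> Arr C"
    "Dom C (copair C S f g) = Coprod S (Dom C f) (Dom C g)"
    "Cod C (copair C S f g) = Cod C g"
  using copair_props[OF assms] assms by (auto simp: hom_iff)

lemma Inj_copair [simp]:
  assumes "f \<in> Arr C" "g \<in> Arr C" "Cod C f = Cod C g" "Dom C f = A" "Dom C g = B"
  shows "Inj0 S A B \<cdot> copair C S f g = f" "Inj1 S A B \<cdot> copair C S f g = g"
  using copair_props[OF assms(1-3)] assms by auto

lemma Inj_copair_Comp [simp]:
  assumes "f \<in> Arr C" "g \<in> Arr C" "Cod C f = Cod C g" "Dom C f = A" "Dom C g = B"
    and "h \<in> Arr C" "Dom C h = Cod C g"
  shows "Inj0 S A B \<cdot> (copair C S f g \<cdot> h) = f \<cdot> h" "Inj1 S A B \<cdot> (copair C S f g \<cdot> h) = g \<cdot> h"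
proof -
  have "A \<in> Obj C" "B \<in> Obj C" using assms by auto
  then show "Inj0 S A B \<cdot> (copair C S f g \<cdot> h) = f \<cdot> h" "Inj1 S A B \<cdot> (copair C S f g \<cdot> h) = g \<cdot> h"
    using assms by (simp_all flip: Comp_assoc_simp)
qed

lemma coproduct_eqI:
  assumes "u \<in> Arr C" "v \<in> Arr C" "Dom C u = Coprod S A B" "Dom C v = Coprod S A B"
    and "Cod C u = Cod C v" "A \<in> Obj C" "B \<in> Obj C"
    and "Inj0 S A B \<cdot> u = Inj0 S A B \<cdot> v" "Inj1 S A B \<cdot> u = Inj1 S A B \<cdot> v"
  shows "u = v"
proof -
  have "Inj0 S A B \<cdot> v \<in> hom C A (Cod C v)" "Inj1 S A B \<cdot> v \<in> hom C B (Cod C v)"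
    using assms by (auto simp: hom_iff)
  then have "\<exists>!h. h \<in> hom C (Coprod S A B) (Cod C v) \<and>
      Inj0 S A B \<cdot> h = Inj0 S A B \<cdot> v \<and> Inj1 S A B \<cdot> h = Inj1 S A B \<cdot> v"
    by (rule copair_ex1)
  then show ?thesis using assms by (auto simp: hom_iff)
qed

lemma copair_eqI:
  assumes "f \<in> Arr C" "g \<in> Arr C" "Cod C f = Cod C g" "h \<in> Arr C"
    and "Dom C h = Coprod S (Dom C f) (Dom C g)" "Cod C h = Cod C f"
    and "Inj0 S (Dom C f) (Dom C g) \<cdot> h = f" "Inj1 S (Dom C f) (Dom C g) \<cdot> h = g"
  shows "copair C S f g = h"
  by (rule coproduct_eqI[where A="Dom C f" and B="Dom C g"]) (use assms in auto)

lemma copair_Comp: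
  assumes "f \<in> Arr C" "g \<in> Arr C" "Cod C f = Cod C g" "h \<in> Arr C" "Dom C h = Cod C g"
  shows "copair C S f g \<cdot> h = copair C S (f \<cdot> h) (g \<cdot> h)"
  by (rule copair_eqI[symmetric]) (use assms in auto)

lemma ternary_coproduct_eqI:
  assumes "u \<in> Arr C" "v \<in> Arr C" "Dom C u = Coprod S A (Coprod S B E)"
    "Dom C v = Coprod S A (Coprod S B E)" "Cod C u = Cod C v"
    and "A \<in> Obj C" "B \<in> Obj C" "E \<in> Obj C"
    and "Inj0 S A (Coprod S B E) \<cdot> u = Inj0 S A (Coprod S B E) \<cdot> v"
    and "Inj0 S B E \<cdot> (Inj1 S A (Coprod S B E) \<cdot> u) = Inj0 S B E \<cdot> (Inj1 S A (Coprod S B E) \<cdot> v)"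
    and "Inj1 S B E \<cdot> (Inj1 S A (Coprod S B E) \<cdot> u) = Inj1 S B E \<cdot> (Inj1 S A (Coprod S B E) \<cdot> v)"
  shows "u = v"
proof (rule coproduct_eqI[where A=A and B="Coprod S B E"])
  show "Inj1 S A (Coprod S B E) \<cdot> u = Inj1 S A (Coprod S B E) \<cdot> v"
    by (rule coproduct_eqI[where A=B and B=E]) (use assms in simp_all)
qed (use assms in simp_all)

end

section \<open>Restriction categories and joins\<close>

context restriction_category
begin

lemma Rst_simps [simp]:
  assumes "f \<in> Arr X"
  shows "Rst X f \<in> Arr X" "Dom X (Rst X f) = Dom X f" "Cod X (Rst X f) = Dom X f"
  using Rst_hom[of f "Dom X f" "Cod X f"] assms by (auto simp: hom_iff)

lemma Rst_Comp_self [simp]: "f \<in> Arr X \<Longrightarrow> Rst X f \<cdot> f = f"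
  using R1[of f "Dom X f" "Cod X f"] by (simp add: hom_iff)

lemma Rst_Comp_self_Comp [simp]:
  "\<lbrakk>f \<in> Arr X; g \<in> Arr X; Cod X f = Dom X g\<rbrakk> \<Longrightarrow> Rst X f \<cdot> (f \<cdot> g) = f \<cdot> g"
  by (simp flip: Comp_assoc_simp)

lemma Rst_commute:
  "\<lbrakk>f \<in> Arr X; g \<in> Arr X; Dom X f = Dom X g\<rbrakk> \<Longrightarrow> Rst X f \<cdot> Rst X g = Rst X g \<cdot> Rst X f"
  using R2[of f "Dom X f" "Cod X f" g "Cod X g"] by (simp add: hom_iff)

lemma Rst_commute_Comp:
  "\<lbrakk>f \<in> Arr X; g \<in> Arr X; h \<in> Arr X; Dom X f = Dom X g; Dom X h = Dom X g\<rbrakk>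
    \<Longrightarrow> Rst X f \<cdot> (Rst X g \<cdot> h) = Rst X g \<cdot> (Rst X f \<cdot> h)"
  using Rst_commute[of f g] Comp_assoc_simp[of "Rst X f" "Rst X g" h]
    Comp_assoc_simp[of "Rst X g" "Rst X f" h]
  by (simp del: Comp_assoc_simp)

lemma Rst_Rst_Comp [simp]:
  "\<lbrakk>f \<in> Arr X; g \<in> Arr X; Dom X f = Dom X g\<rbrakk> \<Longrightarrow> Rst X (Rst X g \<cdot> f) = Rst X g \<cdot> Rst X f"
  using R3[of f "Dom X f" "Cod X f" g "Cod X g"] by (simp add: hom_iff)

lemma Comp_Rst:
  "\<lbrakk>f \<in> Arr X; g \<in> Arr X; Cod X f = Dom X g\<rbrakk> \<Longrightarrow> f \<cdot> Rst X g = Rst X (f \<cdot> g) \<cdot> f"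
  using R4[of f "Dom X f" "Cod X f" g "Cod X g"] by (simp add: hom_iff)

lemma Comp_Rst_Comp:
  assumes "f \<in> Arr X" "g \<in> Arr X" "h \<in> Arr X" "Cod X f = Dom X g" "Dom X h = Dom X g"
  shows "f \<cdot> (Rst X g \<cdot> h) = Rst X (f \<cdot> g) \<cdot> (f \<cdot> h)"
proof -
  have "f \<cdot> (Rst X g \<cdot> h) = (f \<cdot> Rst X g) \<cdot> h"
    using assms by simp
  also have "\<dots> = Rst X (f \<cdot> g) \<cdot> (f \<cdot> h)"
    unfolding Comp_Rst[OF assms(1,2,4)] using assms by simp
  finally show ?thesis .
qed

lemma Rst_Ide [simp]: "A \<in> Obj X \<Longrightarrow> Rst X (Ide X A) = Ide X A"
  using Rst_Comp_self[of "Ide X A"] Comp_Ide_simp[of "Rst X (Ide X A)" A]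
  by (simp del: Rst_Comp_self Comp_Ide_simp)

lemma Rst_Rst [simp]: "f \<in> Arr X \<Longrightarrow> Rst X (Rst X f) = Rst X f"
  using Rst_Rst_Comp[of "Ide X (Dom X f)" f] by (simp del: Rst_Rst_Comp)

lemma Rst_idem [simp]: "f \<in> Arr X \<Longrightarrow> Rst X f \<cdot> Rst X f = Rst X f"
  using Rst_Rst_Comp[of f f] by (simp del: Rst_Rst_Comp)

lemma Rst_idem_Comp [simp]:
  "\<lbrakk>f \<in> Arr X; h \<in> Arr X; Dom X h = Dom X f\<rbrakk> \<Longrightarrow> Rst X f \<cdot> (Rst X f \<cdot> h) = Rst X f \<cdot> h"
  by (simp flip: Comp_assoc_simp)

lemma Rst_Comp_absorb:
  "\<lbrakk>f \<in> Arr X; g \<in> Arr X; Cod X f = Dom X g\<rbrakk> \<Longrightarrow> Rst X f \<cdot> Rst X (f \<cdot> g) = Rst X (f \<cdot> g)"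
  using Rst_Rst_Comp[of "f \<cdot> g" f] by (simp del: Rst_Rst_Comp)

lemma Rst_Comp_Rst:
  assumes "f \<in> Arr X" "g \<in> Arr X" "Cod X f = Dom X g"
  shows "Rst X (f \<cdot> Rst X g) = Rst X (f \<cdot> g)"
proof -
  have "Rst X (f \<cdot> Rst X g) = Rst X (Rst X (f \<cdot> g) \<cdot> f)"
    unfolding Comp_Rst[OF assms] ..
  also have "\<dots> = Rst X (f \<cdot> g) \<cdot> Rst X f"
    using assms by simp
  also have "\<dots> = Rst X f \<cdot> Rst X (f \<cdot> g)"
    by (rule Rst_commute) (use assms in auto)
  finally show ?thesis
    using assms by (simp only: Rst_Comp_absorb)
qed

lemma is_total_iff: "is_total X f \<longleftrightarrow> f \<in> Arr X \<and> Rst X f = Ide X (Dom X f)"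
  by (simp add: is_total_def)

lemma Rst_Comp_total:
  assumes "f \<in> Arr X" "is_total X g" "Cod X f = Dom X g"
  shows "Rst X (f \<cdot> g) = Rst X f"
  using assms Rst_Comp_Rst[of f g] by (simp add: is_total_iff)

lemma total_Ide: "A \<in> Obj X \<Longrightarrow> is_total X (Ide X A)"
  by (simp add: is_total_iff)

lemma total_Comp:
  assumes "is_total X f" "is_total X g" "Cod X f = Dom X g"
  shows "is_total X (f \<cdot> g)"
  using assms Rst_Comp_total[of f g] by (simp add: is_total_iff)

lemma total_if_Comp_total:
  assumes "f \<in> Arr X" "g \<in> Arr X" "Cod X f = Dom X g" "is_total X (f \<cdot> g)"
  shows "is_total X f"
  using assms Rst_Comp_absorb[of f g] by (simp add: is_total_iff)

lemma total_iso:
  assumes "is_iso X f" shows "is_total X f"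
  using inv_arrow_simps[OF assms] total_if_Comp_total[of f "inv_arrow X f"] total_Ide by simp

subsection \<open>The restriction order\<close>

lemma le_antisym:
  assumes "f \<in> hom X A B" "g \<in> hom X A B" "restriction_le X f g" "restriction_le X g f"
  shows "f = g"
proof -
  have "f = Rst X f \<cdot> (Rst X g \<cdot> f)"
    using assms by (simp add: restriction_le_def)
  also have "\<dots> = Rst X g \<cdot> (Rst X f \<cdot> f)"
    by (rule Rst_commute_Comp) (use assms in \<open>auto simp: hom_iff\<close>)
  also have "\<dots> = g"
    using assms by (simp add: hom_iff restriction_le_def)
  finally show ?thesis .
qed

lemma le_trans:
  assumes "f \<in> hom X A B" "g \<in> hom X A B" "h \<in> hom X A B"
    and "restriction_le X f g" "restriction_le X g h"
  shows "restriction_le X f h"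
proof -
  have "Rst X f = Rst X f \<cdot> Rst X g"
    using assms Rst_Rst_Comp[of g f] by (simp add: hom_iff restriction_le_def)
  then have "Rst X f \<cdot> h = Rst X f \<cdot> (Rst X g \<cdot> h)"
    using assms Comp_assoc_simp[of "Rst X f" "Rst X g" h]
    by (simp add: hom_iff del: Comp_assoc_simp)
  then show ?thesis
    using assms by (simp add: restriction_le_def)
qed

lemma compatible_precomp:
  assumes "f \<in> hom X A B" "g \<in> hom X A B" "h \<in> hom X D A" "compatible X f g"
  shows "compatible X (h \<cdot> f) (h \<cdot> g)"
proof -
  have "Rst X (h \<cdot> f) \<cdot> (h \<cdot> g) = h \<cdot> (Rst X f \<cdot> g)"
    by (rule Comp_Rst_Comp[symmetric]) (use assms in \<open>auto simp: hom_iff\<close>)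
  also have "\<dots> = h \<cdot> (Rst X g \<cdot> f)"
    using assms by (simp add: compatible_def)
  also have "\<dots> = Rst X (h \<cdot> g) \<cdot> (h \<cdot> f)"
    by (rule Comp_Rst_Comp) (use assms in \<open>auto simp: hom_iff\<close>)
  finally show ?thesis by (simp add: compatible_def)
qed

lemma is_join_unique:
  assumes "is_join X A B F j" "is_join X A B F k" shows "j = k"
  using assms le_antisym[of j A B k] unfolding is_join_def by blast

text \<open>The induction step for building finite joins from binary ones.\<close>

lemma is_join_insert:
  assumes "is_join X A B F j" "is_join X A B {j, f} k" "f \<in> hom X A B" "F \<subseteq> hom X A B"
  shows "is_join X A B (insert f F) k"
proof -
  have jk: "j \<in> hom X A B" "k \<in> hom X A B" "restriction_le X j k" "restriction_le X f k"
    using assms by (auto simp: is_join_def)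
  have "restriction_le X g k" if "g \<in> F" for g
    by (rule le_trans[of g A B j]) (use that assms jk in \<open>auto simp: is_join_def\<close>)
  moreover have "restriction_le X k m"
    if "m \<in> hom X A B" "\<forall>g \<in> insert f F. restriction_le X g m" for m
    using that assms by (auto simp: is_join_def)
  ultimately show ?thesis
    using jk by (auto simp: is_join_def)
qed

end

locale restriction_category_with_zeroes = restriction_category X
  for X :: "('o, 'a, 'm) rcategory_scheme" (structure) +
  fixes Z :: "'o \<Rightarrow> 'o \<Rightarrow> 'a"
  assumes zeroes: "restriction_zeroes X Z"
begin

lemma zero_simps [simp]:
  assumes "A \<in> Obj X" "B \<in> Obj X"
  shows "Z A B \<in> Arr X" "Dom X (Z A B) = A" "Cod X (Z A B) = B" "Rst X (Z A B) = Z A A"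
  using zeroes assms by (simp_all add: restriction_zeroes_def hom_iff)

lemma Comp_zero [simp]:
  assumes "f \<in> Arr X" "Cod X f = B" "D \<in> Obj X"
  shows "f \<cdot> Z B D = Z (Dom X f) D"
proof -
  have "f \<in> hom X (Dom X f) B" "Dom X f \<in> Obj X" "B \<in> Obj X"
    using assms by (auto simp: hom_iff)
  then show ?thesis
    using zeroes assms(3) unfolding restriction_zeroes_def by blast
qed

lemma zero_Comp [simp]:
  assumes "f \<in> Arr X" "Dom X f = A" "D \<in> Obj X"
  shows "Z D A \<cdot> f = Z D (Cod X f)"
proof -
  have "f \<in> hom X A (Cod X f)" "A \<in> Obj X" "Cod X f \<in> Obj X"
    using assms by (auto simp: hom_iff)
  then show ?thesis
    using zeroes assms(3) unfolding restriction_zeroes_def by blast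
qed

end

text \<open>Restriction zeroes are what the empty joins will be. The binary join is allowed to be any
  operation that gives joins of compatible pairs, is stable under precomposition and keeps
  compatibility with third maps: the last condition makes the induction over finite families work.\<close>

locale binary_join_restriction_category = restriction_category_with_zeroes X Z
  for X :: "('o, 'a, 'm) rcategory_scheme" (structure) and Z :: "'o \<Rightarrow> 'o \<Rightarrow> 'a" +
  fixes J :: "'a \<Rightarrow> 'a \<Rightarrow> 'a"
  assumes binary_join: "\<lbrakk>f \<in> hom X A B; g \<in> hom X A B; compatible X f g\<rbrakk>
      \<Longrightarrow> is_join X A B {f, g} (J f g)"
    and binary_join_compatible: "\<lbrakk>f \<in> hom X A B; g \<in> hom X A B; k \<in> hom X A B;
        compatible X f g; compatible X f k; compatible X g k\<rbrakk> \<Longrightarrow> compatible X (J f g) k"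
    and binary_join_precomp: "\<lbrakk>f \<in> hom X A B; g \<in> hom X A B; compatible X f g; h \<in> hom X D A\<rbrakk>
      \<Longrightarrow> h \<cdot> J f g = J (h \<cdot> f) (h \<cdot> g)"
begin

text \<open>The induction has to carry two further properties of the join: compatibility with every map that
  is compatible with the family, so that the next map can be joined to it, and stability under
  precomposition.\<close>

lemma stable_join_exists:
  assumes "A \<in> Obj X" "B \<in> Obj X" "compatible_family X A B F"
  shows "\<exists>j. is_join X A B F j \<and>
    (\<forall>k \<in> hom X A B. (\<forall>f \<in> F. compatible X f k) \<longrightarrow> compatible X j k) \<and>
    (\<forall>D. \<forall>h \<in> hom X D A. is_join X D B ((\<lambda>f. h \<cdot> f) ` F) (h \<cdot> j))"
proof -
  have "finite F" using assms by (simp add: compatible_family_def)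
  then show ?thesis using assms(3)
  proof (induction F rule: finite_induct)
    case empty
    have join: "is_join X D B {} (Z D B)" if "D \<in> Obj X" for D
      using assms(2) that by (auto simp: is_join_def restriction_le_def hom_iff)
    show ?case
    proof (intro exI[of _ "Z A B"] conjI ballI allI impI)
      show "is_join X A B {} (Z A B)" by (rule join[OF assms(1)])
      show "compatible X (Z A B) k" if "k \<in> hom X A B" for k
        using assms that by (simp add: compatible_def hom_iff)
      fix D h assume h: "h \<in> hom X D A"
      then have "h \<cdot> Z A B = Z D B" using assms by (simp add: hom_iff)
      then show "is_join X D B ((\<lambda>f. h \<cdot> f) ` {}) (h \<cdot> Z A B)"
        using join[OF hom_Obj(1)[OF h]] by simp
    qed
  next
    case (insert f F)
    have F: "compatible_family X A B F" "f \<in> hom X A B" "F \<subseteq> hom X A B"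
      and Ff: "\<And>g. g \<in> F \<Longrightarrow> compatible X g f"
      using insert.prems by (auto simp: compatible_family_def)
    obtain j where j: "is_join X A B F j"
      and comp: "\<And>k. \<lbrakk>k \<in> hom X A B; \<forall>f \<in> F. compatible X f k\<rbrakk> \<Longrightarrow> compatible X j k"
      and stable: "\<And>D h. h \<in> hom X D A \<Longrightarrow> is_join X D B ((\<lambda>f. h \<cdot> f) ` F) (h \<cdot> j)"
      using insert.IH[OF F(1)] by blast
    have jh: "j \<in> hom X A B" using j by (simp add: is_join_def)
    have jf: "compatible X j f" using comp F Ff by blast
    show ?case
    proof (intro exI[of _ "J j f"] conjI ballI allI impI)
      show "is_join X A B (insert f F) (J j f)"
        using is_join_insert[OF j binary_join[OF jh F(2) jf]] F by blast
    next
      fix k assume k: "k \<in> hom X A B" "\<forall>g \<in> insert f F. compatible X g k"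
      then show "compatible X (J j f) k"
        using binary_join_compatible[OF jh F(2) _ jf] comp by blast
    next
      fix D h assume h: "h \<in> hom X D A"
      have hj: "h \<cdot> j \<in> hom X D B" "h \<cdot> f \<in> hom X D B" "(\<lambda>f. h \<cdot> f) ` F \<subseteq> hom X D B"
        using h jh F by (auto simp: hom_iff)
      have "is_join X D B {h \<cdot> j, h \<cdot> f} (J (h \<cdot> j) (h \<cdot> f))"
        using binary_join[OF hj(1,2)] compatible_precomp[OF jh F(2) h jf] by blast
      then have "is_join X D B {h \<cdot> j, h \<cdot> f} (h \<cdot> J j f)"
        using binary_join_precomp[OF jh F(2) jf h] by simp
      from is_join_insert[OF stable[OF h] this hj(2,3)]
      show "is_join X D B ((\<lambda>f. h \<cdot> f) ` insert f F) (h \<cdot> J j f)" by simp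
    qed
  qed
qed

lemma join_restriction_category: "join_restriction_category X"
proof
  fix A B F assume "A \<in> Obj X" "B \<in> Obj X" "compatible_family X A B F"
  then show "\<exists>j. is_join X A B F j" using stable_join_exists by blast
next
  fix A B F j h D
  assume F: "compatible_family X A B F" and j: "is_join X A B F j" and h: "h \<in> hom X D A"
  have "A \<in> Obj X" "B \<in> Obj X" using j by (auto simp: is_join_def hom_iff)
  from stable_join_exists[OF this F]
  obtain j' where "is_join X A B F j'" "is_join X D B ((\<lambda>f. h \<cdot> f) ` F) (h \<cdot> j')"
    using h by blast
  then show "is_join X D B ((\<lambda>f. h \<cdot> f) ` F) (h \<cdot> j)"
    using is_join_unique[OF j] by simp
qed

end

text \<open>The order, compatibility, joins, zeroes and relative complements are expressed by composition and
  restriction inside hom-sets, and stability of joins by precomposition. All of this transfers along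
  bijections of hom-sets that commute with composition and restriction.\<close>

lemma classical_if_fully_faithful:
  assumes X: "restriction_category X" and Y: "classical_restriction_category Y"
    and F: "is_restriction_functor X Y Fo Fa"
    and bij: "\<And>A B. \<lbrakk>A \<in> Obj X; B \<in> Obj X\<rbrakk>
      \<Longrightarrow> bij_betw Fa (hom X A B) (hom Y (Fo A) (Fo B))"
  shows "classical_restriction_category X"
proof -
  interpret X: restriction_category X by (rule X)
  interpret Y: classical_restriction_category Y by (rule Y)
  have Fo: "Fo A \<in> Obj Y" if "A \<in> Obj X" for A
    using F that by (simp add: is_restriction_functor_def is_functor_def)
  have Fhom: "Fa f \<in> hom Y (Fo A) (Fo B)" if "f \<in> hom X A B" for f A B
    using F that X.hom_Obj[OF that] by (simp add: is_restriction_functor_def is_functor_def)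
  have FComp: "Fa (f \<cdot>\<^bsub>X\<^esub> g) = Fa f \<cdot>\<^bsub>Y\<^esub> Fa g" if "f \<in> hom X A B" "g \<in> hom X B D" for f g A B D
    using F that X.hom_Obj[OF that(1)] X.hom_Obj[OF that(2)]
    unfolding is_restriction_functor_def is_functor_def by blast
  have FRst: "Fa (Rst X f) = Rst Y (Fa f)" if "f \<in> hom X A B" for f A B
    using F that by (simp add: is_restriction_functor_def hom_iff)
  have inj: "f = g" if "f \<in> hom X A B" "g \<in> hom X A B" "Fa f = Fa g" for f g A B
    using bij[OF X.hom_Obj[OF that(1)]] that by (auto simp: bij_betw_def inj_on_def)
  have surj: "\<exists>f \<in> hom X A B. Fa f = g"
    if "A \<in> Obj X" "B \<in> Obj X" "g \<in> hom Y (Fo A) (Fo B)" for g A B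
    using bij[OF that(1,2)] that by (auto simp: bij_betw_def image_iff) (metis image_iff)
  have FRC: "Fa (Rst X f \<cdot>\<^bsub>X\<^esub> g) = Rst Y (Fa f) \<cdot>\<^bsub>Y\<^esub> Fa g"
    if "f \<in> hom X A B" "g \<in> hom X A B" for f g A B
    using FComp[OF X.Rst_hom[OF that(1)] that(2)] FRst[OF that(1)] by simp
  have le: "restriction_le X f g \<longleftrightarrow> restriction_le Y (Fa f) (Fa g)"
    if "f \<in> hom X A B" "g \<in> hom X A B" for f g A B
  proof -
    have "Rst X f \<cdot>\<^bsub>X\<^esub> g \<in> hom X A B"
      using that by (auto simp: hom_iff)
    then show ?thesis
      using FRC[OF that] inj[OF _ that(1)] by (auto simp: restriction_le_def)
  qed
  have comp: "compatible X f g \<longleftrightarrow> compatible Y (Fa f) (Fa g)"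
    if "f \<in> hom X A B" "g \<in> hom X A B" for f g A B
  proof -
    have "Rst X f \<cdot>\<^bsub>X\<^esub> g \<in> hom X A B" "Rst X g \<cdot>\<^bsub>X\<^esub> f \<in> hom X A B"
      using that by (auto simp: hom_iff)
    then show ?thesis
      using FRC[OF that] FRC[OF that(2,1)] inj by (auto simp: compatible_def)
  qed
  have join: "is_join X A B E j \<longleftrightarrow> j \<in> hom X A B \<and> is_join Y (Fo A) (Fo B) (Fa ` E) (Fa j)"
    if "A \<in> Obj X" "B \<in> Obj X" "E \<subseteq> hom X A B" for A B E j
  proof -
    have "(\<forall>k \<in> hom X A B. (\<forall>f \<in> E. restriction_le X f k) \<longrightarrow> restriction_le X j k) \<longleftrightarrow>
        (\<forall>k \<in> hom Y (Fo A) (Fo B). (\<forall>f \<in> E. restriction_le Y (Fa f) k)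
          \<longrightarrow> restriction_le Y (Fa j) k)" if j: "j \<in> hom X A B"
    proof -
      have "(\<forall>k \<in> hom X A B. (\<forall>f \<in> E. restriction_le X f k) \<longrightarrow> restriction_le X j k) \<longleftrightarrow>
          (\<forall>k \<in> hom X A B. (\<forall>f \<in> E. restriction_le Y (Fa f) (Fa k))
            \<longrightarrow> restriction_le Y (Fa j) (Fa k))"
        using le j \<open>E \<subseteq> hom X A B\<close> by (metis subset_iff)
      also have "\<dots> \<longleftrightarrow> (\<forall>k \<in> Fa ` hom X A B. (\<forall>f \<in> E. restriction_le Y (Fa f) k)
          \<longrightarrow> restriction_le Y (Fa j) k)"
        by blast
      also have "Fa ` hom X A B = hom Y (Fo A) (Fo B)"
        using bij[OF \<open>A \<in> Obj X\<close> \<open>B \<in> Obj X\<close>] by (simp add: bij_betw_def)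
      finally show ?thesis .
    qed
    moreover have "(\<forall>f \<in> E. restriction_le X f j) \<longleftrightarrow> (\<forall>f \<in> E. restriction_le Y (Fa f) (Fa j))"
      if "j \<in> hom X A B"
      using le that \<open>E \<subseteq> hom X A B\<close> by (metis subset_iff)
    ultimately show ?thesis
      using Fhom unfolding is_join_def by auto
  qed
  have family: "compatible_family Y (Fo A) (Fo B) (Fa ` E)"
    if "compatible_family X A B E" for A B E
  proof -
    have E: "finite E" "E \<subseteq> hom X A B" "\<And>f g. \<lbrakk>f \<in> E; g \<in> E\<rbrakk> \<Longrightarrow> compatible X f g"
      using that by (auto simp: compatible_family_def)
    then have "compatible Y (Fa f) (Fa g)" if "f \<in> E" "g \<in> E" for f g
      using that comp[of f A B g] by blast
    then show ?thesis using E Fhom by (auto simp: compatible_family_def)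
  qed
  obtain Z where Z: "restriction_zeroes Y Z"
    and compl: "\<And>A B f g. \<lbrakk>A \<in> Obj Y; B \<in> Obj Y; f \<in> hom Y A B; g \<in> hom Y A B;
        restriction_le Y f g\<rbrakk> \<Longrightarrow>
        \<exists>c \<in> hom Y A B. disjoint_maps Y Z c f \<and> is_join Y A B {c, f} g"
    using Y.relative_complements by blast
  interpret YZ: restriction_category_with_zeroes Y Z
    by standard (rule Z)
  \<comment> \<open>The zero map is pulled back through the bijection of hom-sets.\<close>
  define W where "W A B = (SOME z. z \<in> hom X A B \<and> Fa z = Z (Fo A) (Fo B))" for A B
  have W: "W A B \<in> hom X A B" "Fa (W A B) = Z (Fo A) (Fo B)"
    if "A \<in> Obj X" "B \<in> Obj X" for A B
  proof -
    have "\<exists>z. z \<in> hom X A B \<and> Fa z = Z (Fo A) (Fo B)"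
      using surj[OF that, of "Z (Fo A) (Fo B)"] Fo that by (auto simp: hom_iff)
    from someI_ex[OF this]
    show "W A B \<in> hom X A B" "Fa (W A B) = Z (Fo A) (Fo B)"
      by (simp_all add: W_def)
  qed
  have W_zeroes: "restriction_zeroes X W"
    unfolding restriction_zeroes_def
  proof (intro conjI ballI)
    fix A B assume AB: "A \<in> Obj X" "B \<in> Obj X"
    show "W A B \<in> hom X A B" by (rule W(1)[OF AB])
    show "Rst X (W A B) = W A A"
    proof (rule inj)
      show "Rst X (W A B) \<in> hom X A A" by (rule X.Rst_hom[OF W(1)[OF AB]])
      show "W A A \<in> hom X A A" by (rule W(1)[OF AB(1,1)])
      show "Fa (Rst X (W A B)) = Fa (W A A)"
        unfolding FRst[OF W(1)[OF AB]] W(2)[OF AB] W(2)[OF AB(1,1)]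
        using AB by (simp add: Fo)
    qed
    fix f D assume f: "f \<in> hom X A B" and D: "D \<in> Obj X"
    have Ff: "Fa f \<in> Arr Y" "Dom Y (Fa f) = Fo A" "Cod Y (Fa f) = Fo B"
      using Fhom[OF f] by (auto simp: hom_iff)
    show "f \<cdot>\<^bsub>X\<^esub> W B D = W A D"
    proof (rule inj)
      show "f \<cdot>\<^bsub>X\<^esub> W B D \<in> hom X A D" by (rule X.Comp_hom[OF f W(1)[OF AB(2) D]])
      show "W A D \<in> hom X A D" by (rule W(1)[OF AB(1) D])
      show "Fa (f \<cdot>\<^bsub>X\<^esub> W B D) = Fa (W A D)"
        unfolding FComp[OF f W(1)[OF AB(2) D]] W(2)[OF AB(2) D] W(2)[OF AB(1) D]
        using Ff D by (simp add: Fo)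
    qed
    show "W D A \<cdot>\<^bsub>X\<^esub> f = W D B"
    proof (rule inj)
      show "W D A \<cdot>\<^bsub>X\<^esub> f \<in> hom X D B" by (rule X.Comp_hom[OF W(1)[OF D AB(1)] f])
      show "W D B \<in> hom X D B" by (rule W(1)[OF D AB(2)])
      show "Fa (W D A \<cdot>\<^bsub>X\<^esub> f) = Fa (W D B)"
        unfolding FComp[OF W(1)[OF D AB(1)] f] W(2)[OF D AB(1)] W(2)[OF D AB(2)]
        using Ff D by (simp add: Fo)
    qed
  qed
  show ?thesis
  proof
    fix A B E assume AB: "A \<in> Obj X" "B \<in> Obj X" and E: "compatible_family X A B E"
    obtain k where k: "is_join Y (Fo A) (Fo B) (Fa ` E) k"
      using Y.join_exists[OF Fo[OF AB(1)] Fo[OF AB(2)] family[OF E]] by blast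
    then have "k \<in> hom Y (Fo A) (Fo B)" by (simp add: is_join_def)
    then obtain j where "j \<in> hom X A B" "Fa j = k"
      using surj[OF AB] by blast
    then show "\<exists>j. is_join X A B E j"
      using join[OF AB] E k by (auto simp: compatible_family_def)
  next
    fix A B E j h D
    assume E: "compatible_family X A B E" and j: "is_join X A B E j" and h: "h \<in> hom X D A"
    have jh: "j \<in> hom X A B" using j by (simp add: is_join_def)
    have E': "E \<subseteq> hom X A B" using E by (simp add: compatible_family_def)
    have AB: "A \<in> Obj X" "B \<in> Obj X" "D \<in> Obj X"
      using X.hom_Obj[OF jh] X.hom_Obj[OF h] by auto
    have "is_join Y (Fo D) (Fo B) ((\<lambda>f. Fa h \<cdot>\<^bsub>Y\<^esub> f) ` Fa ` E) (Fa h \<cdot>\<^bsub>Y\<^esub> Fa j)"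
      by (rule Y.join_precomp[OF family[OF E] _ Fhom[OF h]]) (use join[OF AB(1,2) E'] j in blast)
    moreover have "(\<lambda>f. Fa h \<cdot>\<^bsub>Y\<^esub> f) ` Fa ` E = Fa ` (\<lambda>f. h \<cdot>\<^bsub>X\<^esub> f) ` E"
      unfolding image_image using FComp[OF h] E' by (intro image_cong) auto
    moreover have "Fa h \<cdot>\<^bsub>Y\<^esub> Fa j = Fa (h \<cdot>\<^bsub>X\<^esub> j)" using FComp[OF h jh] by simp
    moreover have "(\<lambda>f. h \<cdot>\<^bsub>X\<^esub> f) ` E \<subseteq> hom X D B" "h \<cdot>\<^bsub>X\<^esub> j \<in> hom X D B"
      using h E' jh by (auto simp: hom_iff)
    ultimately show "is_join X D B ((\<lambda>f. h \<cdot>\<^bsub>X\<^esub> f) ` E) (h \<cdot>\<^bsub>X\<^esub> j)"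
      using join[OF AB(3,2)] by simp
  next
    show "\<exists>Z. restriction_zeroes X Z \<and>
      (\<forall>A \<in> Obj X. \<forall>B \<in> Obj X. \<forall>f \<in> hom X A B. \<forall>g \<in> hom X A B. restriction_le X f g \<longrightarrow>
        (\<exists>c \<in> hom X A B. disjoint_maps X Z c f \<and> is_join X A B {c, f} g))"
    proof (intro exI[of _ W] conjI W_zeroes ballI impI)
      fix A B f g
      assume AB: "A \<in> Obj X" "B \<in> Obj X" and fg: "f \<in> hom X A B" "g \<in> hom X A B"
        and "restriction_le X f g"
      then have "restriction_le Y (Fa f) (Fa g)" using le by blast
      from compl[OF Fo[OF AB(1)] Fo[OF AB(2)] Fhom[OF fg(1)] Fhom[OF fg(2)] this]
      obtain c where c: "c \<in> hom X A B" "disjoint_maps Y Z (Fa c) (Fa f)"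
        "is_join Y (Fo A) (Fo B) {Fa c, Fa f} (Fa g)"
        using surj[OF AB] by blast
      have "Rst X c \<cdot>\<^bsub>X\<^esub> f = W A B"
      proof (rule inj[of _ A B])
        show "Rst X c \<cdot>\<^bsub>X\<^esub> f \<in> hom X A B" using c fg by (auto simp: hom_iff)
        show "W A B \<in> hom X A B" using W[OF AB] by simp
        show "Fa (Rst X c \<cdot>\<^bsub>X\<^esub> f) = Fa (W A B)"
          using FRC[OF c(1) fg(1)] W[OF AB] c(2) Fhom[OF c(1)] Fhom[OF fg(1)]
          by (simp add: disjoint_maps_def hom_iff)
      qed
      then have "disjoint_maps X W c f"
        using c fg by (simp add: disjoint_maps_def hom_iff)
      moreover have "is_join X A B {c, f} g"
        using join[OF AB, of "{c, f}" g] c fg by simp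
      ultimately show "\<exists>c \<in> hom X A B. disjoint_maps X W c f \<and> is_join X A B {c, f} g"
        using c(1) by blast
    qed
  qed
qed

section \<open>Case distinction in distributive categories\<close>

sublocale distributive_category \<subseteq> category_with_coproducts C S
  by standard (rule coproducts)

context distributive_category
begin

abbreviation unit_object ("\<one>") where "\<one> \<equiv> Terminal S"
abbreviation plus_one where "plus_one B \<equiv> Coprod S B \<one>"

lemma Terminal_Obj [simp]: "\<one> \<in> Obj C"
  using products by (simp add: finite_products_def is_terminal_def)

lemma Terminal_eqI: "\<lbrakk>u \<in> hom C A \<one>; v \<in> hom C A \<one>\<rbrakk> \<Longrightarrow> u = v"
  using products hom_Obj(1)[of u A \<one>] unfolding finite_products_def is_terminal_def by blast

definition to_one where "to_one A = (THE t. t \<in> hom C A \<one>)"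

lemma to_one_hom: "A \<in> Obj C \<Longrightarrow> to_one A \<in> hom C A \<one>"
  unfolding to_one_def
  by (rule theI') (use products in \<open>simp add: finite_products_def is_terminal_def\<close>)

lemma to_one_simps [simp]:
  assumes "A \<in> Obj C"
  shows "to_one A \<in> Arr C" "Dom C (to_one A) = A" "Cod C (to_one A) = \<one>"
  using to_one_hom[OF assms] by (auto simp: hom_iff)

lemma to_one_unique: "\<lbrakk>f \<in> Arr C; Cod C f = \<one>\<rbrakk> \<Longrightarrow> f = to_one (Dom C f)"
  by (rule Terminal_eqI[of _ "Dom C f"]) (auto simp: hom_iff)

lemma Comp_to_one [simp]:
  assumes "f \<in> Arr C" "Cod C f = B"
  shows "f \<cdot> to_one B = to_one (Dom C f)"
proof -
  have "B \<in> Obj C" using assms by auto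
  then show ?thesis using to_one_unique[of "f \<cdot> to_one B"] assms by simp
qed

lemma Comp_to_one_Comp [simp]:
  assumes "f \<in> Arr C" "Cod C f = B" "g \<in> Arr C" "Dom C g = \<one>"
  shows "f \<cdot> (to_one B \<cdot> g) = to_one (Dom C f) \<cdot> g"
proof -
  have "B \<in> Obj C" using assms by auto
  then have "f \<cdot> (to_one B \<cdot> g) = (f \<cdot> to_one B) \<cdot> g" using assms by (simp del: Comp_to_one)
  then show ?thesis using assms by simp
qed

lemma Proj_simps [simp]:
  assumes "A \<in> Obj C" "B \<in> Obj C"
  shows "Prod S A B \<in> Obj C"
    "Proj0 S A B \<in> Arr C" "Dom C (Proj0 S A B) = Prod S A B" "Cod C (Proj0 S A B) = A"
    "Proj1 S A B \<in> Arr C" "Dom C (Proj1 S A B) = Prod S A B" "Cod C (Proj1 S A B) = B"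
  using products assms
  by (auto simp: finite_products_def is_product_def hom_iff)

lemma pair_ex1:
  assumes "f \<in> hom C D A" "g \<in> hom C D B"
  shows "\<exists>!h. h \<in> hom C D (Prod S A B) \<and> h \<cdot> Proj0 S A B = f \<and> h \<cdot> Proj1 S A B = g"
  using products assms hom_Obj[of f D A] hom_Obj[of g D B]
  unfolding finite_products_def is_product_def by blast

lemma pair_props:
  assumes "f \<in> Arr C" "g \<in> Arr C" "Dom C f = Dom C g"
  shows "pair C S f g \<in> hom C (Dom C f) (Prod S (Cod C f) (Cod C g)) \<and>
    pair C S f g \<cdot> Proj0 S (Cod C f) (Cod C g) = f \<and>
    pair C S f g \<cdot> Proj1 S (Cod C f) (Cod C g) = g"
  unfolding pair_def
  by (rule theI', rule pair_ex1) (use assms in \<open>auto simp: hom_iff\<close>)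

lemma pair_simps [simp]:
  assumes "f \<in> Arr C" "g \<in> Arr C" "Dom C f = Dom C g"
  shows "pair C S f g \<in> Arr C" "Dom C (pair C S f g) = Dom C g"
    "Cod C (pair C S f g) = Prod S (Cod C f) (Cod C g)"
  using pair_props[OF assms] assms by (auto simp: hom_iff)

lemma pair_Proj [simp]:
  assumes "f \<in> Arr C" "g \<in> Arr C" "Dom C f = Dom C g" "Cod C f = A" "Cod C g = B"
  shows "pair C S f g \<cdot> Proj0 S A B = f" "pair C S f g \<cdot> Proj1 S A B = g"
  using pair_props[OF assms(1-3)] assms by auto

lemma pair_Proj_Comp [simp]:
  assumes "f \<in> Arr C" "g \<in> Arr C" "Dom C f = Dom C g" "Cod C f = A" "Cod C g = B"
  shows "\<lbrakk>h \<in> Arr C; Dom C h = A\<rbrakk> \<Longrightarrow> pair C S f g \<cdot> (Proj0 S A B \<cdot> h) = f \<cdot> h"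
    "\<lbrakk>h \<in> Arr C; Dom C h = B\<rbrakk> \<Longrightarrow> pair C S f g \<cdot> (Proj1 S A B \<cdot> h) = g \<cdot> h"
proof -
  have AB: "A \<in> Obj C" "B \<in> Obj C" using assms by auto
  show "pair C S f g \<cdot> (Proj0 S A B \<cdot> h) = f \<cdot> h" if "h \<in> Arr C" "Dom C h = A"
    using assms AB that Comp_assoc_simp[of "pair C S f g" "Proj0 S A B" h]
    by (simp del: Comp_assoc_simp)
  show "pair C S f g \<cdot> (Proj1 S A B \<cdot> h) = g \<cdot> h" if "h \<in> Arr C" "Dom C h = B"
    using assms AB that Comp_assoc_simp[of "pair C S f g" "Proj1 S A B" h]
    by (simp del: Comp_assoc_simp)
qed

lemma pair_eqI:
  assumes "f \<in> Arr C" "g \<in> Arr C" "Dom C f = Dom C g" "h \<in> Arr C" "Dom C h = Dom C f"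
    and "Cod C h = Prod S (Cod C f) (Cod C g)"
    and "h \<cdot> Proj0 S (Cod C f) (Cod C g) = f" "h \<cdot> Proj1 S (Cod C f) (Cod C g) = g"
  shows "h = pair C S f g"
proof -
  have "\<exists>!h. h \<in> hom C (Dom C f) (Prod S (Cod C f) (Cod C g)) \<and>
      h \<cdot> Proj0 S (Cod C f) (Cod C g) = f \<and> h \<cdot> Proj1 S (Cod C f) (Cod C g) = g"
    by (rule pair_ex1) (use assms in \<open>simp_all add: hom_iff\<close>)
  moreover have "h \<in> hom C (Dom C f) (Prod S (Cod C f) (Cod C g))"
    using assms by (simp add: hom_iff)
  ultimately show ?thesis
    using pair_props[OF assms(1-3)] assms(7,8) by blast
qed

lemma Comp_pair:
  assumes "f \<in> Arr C" "g \<in> Arr C" "Dom C f = Dom C g" "h \<in> Arr C" "Cod C h = Dom C g"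
  shows "h \<cdot> pair C S f g = pair C S (h \<cdot> f) (h \<cdot> g)"
  by (rule pair_eqI) (use assms in auto)

text \<open>The maps \<open>1 \<times> \<iota>\<^sub>0\<close> and \<open>1 \<times> \<iota>\<^sub>1\<close> into \<open>A \<times> (P \<oplus> \<one>)\<close>, whose copairing is the distributor.\<close>

definition in_left where "in_left A P = pair C S (Proj0 S A P) (Proj1 S A P \<cdot> Inj0 S P \<one>)"
definition in_right where "in_right A P = pair C S (Proj0 S A \<one>) (Proj1 S A \<one> \<cdot> Inj1 S P \<one>)"

lemma in_left_right_simps [simp]:
  assumes "A \<in> Obj C" "P \<in> Obj C"
  shows "in_left A P \<in> Arr C" "Dom C (in_left A P) = Prod S A P"
    "Cod C (in_left A P) = Prod S A (plus_one P)"
    "in_right A P \<in> Arr C" "Dom C (in_right A P) = Prod S A \<one>"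
    "Cod C (in_right A P) = Prod S A (plus_one P)"
    "in_left A P \<cdot> Proj0 S A (plus_one P) = Proj0 S A P"
    "in_left A P \<cdot> Proj1 S A (plus_one P) = Proj1 S A P \<cdot> Inj0 S P \<one>"
    "in_right A P \<cdot> Proj0 S A (plus_one P) = Proj0 S A \<one>"
    "in_right A P \<cdot> Proj1 S A (plus_one P) = Proj1 S A \<one> \<cdot> Inj1 S P \<one>"
  using assms by (simp_all add: in_left_def in_right_def)

lemma in_left_right_Comp [simp]:
  assumes "A \<in> Obj C" "P \<in> Obj C" "h \<in> Arr C"
  shows "Dom C h = A \<Longrightarrow> in_left A P \<cdot> (Proj0 S A (plus_one P) \<cdot> h) = Proj0 S A P \<cdot> h"
    "Dom C h = plus_one P \<Longrightarrow>
      in_left A P \<cdot> (Proj1 S A (plus_one P) \<cdot> h) = Proj1 S A P \<cdot> (Inj0 S P \<one> \<cdot> h)"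
    "Dom C h = A \<Longrightarrow> in_right A P \<cdot> (Proj0 S A (plus_one P) \<cdot> h) = Proj0 S A \<one> \<cdot> h"
    "Dom C h = plus_one P \<Longrightarrow>
      in_right A P \<cdot> (Proj1 S A (plus_one P) \<cdot> h) = Proj1 S A \<one> \<cdot> (Inj1 S P \<one> \<cdot> h)"
  using assms by (simp_all add: in_left_def in_right_def)

lemma distributor_unfold:
  "distributor C S (pair C S) A P \<one> = copair C S (in_left A P) (in_right A P)"
  by (simp add: distributor_def in_left_def in_right_def)

abbreviation distrib_inv where "distrib_inv A P \<equiv> inv_arrow C (distributor C S (pair C S) A P \<one>)"

lemma distrib_inv_simps [simp]:
  assumes "A \<in> Obj C" "P \<in> Obj C"
  shows "distrib_inv A P \<in> Arr C"
    "Dom C (distrib_inv A P) = Prod S A (plus_one P)"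
    "Cod C (distrib_inv A P) = Coprod S (Prod S A P) (Prod S A \<one>)"
  using inv_arrow_simps[OF distributor_iso[OF assms Terminal_Obj]] assms
  by (simp_all add: distributor_unfold)

lemma in_distrib_inv [simp]:
  assumes "A \<in> Obj C" "P \<in> Obj C"
  shows "in_left A P \<cdot> distrib_inv A P = Inj0 S (Prod S A P) (Prod S A \<one>)"
    "in_right A P \<cdot> distrib_inv A P = Inj1 S (Prod S A P) (Prod S A \<one>)"
proof -
  let ?d = "copair C S (in_left A P) (in_right A P)"
  have d: "?d \<cdot> distrib_inv A P = Ide C (Coprod S (Prod S A P) (Prod S A \<one>))"
    using inv_arrow_simps(5)[OF distributor_iso[OF assms Terminal_Obj]] assms
    by (simp add: distributor_unfold)
  have "Inj0 S (Prod S A P) (Prod S A \<one>) \<cdot> (?d \<cdot> distrib_inv A P) = in_left A P \<cdot> distrib_inv A P"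
    "Inj1 S (Prod S A P) (Prod S A \<one>) \<cdot> (?d \<cdot> distrib_inv A P) = in_right A P \<cdot> distrib_inv A P"
    using assms by (simp_all)
  then show "in_left A P \<cdot> distrib_inv A P = Inj0 S (Prod S A P) (Prod S A \<one>)"
    "in_right A P \<cdot> distrib_inv A P = Inj1 S (Prod S A P) (Prod S A \<one>)"
    using assms by (simp_all add: d)
qed

lemma in_distrib_inv_Comp [simp]:
  assumes "A \<in> Obj C" "P \<in> Obj C" "h \<in> Arr C" "Dom C h = Coprod S (Prod S A P) (Prod S A \<one>)"
  shows "in_left A P \<cdot> (distrib_inv A P \<cdot> h) = Inj0 S (Prod S A P) (Prod S A \<one>) \<cdot> h"
    "in_right A P \<cdot> (distrib_inv A P \<cdot> h) = Inj1 S (Prod S A P) (Prod S A \<one>) \<cdot> h"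
  using assms in_distrib_inv[OF assms(1,2)]
    Comp_assoc_simp[of "in_left A P" "distrib_inv A P" h]
    Comp_assoc_simp[of "in_right A P" "distrib_inv A P" h]
  by (simp_all del: Comp_assoc_simp in_distrib_inv)

text \<open>Since the distributor is invertible, a map out of \<open>A \<times> (P \<oplus> \<one>)\<close> is determined by what it does
  when the second component lies in \<open>P\<close> and when it lies in \<open>\<one>\<close>. This is the principle of case
  analysis behind all laws of \<open>cond\<close>.\<close>

lemma eq_by_cases:
  assumes "u \<in> Arr C" "v \<in> Arr C" "Dom C u = Prod S A (plus_one P)"
    "Dom C v = Prod S A (plus_one P)" "Cod C u = Cod C v" "A \<in> Obj C" "P \<in> Obj C"
    and "in_left A P \<cdot> u = in_left A P \<cdot> v" "in_right A P \<cdot> u = in_right A P \<cdot> v"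
  shows "u = v"
proof (rule iso_cancel_left[OF distributor_iso[OF assms(6,7) Terminal_Obj]])
  show "distributor C S (pair C S) A P \<one> \<cdot> u = distributor C S (pair C S) A P \<one> \<cdot> v"
    unfolding distributor_unfold using assms by (simp add: copair_Comp)
qed (use assms in \<open>simp_all add: distributor_unfold\<close>)

text \<open>If-then-else with the test \<open>p : A \<longrightarrow> P \<oplus> \<one>\<close>: it is \<open>h\<close> where \<open>p\<close> lands in \<open>P\<close> and \<open>k\<close> where \<open>p\<close>
  lands in \<open>\<one>\<close>. The object \<open>P\<close> is an argument because it need not be determined by \<open>P \<oplus> \<one>\<close>. Tests with
  values in any \<open>P \<oplus> \<one>\<close>, instead of only \<open>\<one> \<oplus> \<one>\<close>, let a Kleisli map serve as a test for its own
  domain of definition.\<close>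

definition cond where
  "cond P p h k = pair C S (Ide C (Dom C p)) p \<cdot>
    (distrib_inv (Dom C p) P \<cdot> copair C S (Proj0 S (Dom C p) P \<cdot> h) (Proj0 S (Dom C p) \<one> \<cdot> k))"

lemma cond_simps [simp]:
  assumes "p \<in> Arr C" "Cod C p = plus_one P" "P \<in> Obj C" "h \<in> Arr C" "k \<in> Arr C"
    and "Dom C h = Dom C p" "Dom C k = Dom C p" "Cod C h = Cod C k"
  shows "cond P p h k \<in> Arr C" "Dom C (cond P p h k) = Dom C p" "Cod C (cond P p h k) = Cod C k"
  using assms by (simp_all add: cond_def)

lemma cond_left:
  assumes "q \<in> Arr C" "Cod C q = P" "h \<in> Arr C" "k \<in> Arr C"
    and "Dom C h = Dom C q" "Dom C k = Dom C q" "Cod C h = Cod C k"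
  shows "cond P (q \<cdot> Inj0 S P \<one>) h k = h"
proof -
  have P: "P \<in> Obj C" using assms by auto
  have "pair C S (Ide C (Dom C q)) (q \<cdot> Inj0 S P \<one>)
      = pair C S (Ide C (Dom C q)) q \<cdot> in_left (Dom C q) P"
    using assms P by (intro pair_eqI[symmetric]) simp_all
  then show ?thesis
    using assms P by (simp add: cond_def)
qed

lemma cond_right:
  assumes "q \<in> Arr C" "Cod C q = \<one>" "P \<in> Obj C" "h \<in> Arr C" "k \<in> Arr C"
    and "Dom C h = Dom C q" "Dom C k = Dom C q" "Cod C h = Cod C k"
  shows "cond P (q \<cdot> Inj1 S P \<one>) h k = k"
proof -
  have "pair C S (Ide C (Dom C q)) (q \<cdot> Inj1 S P \<one>)
      = pair C S (Ide C (Dom C q)) q \<cdot> in_right (Dom C q) P"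
    using assms by (intro pair_eqI[symmetric]) simp_all
  then show ?thesis
    using assms by (simp add: cond_def)
qed

text \<open>Naturality in the domain, which follows from that of the distributor in its first argument. It
  makes every \<open>cond P p h k\<close> the composite of \<open>\<langle>1, p\<rangle>\<close> with a case distinction on
  \<open>A \<times> (P \<oplus> \<one>)\<close> whose test is the second projection.\<close>

lemma Comp_cond:
  assumes "g \<in> Arr C" "Cod C g = Dom C p"
    and "p \<in> Arr C" "Cod C p = plus_one P" "P \<in> Obj C" "h \<in> Arr C" "k \<in> Arr C"
    and "Dom C h = Dom C p" "Dom C k = Dom C p" "Cod C h = Cod C k"
  shows "g \<cdot> cond P p h k = cond P (g \<cdot> p) (g \<cdot> h) (g \<cdot> k)"
proof -
  let ?A = "Dom C p" and ?B = "Dom C g"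
  let ?e = "distrib_inv ?A P \<cdot> copair C S (Proj0 S ?A P \<cdot> h) (Proj0 S ?A \<one> \<cdot> k)"
  let ?e' = "distrib_inv ?B P \<cdot> copair C S (Proj0 S ?B P \<cdot> (g \<cdot> h)) (Proj0 S ?B \<one> \<cdot> (g \<cdot> k))"
  let ?m = "pair C S (Proj0 S ?B (plus_one P) \<cdot> g) (Proj1 S ?B (plus_one P))"
  have l: "in_left ?B P \<cdot> ?m = pair C S (Proj0 S ?B P \<cdot> g) (Proj1 S ?B P) \<cdot> in_left ?A P"
    using assms by (simp add: Comp_pair in_left_def[of ?A P])
  have r: "in_right ?B P \<cdot> ?m = pair C S (Proj0 S ?B \<one> \<cdot> g) (Proj1 S ?B \<one>) \<cdot> in_right ?A P"
    using assms by (simp add: Comp_pair in_right_def[of ?A P])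
  have m: "?m \<cdot> ?e = ?e'"
  proof (rule eq_by_cases[where A="?B" and P=P])
    have "in_left ?B P \<cdot> (?m \<cdot> ?e) = (in_left ?B P \<cdot> ?m) \<cdot> ?e" using assms by simp
    also have "\<dots> = in_left ?B P \<cdot> ?e'" unfolding l using assms by simp
    finally show "in_left ?B P \<cdot> (?m \<cdot> ?e) = in_left ?B P \<cdot> ?e'" .
    have "in_right ?B P \<cdot> (?m \<cdot> ?e) = (in_right ?B P \<cdot> ?m) \<cdot> ?e" using assms by simp
    also have "\<dots> = in_right ?B P \<cdot> ?e'" unfolding r using assms by simp
    finally show "in_right ?B P \<cdot> (?m \<cdot> ?e) = in_right ?B P \<cdot> ?e'" .
  qed (use assms in simp_all)
  have "g \<cdot> pair C S (Ide C ?A) p = pair C S (Ide C ?B) (g \<cdot> p) \<cdot> ?m"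
    using assms by (simp add: Comp_pair)
  then have "g \<cdot> cond P p h k = (pair C S (Ide C ?B) (g \<cdot> p) \<cdot> ?m) \<cdot> ?e"
    using assms Comp_assoc_simp[of g "pair C S (Ide C ?A) p" ?e]
    by (simp add: cond_def del: Comp_assoc_simp)
  also have "\<dots> = pair C S (Ide C ?B) (g \<cdot> p) \<cdot> (?m \<cdot> ?e)"
    by (rule Comp_assoc_simp) (use assms in simp_all)
  also have "\<dots> = cond P (g \<cdot> p) (g \<cdot> h) (g \<cdot> k)"
    unfolding m using assms by (simp add: cond_def)
  finally show ?thesis .
qed

lemma cond_Comp:
  assumes "p \<in> Arr C" "Cod C p = plus_one P" "P \<in> Obj C" "h \<in> Arr C" "k \<in> Arr C"
    and "Dom C h = Dom C p" "Dom C k = Dom C p" "Cod C h = Cod C k"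
    and "m \<in> Arr C" "Dom C m = Cod C k"
  shows "cond P p h k \<cdot> m = cond P p (h \<cdot> m) (k \<cdot> m)"
  using assms by (simp add: cond_def copair_Comp)

subsection \<open>Laws of case distinction\<close>

text \<open>The laws are all proved in the same way. By \<open>Comp_cond\<close> it suffices to prove them on
  \<open>A \<times> (P \<oplus> \<one>)\<close> for the generic test \<open>\<pi>\<^sub>1\<close>, with all other maps precomposed by \<open>\<pi>\<^sub>0\<close>, and to
  precompose with \<open>\<langle>1, p\<rangle>\<close> afterwards. For the generic test \<open>eq_by_cases\<close> applies, and in
  each of the two cases the test is decided by \<open>cond_left\<close> or \<open>cond_right\<close>. The case analysis cannot
  be made directly on \<open>A\<close>, which need not be a coproduct of the two parts.\<close>

lemma cond_same:
  assumes "p \<in> Arr C" "Cod C p = plus_one P" "P \<in> Obj C" "h \<in> Arr C" "Dom C h = Dom C p"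
  shows "cond P p h h = h"
proof -
  let ?A = "Dom C p"
  let ?f = "Proj0 S ?A (plus_one P)" and ?s = "Proj1 S ?A (plus_one P)"
  have "cond P ?s (?f \<cdot> h) (?f \<cdot> h) = ?f \<cdot> h"
    by (rule eq_by_cases[where A="?A" and P=P])
      (use assms in \<open>simp_all add: Comp_cond cond_left cond_right\<close>)
  then have "pair C S (Ide C ?A) p \<cdot> cond P ?s (?f \<cdot> h) (?f \<cdot> h)
      = pair C S (Ide C ?A) p \<cdot> (?f \<cdot> h)" by simp
  then show ?thesis using assms by (simp add: Comp_cond)
qed

lemma cond_cond_left:
  assumes "p \<in> Arr C" "Cod C p = plus_one P" "P \<in> Obj C" "h \<in> Arr C" "k \<in> Arr C" "l \<in> Arr C"
    and "Dom C h = Dom C p" "Dom C k = Dom C p" "Dom C l = Dom C p"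
    and "Cod C h = Cod C l" "Cod C k = Cod C l"
  shows "cond P p (cond P p h k) l = cond P p h l"
proof -
  let ?A = "Dom C p"
  let ?f = "Proj0 S ?A (plus_one P)" and ?s = "Proj1 S ?A (plus_one P)"
  have "cond P ?s (cond P ?s (?f \<cdot> h) (?f \<cdot> k)) (?f \<cdot> l) = cond P ?s (?f \<cdot> h) (?f \<cdot> l)"
    by (rule eq_by_cases[where A="?A" and P=P])
      (use assms in \<open>simp_all add: Comp_cond cond_left cond_right\<close>)
  then have "pair C S (Ide C ?A) p \<cdot> cond P ?s (cond P ?s (?f \<cdot> h) (?f \<cdot> k)) (?f \<cdot> l)
      = pair C S (Ide C ?A) p \<cdot> cond P ?s (?f \<cdot> h) (?f \<cdot> l)" by simp
  then show ?thesis using assms by (simp add: Comp_cond)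
qed

lemma cond_cond_right:
  assumes "p \<in> Arr C" "Cod C p = plus_one P" "P \<in> Obj C" "h \<in> Arr C" "k \<in> Arr C" "l \<in> Arr C"
    and "Dom C h = Dom C p" "Dom C k = Dom C p" "Dom C l = Dom C p"
    and "Cod C h = Cod C l" "Cod C k = Cod C l"
  shows "cond P p h (cond P p k l) = cond P p h l"
proof -
  let ?A = "Dom C p"
  let ?f = "Proj0 S ?A (plus_one P)" and ?s = "Proj1 S ?A (plus_one P)"
  have "cond P ?s (?f \<cdot> h) (cond P ?s (?f \<cdot> k) (?f \<cdot> l)) = cond P ?s (?f \<cdot> h) (?f \<cdot> l)"
    by (rule eq_by_cases[where A="?A" and P=P])
      (use assms in \<open>simp_all add: Comp_cond cond_left cond_right\<close>)
  then have "pair C S (Ide C ?A) p \<cdot> cond P ?s (?f \<cdot> h) (cond P ?s (?f \<cdot> k) (?f \<cdot> l))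
      = pair C S (Ide C ?A) p \<cdot> cond P ?s (?f \<cdot> h) (?f \<cdot> l)" by simp
  then show ?thesis using assms by (simp add: Comp_cond)
qed

lemma cond_cond_test:
  assumes "p \<in> Arr C" "Cod C p = plus_one P" "P \<in> Obj C"
    and "q \<in> Arr C" "r \<in> Arr C" "Cod C q = plus_one Q" "Cod C r = plus_one Q" "Q \<in> Obj C"
    and "h \<in> Arr C" "k \<in> Arr C" "Cod C h = Cod C k"
    and "Dom C q = Dom C p" "Dom C r = Dom C p" "Dom C h = Dom C p" "Dom C k = Dom C p"
  shows "cond Q (cond P p q r) h k = cond P p (cond Q q h k) (cond Q r h k)"
proof -
  let ?A = "Dom C p"
  let ?f = "Proj0 S ?A (plus_one P)" and ?s = "Proj1 S ?A (plus_one P)"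
  have "cond Q (cond P ?s (?f \<cdot> q) (?f \<cdot> r)) (?f \<cdot> h) (?f \<cdot> k)
      = cond P ?s (cond Q (?f \<cdot> q) (?f \<cdot> h) (?f \<cdot> k)) (cond Q (?f \<cdot> r) (?f \<cdot> h) (?f \<cdot> k))"
    by (rule eq_by_cases[where A="?A" and P=P])
      (use assms in \<open>simp_all add: Comp_cond cond_left cond_right\<close>)
  then have "pair C S (Ide C ?A) p \<cdot> cond Q (cond P ?s (?f \<cdot> q) (?f \<cdot> r)) (?f \<cdot> h) (?f \<cdot> k)
      = pair C S (Ide C ?A) p \<cdot>
        cond P ?s (cond Q (?f \<cdot> q) (?f \<cdot> h) (?f \<cdot> k)) (cond Q (?f \<cdot> r) (?f \<cdot> h) (?f \<cdot> k))"
    by simp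
  then show ?thesis using assms by (simp add: Comp_cond)
qed

lemma cond_swap:
  assumes "p \<in> Arr C" "Cod C p = plus_one P" "P \<in> Obj C"
    and "q \<in> Arr C" "Cod C q = plus_one Q" "Q \<in> Obj C" "Dom C q = Dom C p"
    and "h \<in> Arr C" "k \<in> Arr C" "h' \<in> Arr C" "k' \<in> Arr C"
    and "Dom C h = Dom C p" "Dom C k = Dom C p" "Dom C h' = Dom C p" "Dom C k' = Dom C p"
    and "Cod C h = Cod C k'" "Cod C k = Cod C k'" "Cod C h' = Cod C k'"
  shows "cond P p (cond Q q h k) (cond Q q h' k') = cond Q q (cond P p h h') (cond P p k k')"
proof -
  let ?A = "Dom C p"
  let ?f = "Proj0 S ?A (plus_one P)" and ?s = "Proj1 S ?A (plus_one P)"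
  let ?l = "cond P ?s (cond Q (?f \<cdot> q) (?f \<cdot> h) (?f \<cdot> k)) (cond Q (?f \<cdot> q) (?f \<cdot> h') (?f \<cdot> k'))"
  let ?r = "cond Q (?f \<cdot> q) (cond P ?s (?f \<cdot> h) (?f \<cdot> h')) (cond P ?s (?f \<cdot> k) (?f \<cdot> k'))"
  have "?l = ?r"
    by (rule eq_by_cases[where A="?A" and P=P])
      (use assms in \<open>simp_all add: Comp_cond cond_left cond_right\<close>)
  then have "pair C S (Ide C ?A) p \<cdot> ?l = pair C S (Ide C ?A) p \<cdot> ?r" by simp
  then show ?thesis using assms by (simp add: Comp_cond)
qed

text \<open>The nowhere defined Kleisli map.\<close>

definition undef where "undef A B = to_one A \<cdot> Inj1 S B \<one>"

lemma undef_simps [simp]: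
  assumes "A \<in> Obj C" "B \<in> Obj C"
  shows "undef A B \<in> Arr C" "Dom C (undef A B) = A" "Cod C (undef A B) = plus_one B"
  using assms by (simp_all add: undef_def)

lemma Comp_undef [simp]:
  assumes "f \<in> Arr C" "Cod C f = A" "B \<in> Obj C"
  shows "f \<cdot> undef A B = undef (Dom C f) B"
proof -
  have "A \<in> Obj C" using assms by auto
  then show ?thesis using assms by (simp add: undef_def)
qed

lemma undef_copair [simp]:
  assumes "A \<in> Obj C" "B \<in> Obj C" "f \<in> Arr C" "Dom C f = B" "Cod C f = plus_one E" "E \<in> Obj C"
  shows "undef A B \<cdot> copair C S f (Inj1 S E \<one>) = undef A E"
  using assms by (simp add: undef_def)

lemma cond_undef_test:
  assumes "A \<in> Obj C" "P \<in> Obj C" "h \<in> Arr C" "k \<in> Arr C" "Dom C h = A" "Dom C k = A"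
    and "Cod C h = Cod C k"
  shows "cond P (undef A P) h k = k"
  unfolding undef_def by (rule cond_right) (use assms in simp_all)

lemma Inj1_eq_undef: "B \<in> Obj C \<Longrightarrow> Inj1 S B \<one> = undef \<one> B"
  using Terminal_eqI[of "to_one \<one>" \<one> "Ide C \<one>"] by (simp add: undef_def hom_iff)

text \<open>By naturality only the generic test, the identity of \<open>B \<oplus> \<one>\<close>, has to be considered, and its two
  cases are the injections.\<close>

lemma cond_self_undef:
  assumes "f \<in> Arr C" "Cod C f = plus_one B" "B \<in> Obj C" "A = Dom C f"
  shows "cond B f f (undef A B) = f"
proof -
  let ?i = "Ide C (plus_one B)"
  have "cond B ?i ?i (undef (plus_one B) B) = ?i"
  proof (rule coproduct_eqI[where A=B and B=\<one>])
    have "cond B (Ide C B \<cdot> Inj0 S B \<one>) (Inj0 S B \<one>) (undef B B) = Inj0 S B \<one>"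
      by (rule cond_left) (use assms in simp_all)
    then show "Inj0 S B \<one> \<cdot> cond B ?i ?i (undef (plus_one B) B) = Inj0 S B \<one> \<cdot> ?i"
      using assms by (simp add: Comp_cond)
    have "cond B (Ide C \<one> \<cdot> Inj1 S B \<one>) (Inj1 S B \<one>) (undef \<one> B) = undef \<one> B"
      by (rule cond_right) (use assms in simp_all)
    then show "Inj1 S B \<one> \<cdot> cond B ?i ?i (undef (plus_one B) B) = Inj1 S B \<one> \<cdot> ?i"
      using assms by (simp add: Comp_cond Inj1_eq_undef)
  qed (use assms in simp_all)
  then have "f \<cdot> cond B ?i ?i (undef (plus_one B) B) = f \<cdot> ?i" by simp
  then show ?thesis using assms by (simp add: Comp_cond)
qed
end

section \<open>The Kleisli category of the exception monad is classical\<close>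

context distributive_category
begin

abbreviation Kl where "Kl \<equiv> exception_kleisli C S"

lemma Kl_simps [simp]:
  "Obj Kl = Obj C" "Dom Kl (A, f, B) = A" "Cod Kl (A, f, B) = B"
  "Ide Kl A = (A, Inj0 S A \<one>, A)"
  "(A, f, B) \<cdot>\<^bsub>Kl\<^esub> (B', g, E) = (A, f \<cdot> copair C S g (Inj1 S E \<one>), E)"
  by (simp_all add: exception_kleisli_def Let_def)

lemma Arr_Kl: "(A, f, B) \<in> Arr Kl \<longleftrightarrow> A \<in> Obj C \<and> B \<in> Obj C \<and> f \<in> hom C A (plus_one B)"
  by (simp add: exception_kleisli_def Let_def)

lemma hom_Kl: "F \<in> hom Kl A B \<longleftrightarrow>
    (\<exists>f. F = (A, f, B) \<and> A \<in> Obj C \<and> B \<in> Obj C \<and>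
      f \<in> Arr C \<and> Dom C f = A \<and> Cod C f = plus_one B)"
  by (cases F) (auto simp: hom_iff Arr_Kl)

text \<open>The second summand of the formula for the restriction is the projection \<open>A \<times> \<one> \<longrightarrow> \<one>\<close>, which agrees
  with the map to \<open>\<one>\<close> through \<open>A\<close>. Hence the restriction is the identity where \<open>f\<close> is defined and
  undefined elsewhere.\<close>

lemma Rst_Kl:
  assumes "f \<in> Arr C" "Dom C f = A" "Cod C f = plus_one B" "B \<in> Obj C"
  shows "Rst Kl (A, f, B) = (A, cond B f (Inj0 S A \<one>) (undef A A), A)"
proof -
  have A: "A \<in> Obj C" using assms by auto
  have "Proj0 S A \<one> \<cdot> undef A A = Proj1 S A \<one> \<cdot> Inj1 S A \<one>"
    using A Inj1_eq_undef[of A] by simp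
  then have "coprod_map C S (Proj0 S A B) (Proj1 S A \<one>) =
      copair C S (Proj0 S A B \<cdot> Inj0 S A \<one>) (Proj0 S A \<one> \<cdot> undef A A)"
    using A assms by (simp add: coprod_map_def)
  then show ?thesis
    using A assms by (simp add: exception_kleisli_def Let_def cond_def)
qed

text \<open>This formula translates the order, compatibility and disjointness of Kleisli maps into equations
  about \<open>cond\<close>.\<close>

lemma Rst_Comp_Kl:
  assumes "f \<in> Arr C" "Dom C f = A" "Cod C f = plus_one B" "B \<in> Obj C"
    and "g \<in> Arr C" "Dom C g = A" "Cod C g = plus_one E" "E \<in> Obj C"
  shows "Rst Kl (A, f, B) \<cdot>\<^bsub>Kl\<^esub> (A, g, E) = (A, cond B f g (undef A E), E)"
proof -
  have A: "A \<in> Obj C" using assms by auto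
  show ?thesis using A assms by (simp add: Rst_Kl cond_Comp)
qed

definition zero_Kl where "zero_Kl A B = (A, undef A B, B)"

fun join_Kl where "join_Kl (A, f, B) (A', g, B') = (A, cond B f f g, B)"

lemma zeroes_Kl: "restriction_zeroes Kl zero_Kl"
proof -
  have "Rst Kl (zero_Kl A B) = zero_Kl A A" if "A \<in> Obj C" "B \<in> Obj C" for A B
    using that by (simp add: zero_Kl_def Rst_Kl cond_undef_test)
  moreover have "F \<cdot>\<^bsub>Kl\<^esub> zero_Kl B E = zero_Kl A E" "zero_Kl E A \<cdot>\<^bsub>Kl\<^esub> F = zero_Kl E B"
    if "F \<in> hom Kl A B" "E \<in> Obj C" for F A B E
  proof -
    have "copair C S (undef B E) (Inj1 S E \<one>) = undef (plus_one B) E" if "B \<in> Obj C"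
      by (rule copair_eqI) (use that \<open>E \<in> Obj C\<close> Inj1_eq_undef[of E] in simp_all)
    then show "F \<cdot>\<^bsub>Kl\<^esub> zero_Kl B E = zero_Kl A E" "zero_Kl E A \<cdot>\<^bsub>Kl\<^esub> F = zero_Kl E B"
      using that by (auto simp: hom_Kl zero_Kl_def)
  qed
  moreover have "zero_Kl A B \<in> hom Kl A B" if "A \<in> Obj C" "B \<in> Obj C" for A B
    using that by (simp add: zero_Kl_def hom_Kl)
  ultimately show ?thesis
    unfolding restriction_zeroes_def Kl_simps by blast
qed

lemma restriction_le_Kl:
  assumes "f \<in> Arr C" "Dom C f = A" "Cod C f = plus_one B" "B \<in> Obj C"
    and "g \<in> Arr C" "Dom C g = A" "Cod C g = plus_one B"
  shows "restriction_le Kl (A, f, B) (A, g, B) \<longleftrightarrow> cond B f g (undef A B) = f"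
  unfolding restriction_le_def Rst_Comp_Kl[OF assms(1-4,5-7,4)] by simp

lemma compatible_Kl:
  assumes "f \<in> Arr C" "Dom C f = A" "Cod C f = plus_one B" "B \<in> Obj C"
    and "g \<in> Arr C" "Dom C g = A" "Cod C g = plus_one B"
  shows "compatible Kl (A, f, B) (A, g, B) \<longleftrightarrow> cond B f g (undef A B) = cond B g f (undef A B)"
  unfolding compatible_def Rst_Comp_Kl[OF assms(1-4,5-7,4)] Rst_Comp_Kl[OF assms(5-7,4,1-4)]
  by simp

text \<open>The join takes the value of \<open>f\<close> where \<open>f\<close> is defined and that of \<open>g\<close> elsewhere. Compatibility
  makes it lie above \<open>g\<close>; that it is least is the law for nested tests.\<close>

lemma is_join_Kl:
  assumes f: "f \<in> Arr C" "Dom C f = A" "Cod C f = plus_one B" and B: "B \<in> Obj C"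
    and g: "g \<in> Arr C" "Dom C g = A" "Cod C g = plus_one B"
    and fg: "cond B f g (undef A B) = cond B g f (undef A B)"
  shows "is_join Kl A B {(A, f, B), (A, g, B)} (A, cond B f f g, B)"
proof -
  have A: "A \<in> Obj C" using f by auto
  note [simp] = A B f g
  let ?u = "undef A B" and ?j = "cond B f f g"
  have "cond B f ?j ?u = f"
    by (simp add: cond_cond_left cond_self_undef)
  moreover have "cond B g ?j ?u = g"
  proof -
    have "cond B g ?j ?u = cond B g (cond B f f g) (cond B f ?u ?u)"
      by (simp add: cond_same)
    also have "\<dots> = cond B f (cond B g f ?u) (cond B g g ?u)"
      by (rule cond_swap) simp_all
    also have "\<dots> = cond B f (cond B f g ?u) g"
      by (simp add: cond_self_undef flip: fg)
    also have "\<dots> = g"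
      by (simp add: cond_cond_left cond_same)
    finally show ?thesis .
  qed
  moreover have "cond B ?j k ?u = ?j"
    if "k \<in> Arr C" "Dom C k = A" "Cod C k = plus_one B" "cond B f k ?u = f" "cond B g k ?u = g" for k
  proof -
    have "cond B ?j k ?u = cond B f (cond B f k ?u) (cond B g k ?u)"
      by (rule cond_cond_test) (use that in simp_all)
    then show ?thesis using that by simp
  qed
  ultimately show ?thesis
    unfolding is_join_def by (auto simp: hom_Kl restriction_le_Kl)
qed

text \<open>The Kleisli category is assumed to satisfy the restriction axioms; a restriction equivalence
  supplies them.\<close>

lemma binary_join_Kl:
  assumes "restriction_category Kl"
  shows "binary_join_restriction_category Kl zero_Kl join_Kl"
proof -
  interpret Kl: restriction_category Kl by (rule assms)
  show ?thesis
  proof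
    show "restriction_zeroes Kl zero_Kl" by (rule zeroes_Kl)
  next
    fix F G A B assume "F \<in> hom Kl A B" "G \<in> hom Kl A B" "compatible Kl F G"
    then show "is_join Kl A B {F, G} (join_Kl F G)"
      by (auto simp: hom_Kl compatible_Kl intro!: is_join_Kl)
  next
    fix F G K A B
    assume hom: "F \<in> hom Kl A B" "G \<in> hom Kl A B" "K \<in> hom Kl A B"
      and comp: "compatible Kl F G" "compatible Kl F K" "compatible Kl G K"
    obtain f g k where FGK: "F = (A, f, B)" "G = (A, g, B)" "K = (A, k, B)"
      and [simp]: "A \<in> Obj C" "B \<in> Obj C"
      "f \<in> Arr C" "Dom C f = A" "Cod C f = plus_one B"
      "g \<in> Arr C" "Dom C g = A" "Cod C g = plus_one B"
      "k \<in> Arr C" "Dom C k = A" "Cod C k = plus_one B"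
      using hom by (auto simp: hom_Kl)
    let ?u = "undef A B" and ?j = "cond B f f g"
    have fk: "cond B f k ?u = cond B k f ?u" and gk: "cond B g k ?u = cond B k g ?u"
      by (rule compatible_Kl[THEN iffD1]; use comp FGK in simp)+
    have "cond B ?j k ?u = cond B f (cond B f k ?u) (cond B g k ?u)"
      by (rule cond_cond_test) simp_all
    also have "\<dots> = cond B f (cond B k f ?u) (cond B k g ?u)"
      unfolding fk gk ..
    also have "\<dots> = cond B k ?j (cond B f ?u ?u)"
      by (rule cond_swap) simp_all
    also have "\<dots> = cond B k ?j ?u"
      by (simp add: cond_same)
    finally show "compatible Kl (join_Kl F G) K"
      by (simp add: FGK compatible_Kl)
  next
    fix F G H A B D
    assume hom: "F \<in> hom Kl A B" "G \<in> hom Kl A B" "H \<in> hom Kl D A"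
    obtain f g h where FGH: "F = (A, f, B)" "G = (A, g, B)" "H = (D, h, A)"
      and [simp]: "A \<in> Obj C" "B \<in> Obj C" "D \<in> Obj C"
      "f \<in> Arr C" "Dom C f = A" "Cod C f = plus_one B"
      "g \<in> Arr C" "Dom C g = A" "Cod C g = plus_one B"
      "h \<in> Arr C" "Dom C h = D" "Cod C h = plus_one A"
      using hom by (auto simp: hom_Kl)
    let ?f = "copair C S f (Inj1 S B \<one>)" and ?g = "copair C S g (Inj1 S B \<one>)"
    have "copair C S (cond B f f g) (Inj1 S B \<one>) = cond B ?f ?f ?g"
      by (rule copair_eqI) (simp_all add: Comp_cond cond_same)
    then show "H \<cdot>\<^bsub>Kl\<^esub> join_Kl F G = join_Kl (H \<cdot>\<^bsub>Kl\<^esub> F) (H \<cdot>\<^bsub>Kl\<^esub> G)"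
      by (simp add: FGH Comp_cond)
  qed
qed

theorem classical_Kl:
  assumes "restriction_category Kl"
  shows "classical_restriction_category Kl"
proof -
  interpret Kl: binary_join_restriction_category Kl zero_Kl join_Kl
    by (rule binary_join_Kl[OF assms])
  interpret join_restriction_category Kl
    by (rule Kl.join_restriction_category)
  show ?thesis
  proof
    show "\<exists>Z. restriction_zeroes Kl Z \<and>
      (\<forall>A \<in> Obj Kl. \<forall>B \<in> Obj Kl. \<forall>f \<in> hom Kl A B. \<forall>g \<in> hom Kl A B. restriction_le Kl f g \<longrightarrow>
        (\<exists>c \<in> hom Kl A B. disjoint_maps Kl Z c f \<and> is_join Kl A B {c, f} g))"
    proof (intro exI[of _ zero_Kl] conjI zeroes_Kl ballI impI)
      fix A B F G
      assume hom: "F \<in> hom Kl A B" "G \<in> hom Kl A B" and le: "restriction_le Kl F G"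
      obtain f g where FG: "F = (A, f, B)" "G = (A, g, B)"
        and [simp]: "A \<in> Obj C" "B \<in> Obj C"
        "f \<in> Arr C" "Dom C f = A" "Cod C f = plus_one B"
        "g \<in> Arr C" "Dom C g = A" "Cod C g = plus_one B"
        using hom by (auto simp: hom_Kl)
      let ?u = "undef A B" and ?c = "cond B f (undef A B) g"
      have fg: "cond B f g ?u = f" using le by (simp add: FG restriction_le_Kl)
      \<comment> \<open>Where \<open>f\<close> is undefined, so is the restriction of \<open>f\<close> to the domain of \<open>g\<close>.\<close>
      have gf: "cond B g f ?u = cond B f (cond B g f ?u) ?u"
      proof -
        have "cond B f f ?u = f" "cond B f ?u ?u = ?u"
          by (simp_all add: cond_self_undef cond_same)
        then have "cond B g f ?u = cond B g (cond B f f ?u) (cond B f ?u ?u)"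
          by simp
        also have "\<dots> = cond B f (cond B g f ?u) (cond B g ?u ?u)"
          by (rule cond_swap) simp_all
        also have "cond B g ?u ?u = ?u"
          by (rule cond_same) simp_all
        finally show ?thesis .
      qed
      have cf: "cond B ?c f ?u = ?u"
      proof -
        have "cond B ?c f ?u = cond B f (cond B ?u f ?u) (cond B g f ?u)"
          by (rule cond_cond_test) simp_all
        also have "\<dots> = cond B f ?u (cond B f (cond B g f ?u) ?u)"
          by (simp add: cond_undef_test flip: gf)
        also have "\<dots> = ?u"
          by (simp add: cond_cond_right cond_same)
        finally show ?thesis .
      qed
      have fc: "cond B f ?c ?u = ?u"
        by (simp add: cond_cond_left cond_same)
      have join: "cond B f f ?c = g"
      proof -
        have "cond B f f ?c = cond B f (cond B f g ?u) g"
          by (simp add: cond_cond_right fg)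
        then show ?thesis by (simp add: cond_cond_left cond_same)
      qed
      have "disjoint_maps Kl zero_Kl (A, ?c, B) F"
        by (simp add: disjoint_maps_def FG Rst_Comp_Kl cf zero_Kl_def)
      moreover have "is_join Kl A B {F, (A, ?c, B)} (A, cond B f f ?c, B)"
        unfolding FG by (rule is_join_Kl) (simp_all add: cf fc)
      then have "is_join Kl A B {(A, ?c, B), F} G"
        by (simp only: join FG insert_commute)
      moreover have "(A, ?c, B) \<in> hom Kl A B"
        by (simp add: hom_Kl)
      ultimately show "\<exists>c \<in> hom Kl A B. disjoint_maps Kl zero_Kl c F \<and> is_join Kl A B {c, F} G"
        by blast
    qed
  qed
qed

end

text \<open>The usual argument: naturality of the unit and counit makes both functors faithful, and a
  preimage of \<open>g\<close> is obtained by conjugating its image under the inverse functor with the unit.\<close>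

lemma fully_faithful_if_restriction_equivalent:
  assumes "restriction_equivalent X Y"
  obtains Fo Fa where "is_restriction_functor X Y Fo Fa"
    and "\<And>A B. \<lbrakk>A \<in> Obj X; B \<in> Obj X\<rbrakk> \<Longrightarrow> bij_betw Fa (hom X A B) (hom Y (Fo A) (Fo B))"
proof -
  obtain Fo Fa Go Ga \<eta> \<epsilon> where
      rcat: "restriction_category X" "restriction_category Y"
    and rF: "is_restriction_functor X Y Fo Fa" and rG: "is_restriction_functor Y X Go Ga"
    and \<eta>: "is_natural_iso X X (\<lambda>A. A) (\<lambda>f. f) (\<lambda>A. Go (Fo A)) (\<lambda>f. Ga (Fa f)) \<eta>"
    and \<epsilon>: "is_natural_iso Y Y (\<lambda>B. Fo (Go B)) (\<lambda>g. Fa (Ga g)) (\<lambda>B. B) (\<lambda>g. g) \<epsilon>"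
    using assms unfolding restriction_equivalent_def by blast
  interpret X: restriction_category X by (rule rcat)
  interpret Y: restriction_category Y by (rule rcat)
  have F: "Fa f \<in> hom Y (Fo A) (Fo B)" if "f \<in> hom X A B" for f A B
    using rF that X.hom_Obj[OF that] unfolding is_restriction_functor_def is_functor_def by blast
  have G: "Ga g \<in> hom X (Go A) (Go B)" if "g \<in> hom Y A B" for g A B
    using rG that Y.hom_Obj[OF that] unfolding is_restriction_functor_def is_functor_def by blast
  have \<eta>h: "\<eta> A \<in> hom X A (Go (Fo A))" "is_iso X (\<eta> A)" if "A \<in> Obj X" for A
    using \<eta> that by (auto simp: is_natural_iso_def)
  have \<epsilon>h: "\<epsilon> B \<in> hom Y (Fo (Go B)) B" "is_iso Y (\<epsilon> B)" if "B \<in> Obj Y" for B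
    using \<epsilon> that by (auto simp: is_natural_iso_def)
  have nat_\<eta>: "f \<cdot>\<^bsub>X\<^esub> \<eta> B = \<eta> A \<cdot>\<^bsub>X\<^esub> Ga (Fa f)" if "f \<in> hom X A B" for f A B
    using \<eta> that X.hom_Obj[OF that] unfolding is_natural_iso_def by blast
  have nat_\<epsilon>: "Fa (Ga g) \<cdot>\<^bsub>Y\<^esub> \<epsilon> B = \<epsilon> A \<cdot>\<^bsub>Y\<^esub> g" if "g \<in> hom Y A B" for g A B
    using \<epsilon> that Y.hom_Obj[OF that] unfolding is_natural_iso_def by blast
  have F_faithful: "f = g" if f: "f \<in> hom X A B" and g: "g \<in> hom X A B" and "Fa f = Fa g" for f g A B
  proof -
    have B: "B \<in> Obj X" using X.hom_Obj[OF f] by simp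
    note i = X.inv_arrow_simps[OF \<eta>h(2)[OF B]] and e = \<eta>h(1)[OF B]
    have "f \<cdot>\<^bsub>X\<^esub> \<eta> B = g \<cdot>\<^bsub>X\<^esub> \<eta> B" using nat_\<eta>[OF f] nat_\<eta>[OF g] that by simp
    then have "(f \<cdot>\<^bsub>X\<^esub> \<eta> B) \<cdot>\<^bsub>X\<^esub> inv_arrow X (\<eta> B) = (g \<cdot>\<^bsub>X\<^esub> \<eta> B) \<cdot>\<^bsub>X\<^esub> inv_arrow X (\<eta> B)"
      by simp
    then show ?thesis using i e f g by (simp add: hom_iff)
  qed
  have G_faithful: "f = g" if f: "f \<in> hom Y A B" and g: "g \<in> hom Y A B" and "Ga f = Ga g" for f g A B
  proof -
    have A: "A \<in> Obj Y" using Y.hom_Obj[OF f] by simp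
    have "\<epsilon> A \<cdot>\<^bsub>Y\<^esub> f = \<epsilon> A \<cdot>\<^bsub>Y\<^esub> g" using nat_\<epsilon>[OF f] nat_\<epsilon>[OF g] that by simp
    then show ?thesis
      by (rule Y.iso_cancel_left[OF \<epsilon>h(2)[OF A], rotated 4])
        (use \<epsilon>h(1)[OF A] f g in \<open>simp_all add: hom_iff\<close>)
  qed
  have F_full: "\<exists>f \<in> hom X A B. Fa f = g"
    if A: "A \<in> Obj X" and B: "B \<in> Obj X" and g: "g \<in> hom Y (Fo A) (Fo B)" for g A B
  proof -
    note iB = X.inv_arrow_simps[OF \<eta>h(2)[OF B]] and eB = \<eta>h(1)[OF B] and eA = \<eta>h(1)[OF A]
    let ?f = "\<eta> A \<cdot>\<^bsub>X\<^esub> (Ga g \<cdot>\<^bsub>X\<^esub> inv_arrow X (\<eta> B))"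
    have f: "?f \<in> hom X A B"
      using iB eB eA G[OF g] by (simp add: hom_iff)
    have "\<eta> A \<cdot>\<^bsub>X\<^esub> Ga (Fa ?f) = ?f \<cdot>\<^bsub>X\<^esub> \<eta> B" using nat_\<eta>[OF f] by simp
    also have "\<dots> = \<eta> A \<cdot>\<^bsub>X\<^esub> Ga g"
      using iB eB eA G[OF g] by (simp add: hom_iff)
    finally have "Ga (Fa ?f) = Ga g"
      by (rule X.iso_cancel_left[OF \<eta>h(2)[OF A], rotated 4])
        (use eA G[OF g] G[OF F[OF f]] in \<open>simp_all add: hom_iff\<close>)
    then have "Fa ?f = g" by (rule G_faithful[OF F[OF f] g])
    then show ?thesis using f by blast
  qed
  have "bij_betw Fa (hom X A B) (hom Y (Fo A) (Fo B))" if "A \<in> Obj X" "B \<in> Obj X" for A B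
    unfolding bij_betw_def
  proof
    show "inj_on Fa (hom X A B)" using F_faithful by (auto simp: inj_on_def)
    show "Fa ` hom X A B = hom Y (Fo A) (Fo B)" using F F_full[OF that] by blast
  qed
  then show ?thesis using that rF by blast
qed

theorem classical_if_equivalent_exception_kleisli:
  assumes "distributive_category D T" "restriction_equivalent X (exception_kleisli D T)"
  shows "classical_restriction_category X"
proof -
  interpret D: distributive_category D T by (rule assms)
  have rcat: "restriction_category X" "restriction_category (exception_kleisli D T)"
    using assms(2) by (simp_all add: restriction_equivalent_def)
  obtain Fo Fa where "is_restriction_functor X (exception_kleisli D T) Fo Fa"
    and "\<And>A B. \<lbrakk>A \<in> Obj X; B \<in> Obj X\<rbrakk> \<Longrightarrow>
      bij_betw Fa (hom X A B) (hom (exception_kleisli D T) (Fo A) (Fo B))"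
    using fully_faithful_if_restriction_equivalent[OF assms(2)] by blast
  then show ?thesis
    using classical_if_fully_faithful[OF rcat(1) D.classical_Kl[OF rcat(2)]] by blast
qed

section \<open>Calculating in distributive restriction categories\<close>

sublocale cocartesian_restriction_category \<subseteq> category_with_coproducts X S
  by standard (rule coproducts)

context cocartesian_restriction_category
begin

lemma Rst_Inj [simp]:
  assumes "A \<in> Obj X" "B \<in> Obj X"
  shows "Rst X (Inj0 S A B) = Ide X A" "Rst X (Inj1 S A B) = Ide X B"
  using total_Inj0[OF assms] total_Inj1[OF assms] assms by (simp_all add: is_total_iff)

lemma Inj_Rst:
  assumes "A \<in> Obj X" "B \<in> Obj X" "h \<in> Arr X" "Dom X h = Coprod S A B"
  shows "Inj0 S A B \<cdot> Rst X h = Rst X (Inj0 S A B \<cdot> h) \<cdot> Inj0 S A B"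
    "Inj1 S A B \<cdot> Rst X h = Rst X (Inj1 S A B \<cdot> h) \<cdot> Inj1 S A B"
  using assms by (simp_all add: Comp_Rst)

text \<open>By [R.4], the component of the restriction at an injection \<open>\<iota>\<close> is \<open>Rst X (\<iota> \<cdot> copair X S f g) \<cdot> \<iota>\<close>.\<close>

lemma Rst_copair:
  assumes "f \<in> Arr X" "g \<in> Arr X" "Cod X f = Cod X g" "Dom X f = A" "Dom X g = B"
  shows "Rst X (copair X S f g) = copair X S (Rst X f \<cdot> Inj0 S A B) (Rst X g \<cdot> Inj1 S A B)"
proof -
  have "A \<in> Obj X" "B \<in> Obj X" using assms by auto
  then show ?thesis
    using assms by (intro copair_eqI[symmetric]) (simp_all add: Inj_Rst)
qed

lemma total_copair:
  assumes "is_total X f" "is_total X g" "Cod X f = Cod X g"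
  shows "is_total X (copair X S f g)"
proof -
  have "copair X S (Inj0 S (Dom X f) (Dom X g)) (Inj1 S (Dom X f) (Dom X g))
      = Ide X (Coprod S (Dom X f) (Dom X g))"
    by (rule copair_eqI) (use assms in \<open>simp_all add: is_total_iff\<close>)
  then show ?thesis
    using assms by (simp add: is_total_iff Rst_copair)
qed

end

context cartesian_restriction_category
begin

lemma Terminal_Obj [simp]: "Terminal S \<in> Obj X"
  using restriction_terminal by (simp add: restriction_terminal_def)

lemma total_to_Terminal:
  assumes "A \<in> Obj X"
  obtains t where "t \<in> hom X A (Terminal S)" "is_total X t"
  using restriction_terminal assms unfolding restriction_terminal_def by blast

lemma total_to_Terminal_unique:
  assumes "s \<in> hom X A (Terminal S)" "is_total X s" "t \<in> hom X A (Terminal S)" "is_total X t"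
  shows "s = t"
  using restriction_terminal assms hom_Obj(1)[OF assms(1)]
  unfolding restriction_terminal_def by blast

lemma Proj_simps [simp]:
  assumes "A \<in> Obj X" "B \<in> Obj X"
  shows "Prod S A B \<in> Obj X"
    "Proj0 S A B \<in> Arr X" "Dom X (Proj0 S A B) = Prod S A B" "Cod X (Proj0 S A B) = A"
    "Proj1 S A B \<in> Arr X" "Dom X (Proj1 S A B) = Prod S A B" "Cod X (Proj1 S A B) = B"
    "Rst X (Proj0 S A B) = Ide X (Prod S A B)" "Rst X (Proj1 S A B) = Ide X (Prod S A B)"
  using restriction_products[OF assms]
  by (auto simp: is_restriction_product_def hom_iff is_total_iff)

abbreviation rpair where "rpair \<equiv> restriction_pair X S"

lemma rpair_ex1:
  assumes "f \<in> hom X D A" "g \<in> hom X D B"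
  shows "\<exists>!h. h \<in> hom X D (Prod S A B) \<and>
    h \<cdot> Proj0 S A B = Rst X g \<cdot> f \<and> h \<cdot> Proj1 S A B = Rst X f \<cdot> g"
  using restriction_products[of A B] assms hom_Obj[OF assms(1)] hom_Obj[OF assms(2)]
  unfolding is_restriction_product_def by blast

lemma rpair_props:
  assumes "f \<in> Arr X" "g \<in> Arr X" "Dom X f = Dom X g"
  shows "rpair f g \<in> hom X (Dom X f) (Prod S (Cod X f) (Cod X g)) \<and>
    rpair f g \<cdot> Proj0 S (Cod X f) (Cod X g) = Rst X g \<cdot> f \<and>
    rpair f g \<cdot> Proj1 S (Cod X f) (Cod X g) = Rst X f \<cdot> g"
  unfolding restriction_pair_def
  by (rule theI', rule rpair_ex1) (use assms in \<open>simp_all add: hom_iff\<close>)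

lemma rpair_simps [simp]:
  assumes "f \<in> Arr X" "g \<in> Arr X" "Dom X f = Dom X g"
  shows "rpair f g \<in> Arr X" "Dom X (rpair f g) = Dom X g"
    "Cod X (rpair f g) = Prod S (Cod X f) (Cod X g)"
  using rpair_props[OF assms] assms by (simp_all add: hom_iff)

lemma rpair_Proj [simp]:
  assumes "f \<in> Arr X" "g \<in> Arr X" "Dom X f = Dom X g" "Cod X f = A" "Cod X g = B"
  shows "rpair f g \<cdot> Proj0 S A B = Rst X g \<cdot> f" "rpair f g \<cdot> Proj1 S A B = Rst X f \<cdot> g"
  using rpair_props[OF assms(1-3)] assms by simp_all

lemma rpair_Proj_Comp [simp]:
  assumes "f \<in> Arr X" "g \<in> Arr X" "Dom X f = Dom X g" "Cod X f = A" "Cod X g = B"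
  shows "\<lbrakk>h \<in> Arr X; Dom X h = A\<rbrakk> \<Longrightarrow> rpair f g \<cdot> (Proj0 S A B \<cdot> h) = Rst X g \<cdot> (f \<cdot> h)"
    "\<lbrakk>h \<in> Arr X; Dom X h = B\<rbrakk> \<Longrightarrow> rpair f g \<cdot> (Proj1 S A B \<cdot> h) = Rst X f \<cdot> (g \<cdot> h)"
proof -
  have AB: "A \<in> Obj X" "B \<in> Obj X" using assms by auto
  note p = rpair_Proj[OF assms]
  show "rpair f g \<cdot> (Proj0 S A B \<cdot> h) = Rst X g \<cdot> (f \<cdot> h)" if "h \<in> Arr X" "Dom X h = A"
  proof -
    have "rpair f g \<cdot> (Proj0 S A B \<cdot> h) = (rpair f g \<cdot> Proj0 S A B) \<cdot> h"
      by (rule Comp_assoc_simp[symmetric]) (use assms AB that in simp_all)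
    then show ?thesis unfolding p using assms that by simp
  qed
  show "rpair f g \<cdot> (Proj1 S A B \<cdot> h) = Rst X f \<cdot> (g \<cdot> h)" if "h \<in> Arr X" "Dom X h = B"
  proof -
    have "rpair f g \<cdot> (Proj1 S A B \<cdot> h) = (rpair f g \<cdot> Proj1 S A B) \<cdot> h"
      by (rule Comp_assoc_simp[symmetric]) (use assms AB that in simp_all)
    then show ?thesis unfolding p using assms that by simp
  qed
qed

lemma rpair_eqI:
  assumes "f \<in> Arr X" "g \<in> Arr X" "Dom X f = Dom X g" "h \<in> Arr X" "Dom X h = Dom X f"
    and "Cod X h = Prod S (Cod X f) (Cod X g)"
    and "h \<cdot> Proj0 S (Cod X f) (Cod X g) = Rst X g \<cdot> f"
    and "h \<cdot> Proj1 S (Cod X f) (Cod X g) = Rst X f \<cdot> g"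
  shows "h = rpair f g"
proof -
  have "\<exists>!h. h \<in> hom X (Dom X f) (Prod S (Cod X f) (Cod X g)) \<and>
      h \<cdot> Proj0 S (Cod X f) (Cod X g) = Rst X g \<cdot> f \<and>
      h \<cdot> Proj1 S (Cod X f) (Cod X g) = Rst X f \<cdot> g"
    by (rule rpair_ex1) (use assms in \<open>simp_all add: hom_iff\<close>)
  moreover have "h \<in> hom X (Dom X f) (Prod S (Cod X f) (Cod X g))"
    using assms by (simp add: hom_iff)
  ultimately show ?thesis
    using rpair_props[OF assms(1-3)] assms(7,8) by blast
qed

lemma total_rpair:
  assumes "is_total X f" "is_total X g" "Dom X f = Dom X g"
  shows "is_total X (rpair f g)"
proof (rule total_if_Comp_total)
  show "is_total X (rpair f g \<cdot> Proj0 S (Cod X f) (Cod X g))"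
    using assms by (simp add: is_total_iff)
qed (use assms in \<open>simp_all add: is_total_iff\<close>)

end

locale distributive_restriction_category_with_zeroes =
  distributive_restriction_category X S + restriction_category_with_zeroes X Z
  for X :: "('o, 'a, 'm) rcategory_scheme" (structure)
    and S :: "('o, 'a) prod_coprod" and Z :: "'o \<Rightarrow> 'o \<Rightarrow> 'a"

section \<open>Case distinction in classical restriction categories\<close>

context classical_restriction_category
begin

text \<open>The complement of a restriction \<open>Rst X f\<close> in the identity. Being below the identity, it is itself a
  restriction idempotent. Zero maps are unique, so the zeroes that come with the
  relative complements can be replaced by any given ones.\<close>

lemma complement_exists:
  assumes Z: "restriction_zeroes X Z" and f: "f \<in> hom X A B"
  obtains c where "c \<in> hom X A A" "Rst X c = c" "c \<cdot> f = Z A B" "c \<cdot> Rst X f = Z A A"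
    "Rst X f \<cdot> c = Z A A" "is_join X A A {c, Rst X f} (Ide X A)"
proof -
  interpret restriction_category_with_zeroes X Z by standard (rule Z)
  have A: "A \<in> Obj X" "B \<in> Obj X" and fA: "f \<in> Arr X" "Dom X f = A" "Cod X f = B"
    using f hom_Obj[OF f] by (auto simp: hom_iff)
  obtain Z' where Z': "restriction_zeroes X Z'"
    and compl: "\<And>f g. \<lbrakk>f \<in> hom X A A; g \<in> hom X A A; restriction_le X f g\<rbrakk> \<Longrightarrow>
      \<exists>c \<in> hom X A A. disjoint_maps X Z' c f \<and> is_join X A A {c, f} g"
    using relative_complements A(1) by blast
  interpret Z': restriction_category_with_zeroes X Z' by standard (rule Z')
  have "Z A A \<cdot> Z' A A = Z A A" "Z A A \<cdot> Z' A A = Z' A A"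
    using A zero_Comp[of "Z' A A" A A] Z'.Comp_zero[of "Z A A" A A]
    by (simp_all del: zero_Comp Z'.Comp_zero Comp_zero Z'.zero_Comp)
  then have ZZ: "Z' A A = Z A A" by simp
  have "restriction_le X (Rst X f) (Ide X A)" "Rst X f \<in> hom X A A" "Ide X A \<in> hom X A A"
    using A fA by (simp_all add: restriction_le_def hom_iff)
  then obtain c where c: "c \<in> hom X A A" "disjoint_maps X Z' c (Rst X f)"
    "is_join X A A {c, Rst X f} (Ide X A)"
    using compl by blast
  have cA: "c \<in> Arr X" "Dom X c = A" "Cod X c = A" using c(1) by (auto simp: hom_iff)
  have Rc: "Rst X c = c"
    using c(3) A cA by (simp add: is_join_def restriction_le_def)
  have 1: "c \<cdot> Rst X f = Z A A"
    using c(2) Rc fA cA ZZ by (simp add: disjoint_maps_def)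
  have "c \<cdot> f = (c \<cdot> Rst X f) \<cdot> f" using fA cA by simp
  then have 2: "c \<cdot> f = Z A B" unfolding 1 using A fA by simp
  have 3: "Rst X f \<cdot> c = Z A A"
    using Rst_commute[of f c] 1 Rc fA cA by simp
  show ?thesis by (rule that[OF c(1) Rc 2 1 3 c(3)])
qed

text \<open>Only precomposition is assumed to preserve joins. That \<open>u\<close> is the join of its restrictions to a
  cover of the identity is the instance of preservation by postcomposition that definition by cases
  requires.\<close>

lemma join_cover:
  assumes c: "c \<in> hom X A A" "Rst X c = c" and e: "e \<in> hom X A A" "Rst X e = e"
    and join: "is_join X A A {c, e} (Ide X A)" and u: "u \<in> hom X A B"
  shows "is_join X A B {c \<cdot> u, e \<cdot> u} u"
proof -
  have [simp]: "c \<in> Arr X" "Dom X c = A" "Cod X c = A" "e \<in> Arr X" "Dom X e = A" "Cod X e = A"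
    "u \<in> Arr X" "Dom X u = A" "Cod X u = B"
    using c e u by (auto simp: hom_iff)
  have AB: "A \<in> Obj X" "B \<in> Obj X" using hom_Obj[OF u] by auto
  have Rcu: "Rst X (c \<cdot> u) = c \<cdot> Rst X u" "Rst X (e \<cdot> u) = e \<cdot> Rst X u"
    using Rst_Rst_Comp[of u c] Rst_Rst_Comp[of u e] c e by simp_all
  have comm: "c \<cdot> Rst X u = Rst X u \<cdot> c" "e \<cdot> Rst X u = Rst X u \<cdot> e" "c \<cdot> e = e \<cdot> c"
    using Rst_commute[of c u] Rst_commute[of e u] Rst_commute[of c e] c e by simp_all
  have le: "restriction_le X (c \<cdot> u) u" "restriction_le X (e \<cdot> u) u"
    by (simp_all add: restriction_le_def Rcu)
  have hom: "c \<cdot> u \<in> hom X A B" "e \<cdot> u \<in> hom X A B" by (simp_all add: hom_iff)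
  have below: "compatible X f g"
    if "f \<in> hom X A B" "g \<in> hom X A B" "restriction_le X f u" "restriction_le X g u" for f g
  proof -
    have "Rst X f \<cdot> g = Rst X f \<cdot> (Rst X g \<cdot> u)" using that by (simp add: restriction_le_def)
    also have "\<dots> = Rst X g \<cdot> (Rst X f \<cdot> u)"
      by (rule Rst_commute_Comp) (use that in \<open>simp_all add: hom_iff\<close>)
    also have "\<dots> = Rst X g \<cdot> f" using that by (simp add: restriction_le_def)
    finally show ?thesis by (simp add: compatible_def)
  qed
  have "compatible_family X A B {c \<cdot> u, e \<cdot> u}"
    unfolding compatible_family_def using hom below le by blast
  then obtain m where m: "is_join X A B {c \<cdot> u, e \<cdot> u} m"
    using join_exists[OF AB] by blast
  then have mh: "m \<in> hom X A B" and mA: "m \<in> Arr X" "Dom X m = A" "Cod X m = B"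
    and cm: "restriction_le X (c \<cdot> u) m" and em: "restriction_le X (e \<cdot> u) m"
    and mu: "Rst X m \<cdot> u = m"
    using le u by (auto simp: is_join_def hom_iff restriction_le_def)
  have dom: "restriction_le X (Rst X f) (Rst X m)" if "f \<in> hom X A B" "restriction_le X f m" for f
    using that mA Rst_Rst_Comp[of m f] by (simp add: restriction_le_def hom_iff)
  have ce: "compatible_family X A A {c, e}"
    using c e comm by (auto simp: compatible_family_def compatible_def)
  \<comment> \<open>The join \<open>m\<close> of \<open>c \<cdot> u\<close> and \<open>e \<cdot> u\<close> lies below \<open>u\<close>, so it remains to compare domains: the cover,
    precomposed with \<open>Rst X u\<close>, shows that \<open>Rst X u\<close> lies below \<open>Rst X m\<close>.\<close>
  have "is_join X A A {Rst X u \<cdot> c, Rst X u \<cdot> e} (Rst X u)"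
    using join_precomp[OF ce join, of "Rst X u" A] AB by (simp add: hom_iff)
  moreover have "restriction_le X (Rst X u \<cdot> c) (Rst X m)" "restriction_le X (Rst X u \<cdot> e) (Rst X m)"
    using dom[OF hom(1) cm] dom[OF hom(2) em] by (simp_all add: Rcu comm)
  moreover have "Rst X m \<in> hom X A A" using mA by (simp add: hom_iff)
  ultimately have "restriction_le X (Rst X u) (Rst X m)"
    by (simp add: is_join_def)
  then have um: "Rst X u \<cdot> Rst X m = Rst X u" by (simp add: restriction_le_def)
  have "u = (Rst X u \<cdot> Rst X m) \<cdot> u" unfolding um by simp
  also have "\<dots> = Rst X u \<cdot> (Rst X m \<cdot> u)" using mA by simp
  also have "\<dots> = Rst X m \<cdot> (Rst X u \<cdot> u)"
    by (rule Rst_commute_Comp) (use mA in simp_all)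
  also have "\<dots> = m" using mu by simp
  finally show ?thesis using m by simp
qed

lemma eq_on_cover:
  assumes "c \<in> hom X A A" "Rst X c = c" "e \<in> hom X A A" "Rst X e = e"
    and "is_join X A A {c, e} (Ide X A)" "u \<in> hom X A B" "v \<in> hom X A B"
    and "c \<cdot> u = c \<cdot> v" "e \<cdot> u = e \<cdot> v"
  shows "u = v"
  using is_join_unique[OF join_cover[OF assms(1-5,6)]] join_cover[OF assms(1-5,7)] assms(8,9)
  by simp

text \<open>Disjointness of \<open>c\<close> and \<open>e\<close> makes \<open>c \<cdot> v\<close> and \<open>e \<cdot> u\<close> compatible, and \<open>w\<close> is their join.\<close>

lemma glue_on_cover:
  assumes Z: "restriction_zeroes X Z"
    and c: "c \<in> hom X A A" "Rst X c = c" and e: "e \<in> hom X A A" "Rst X e = e"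
    and join: "is_join X A A {c, e} (Ide X A)"
    and disj: "c \<cdot> e = Z A A" "e \<cdot> c = Z A A"
    and u: "u \<in> hom X A B" and v: "v \<in> hom X A B"
  obtains w where "w \<in> hom X A B" "e \<cdot> w = e \<cdot> u" "c \<cdot> w = c \<cdot> v"
proof -
  interpret restriction_category_with_zeroes X Z by standard (rule Z)
  have [simp]: "c \<in> Arr X" "Dom X c = A" "Cod X c = A" "e \<in> Arr X" "Dom X e = A" "Cod X e = A"
    "u \<in> Arr X" "Dom X u = A" "Cod X u = B" "v \<in> Arr X" "Dom X v = A" "Cod X v = B"
    using c e u v by (auto simp: hom_iff)
  have [simp]: "A \<in> Obj X" "B \<in> Obj X" using hom_Obj[OF u] by auto
  have ceh: "c \<cdot> (e \<cdot> h) = Z A E" "e \<cdot> (c \<cdot> h) = Z A E" "c \<cdot> (c \<cdot> h) = c \<cdot> h" "e \<cdot> (e \<cdot> h) = e \<cdot> h"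
    if "h \<in> hom X A E" for h E
  proof -
    have h: "h \<in> Arr X" "Dom X h = A" "Cod X h = E" using that by (auto simp: hom_iff)
    have "c \<cdot> (e \<cdot> h) = (c \<cdot> e) \<cdot> h" "e \<cdot> (c \<cdot> h) = (e \<cdot> c) \<cdot> h" using h by simp_all
    then show "c \<cdot> (e \<cdot> h) = Z A E" "e \<cdot> (c \<cdot> h) = Z A E" using h disj by simp_all
    show "c \<cdot> (c \<cdot> h) = c \<cdot> h" using Rst_idem_Comp[of c h] h c by simp
    show "e \<cdot> (e \<cdot> h) = e \<cdot> h" using Rst_idem_Comp[of e h] h e by simp
  qed
  have R: "Rst X (c \<cdot> v) = c \<cdot> Rst X v" "Rst X (e \<cdot> u) = e \<cdot> Rst X u"
    using Rst_Rst_Comp[of v c] Rst_Rst_Comp[of u e] c e by simp_all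
  have Rv: "c \<cdot> Rst X v = Rst X v \<cdot> c" "e \<cdot> Rst X u = Rst X u \<cdot> e"
    using Rst_commute[of c v] Rst_commute[of e u] c e by simp_all
  have "Rst X (c \<cdot> v) \<cdot> (e \<cdot> u) = Z A B" "Rst X (e \<cdot> u) \<cdot> (c \<cdot> v) = Z A B"
    unfolding R Rv using ceh(1)[OF u] ceh(2)[OF v] by simp_all
  then have fam: "compatible_family X A B {c \<cdot> v, e \<cdot> u}"
    by (auto simp: compatible_family_def compatible_def hom_iff)
  then obtain w where w: "is_join X A B {c \<cdot> v, e \<cdot> u} w"
    using join_exists[of A B] by auto
  have join_Z: "is_join X A B {f, Z A B} f" "is_join X A B {Z A B, f} f" if "f \<in> hom X A B" for f
    using that by (auto simp: is_join_def restriction_le_def hom_iff)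
  have "is_join X A B {c \<cdot> v, Z A B} (c \<cdot> w)"
    using join_precomp[OF fam w c(1)] ceh(3)[OF v] ceh(1)[OF u] by simp
  then have "c \<cdot> w = c \<cdot> v"
    by (rule is_join_unique) (rule join_Z, simp add: hom_iff)
  moreover have "is_join X A B {Z A B, e \<cdot> u} (e \<cdot> w)"
    using join_precomp[OF fam w e(1)] ceh(2)[OF v] ceh(4)[OF u] by simp
  then have "e \<cdot> w = e \<cdot> u"
    by (rule is_join_unique) (rule join_Z, simp add: hom_iff)
  moreover have "w \<in> hom X A B" using w unfolding is_join_def by blast
  ultimately show ?thesis using that by blast
qed

text \<open>A map that avoids one half of a cover of its codomain lands in the other half.\<close>

lemma absorb_cover:
  assumes Z: "restriction_zeroes X Z"
    and c: "c \<in> hom X A A" "Rst X c = c" and e: "e \<in> hom X A A" "Rst X e = e"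
    and join: "is_join X A A {c, e} (Ide X A)"
    and k: "k \<in> hom X D A" "k \<cdot> e = Z D A"
  shows "k \<cdot> c = k"
proof -
  interpret restriction_category_with_zeroes X Z by standard (rule Z)
  have A: "A \<in> Obj X" "D \<in> Obj X" using hom_Obj[OF k(1)] by auto
  have kc: "k \<cdot> c \<in> hom X D A" using k c by (simp add: hom_iff)
  have "c \<cdot> e = e \<cdot> c"
    using Rst_commute[of c e] c e by (simp add: hom_iff)
  then have "compatible_family X A A {c, e}"
    using c e by (auto simp: compatible_family_def compatible_def)
  from join_precomp[OF this join k(1)]
  have "is_join X D A {k \<cdot> c, Z D A} k"
    using k A by (simp add: hom_iff)
  moreover have "is_join X D A {k \<cdot> c, Z D A} (k \<cdot> c)"
    using kc A by (auto simp: is_join_def restriction_le_def hom_iff)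
  ultimately show ?thesis by (metis is_join_unique)
qed

end

section \<open>The classical product as a threefold coproduct\<close>

context distributive_restriction_category_with_zeroes
begin

abbreviation classical_prod where "classical_prod A B \<equiv> Coprod S A (Coprod S B (Prod S A B))"

definition cproj0 where "cproj0 A B = copair X S (Ide X A) (copair X S (Z B A) (Proj0 S A B))"
definition cproj1 where "cproj1 A B = copair X S (Z A B) (copair X S (Ide X B) (Proj1 S A B))"

definition inj_only0 where "inj_only0 A B = Inj0 S A (Coprod S B (Prod S A B))"
definition inj_only1 where
  "inj_only1 A B = Inj0 S B (Prod S A B) \<cdot> Inj1 S A (Coprod S B (Prod S A B))"
definition inj_both where
  "inj_both A B = Inj1 S B (Prod S A B) \<cdot> Inj1 S A (Coprod S B (Prod S A B))"

lemma classical_prod_simps [simp]: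
  assumes "A \<in> Obj X" "B \<in> Obj X"
  shows "cproj0 A B \<in> Arr X" "Dom X (cproj0 A B) = classical_prod A B" "Cod X (cproj0 A B) = A"
    "cproj1 A B \<in> Arr X" "Dom X (cproj1 A B) = classical_prod A B" "Cod X (cproj1 A B) = B"
    "inj_only0 A B \<in> Arr X" "Dom X (inj_only0 A B) = A" "Cod X (inj_only0 A B) = classical_prod A B"
    "inj_only1 A B \<in> Arr X" "Dom X (inj_only1 A B) = B" "Cod X (inj_only1 A B) = classical_prod A B"
    "inj_both A B \<in> Arr X" "Dom X (inj_both A B) = Prod S A B"
    "Cod X (inj_both A B) = classical_prod A B"
    "Rst X (inj_only0 A B) = Ide X A" "Rst X (inj_only1 A B) = Ide X B"
    "Rst X (inj_both A B) = Ide X (Prod S A B)"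
    "inj_only0 A B \<cdot> cproj0 A B = Ide X A" "inj_only0 A B \<cdot> cproj1 A B = Z A B"
    "inj_only1 A B \<cdot> cproj0 A B = Z B A" "inj_only1 A B \<cdot> cproj1 A B = Ide X B"
    "inj_both A B \<cdot> cproj0 A B = Proj0 S A B" "inj_both A B \<cdot> cproj1 A B = Proj1 S A B"
  using assms total_Inj0 total_Inj1
  by (simp_all add: cproj0_def cproj1_def inj_only0_def inj_only1_def inj_both_def
      Rst_Comp_total)

lemma classical_prod_eqI:
  assumes "u \<in> Arr X" "v \<in> Arr X" "Dom X u = classical_prod A B"
    "Dom X v = classical_prod A B" "Cod X u = Cod X v" "A \<in> Obj X" "B \<in> Obj X"
    and "inj_only0 A B \<cdot> u = inj_only0 A B \<cdot> v" "inj_only1 A B \<cdot> u = inj_only1 A B \<cdot> v"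
    and "inj_both A B \<cdot> u = inj_both A B \<cdot> v"
  shows "u = v"
  by (rule ternary_coproduct_eqI[where A=A and B=B and E="Prod S A B"])
    (use assms in \<open>simp_all add: inj_only0_def inj_only1_def inj_both_def\<close>)

definition match where "match f g h = copair X S f (copair X S g h)"

lemma match_simps [simp]:
  assumes "f \<in> Arr X" "g \<in> Arr X" "h \<in> Arr X" "Dom X f = A" "Dom X g = B" "Dom X h = Prod S A B"
    "Cod X f = Cod X h" "Cod X g = Cod X h" "A \<in> Obj X" "B \<in> Obj X"
  shows "match f g h \<in> Arr X" "Dom X (match f g h) = classical_prod A B"
    "Cod X (match f g h) = Cod X h"
    "inj_only0 A B \<cdot> match f g h = f" "inj_only1 A B \<cdot> match f g h = g"
    "inj_both A B \<cdot> match f g h = h"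
  using assms by (simp_all add: match_def inj_only0_def inj_only1_def inj_both_def)

lemma inj_Comp_cproj [simp]:
  assumes "A \<in> Obj X" "B \<in> Obj X" "m \<in> Arr X"
  shows "Dom X m = A \<Longrightarrow> inj_only0 A B \<cdot> (cproj0 A B \<cdot> m) = m"
    "Dom X m = B \<Longrightarrow> inj_only0 A B \<cdot> (cproj1 A B \<cdot> m) = Z A (Cod X m)"
    "Dom X m = A \<Longrightarrow> inj_only1 A B \<cdot> (cproj0 A B \<cdot> m) = Z B (Cod X m)"
    "Dom X m = B \<Longrightarrow> inj_only1 A B \<cdot> (cproj1 A B \<cdot> m) = m"
    "Dom X m = A \<Longrightarrow> inj_both A B \<cdot> (cproj0 A B \<cdot> m) = Proj0 S A B \<cdot> m"
    "Dom X m = B \<Longrightarrow> inj_both A B \<cdot> (cproj1 A B \<cdot> m) = Proj1 S A B \<cdot> m"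
  using assms by (simp_all flip: Comp_assoc_simp)

lemma inj_Comp_match [simp]:
  assumes "f \<in> Arr X" "g \<in> Arr X" "h \<in> Arr X" "Dom X f = A" "Dom X g = B" "Dom X h = Prod S A B"
    "Cod X f = Cod X h" "Cod X g = Cod X h" "A \<in> Obj X" "B \<in> Obj X" "m \<in> Arr X" "Dom X m = Cod X h"
  shows "inj_only0 A B \<cdot> (match f g h \<cdot> m) = f \<cdot> m" "inj_only1 A B \<cdot> (match f g h \<cdot> m) = g \<cdot> m"
    "inj_both A B \<cdot> (match f g h \<cdot> m) = h \<cdot> m"
  using assms by (simp_all flip: Comp_assoc_simp)

lemma inj_Rst_Comp [simp]:
  assumes "A \<in> Obj X" "B \<in> Obj X" "h \<in> Arr X" "k \<in> Arr X"
    and "Dom X h = classical_prod A B" "Dom X k = classical_prod A B"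
  shows "inj_only0 A B \<cdot> (Rst X h \<cdot> k) = Rst X (inj_only0 A B \<cdot> h) \<cdot> (inj_only0 A B \<cdot> k)"
    "inj_only1 A B \<cdot> (Rst X h \<cdot> k) = Rst X (inj_only1 A B \<cdot> h) \<cdot> (inj_only1 A B \<cdot> k)"
    "inj_both A B \<cdot> (Rst X h \<cdot> k) = Rst X (inj_both A B \<cdot> h) \<cdot> (inj_both A B \<cdot> k)"
  using assms by (simp_all add: Comp_Rst_Comp)

lemma inj_Rst [simp]:
  assumes "A \<in> Obj X" "B \<in> Obj X" "h \<in> Arr X" "Dom X h = classical_prod A B"
  shows "inj_only0 A B \<cdot> Rst X h = Rst X (inj_only0 A B \<cdot> h) \<cdot> inj_only0 A B"
    "inj_only1 A B \<cdot> Rst X h = Rst X (inj_only1 A B \<cdot> h) \<cdot> inj_only1 A B"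
    "inj_both A B \<cdot> Rst X h = Rst X (inj_both A B \<cdot> h) \<cdot> inj_both A B"
  using assms by (simp_all add: Comp_Rst)

text \<open>The restriction idempotents that pick the first and the second summand. They are the complements
  of the domains of the second and the first projection.\<close>

definition only0 where "only0 A B = match (inj_only0 A B) (Z B (classical_prod A B))
  (Z (Prod S A B) (classical_prod A B))"
definition only1 where "only1 A B = match (Z A (classical_prod A B)) (inj_only1 A B)
  (Z (Prod S A B) (classical_prod A B))"

lemma only_simps [simp]:
  assumes "A \<in> Obj X" "B \<in> Obj X"
  shows "only0 A B \<in> Arr X" "Dom X (only0 A B) = classical_prod A B"
    "Cod X (only0 A B) = classical_prod A B"
    "only1 A B \<in> Arr X" "Dom X (only1 A B) = classical_prod A B"
    "Cod X (only1 A B) = classical_prod A B"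
  using assms by (simp_all add: only0_def only1_def)

lemma Rst_only [simp]:
  assumes "A \<in> Obj X" "B \<in> Obj X"
  shows "Rst X (only0 A B) = only0 A B" "Rst X (only1 A B) = only1 A B"
proof -
  show "Rst X (only0 A B) = only0 A B"
    by (rule classical_prod_eqI[where A=A and B=B]) (use assms in \<open>simp_all add: only0_def\<close>)
  show "Rst X (only1 A B) = only1 A B"
    by (rule classical_prod_eqI[where A=A and B=B]) (use assms in \<open>simp_all add: only1_def\<close>)
qed

lemma only_factor:
  assumes "A \<in> Obj X" "B \<in> Obj X"
  shows "only0 A B \<cdot> (cproj0 A B \<cdot> inj_only0 A B) = only0 A B"
    "only1 A B \<cdot> (cproj1 A B \<cdot> inj_only1 A B) = only1 A B"
proof -
  show "only0 A B \<cdot> (cproj0 A B \<cdot> inj_only0 A B) = only0 A B"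
    by (rule classical_prod_eqI[where A=A and B=B]) (use assms in \<open>simp_all add: only0_def\<close>)
  show "only1 A B \<cdot> (cproj1 A B \<cdot> inj_only1 A B) = only1 A B"
    by (rule classical_prod_eqI[where A=A and B=B]) (use assms in \<open>simp_all add: only1_def\<close>)
qed

text \<open>An upper bound of \<open>only0\<close> and the domain of the second projection agrees with the identity on
  each of the three summands.\<close>

lemma join_only:
  assumes "A \<in> Obj X" "B \<in> Obj X"
  defines "M \<equiv> classical_prod A B"
  shows "is_join X M M {only0 A B, Rst X (cproj1 A B)} (Ide X M)"
    "is_join X M M {only1 A B, Rst X (cproj0 A B)} (Ide X M)"
proof -
  note [simp] = assms(1,2)
  have M: "Dom X k = M \<longleftrightarrow> Dom X k = classical_prod A B" for k by (simp add: M_def)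
  have "Ide X M = k" if k: "k \<in> hom X M M" and "only0 A B = only0 A B \<cdot> k"
    and "Rst X (cproj1 A B) = Rst X (cproj1 A B) \<cdot> k" for k
  proof (rule classical_prod_eqI[where A=A and B=B])
    have [simp]: "k \<in> Arr X" "Dom X k = classical_prod A B" "Cod X k = classical_prod A B"
      using k by (simp_all add: hom_iff M_def)
    have "inj_only0 A B \<cdot> only0 A B = inj_only0 A B \<cdot> (only0 A B \<cdot> k)" using that by simp
    then show "inj_only0 A B \<cdot> Ide X M = inj_only0 A B \<cdot> k"
      by (simp add: only0_def M_def)
    have "inj_only1 A B \<cdot> Rst X (cproj1 A B) = inj_only1 A B \<cdot> (Rst X (cproj1 A B) \<cdot> k)"
      "inj_both A B \<cdot> Rst X (cproj1 A B) = inj_both A B \<cdot> (Rst X (cproj1 A B) \<cdot> k)"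
      using that by simp_all
    then show "inj_only1 A B \<cdot> Ide X M = inj_only1 A B \<cdot> k" "inj_both A B \<cdot> Ide X M = inj_both A B \<cdot> k"
      by (simp_all add: M_def)
  qed (use k in \<open>simp_all add: hom_iff M_def\<close>)
  then show "is_join X M M {only0 A B, Rst X (cproj1 A B)} (Ide X M)"
    by (auto simp: is_join_def restriction_le_def hom_iff M_def)
  have "Ide X M = k" if k: "k \<in> hom X M M" and "only1 A B = only1 A B \<cdot> k"
    and "Rst X (cproj0 A B) = Rst X (cproj0 A B) \<cdot> k" for k
  proof (rule classical_prod_eqI[where A=A and B=B])
    have [simp]: "k \<in> Arr X" "Dom X k = classical_prod A B" "Cod X k = classical_prod A B"
      using k by (simp_all add: hom_iff M_def)
    have "inj_only1 A B \<cdot> only1 A B = inj_only1 A B \<cdot> (only1 A B \<cdot> k)" using that by simp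
    then show "inj_only1 A B \<cdot> Ide X M = inj_only1 A B \<cdot> k"
      by (simp add: only1_def M_def)
    have "inj_only0 A B \<cdot> Rst X (cproj0 A B) = inj_only0 A B \<cdot> (Rst X (cproj0 A B) \<cdot> k)"
      "inj_both A B \<cdot> Rst X (cproj0 A B) = inj_both A B \<cdot> (Rst X (cproj0 A B) \<cdot> k)"
      using that by simp_all
    then show "inj_only0 A B \<cdot> Ide X M = inj_only0 A B \<cdot> k" "inj_both A B \<cdot> Ide X M = inj_both A B \<cdot> k"
      by (simp_all add: M_def)
  qed (use k in \<open>simp_all add: hom_iff M_def\<close>)
  then show "is_join X M M {only1 A B, Rst X (cproj0 A B)} (Ide X M)"
    by (auto simp: is_join_def restriction_le_def hom_iff M_def)
qed

text \<open>Where both components of \<open>k\<close> are defined, \<open>k\<close> takes values in the third summand, and there it is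
  given by the restriction pairing of the components.\<close>

lemma on_both:
  assumes k: "k \<in> hom X D (classical_prod A B)" and [simp]: "A \<in> Obj X" "B \<in> Obj X"
  shows "Rst X (k \<cdot> cproj0 A B) \<cdot> (Rst X (k \<cdot> cproj1 A B) \<cdot> k)
    = rpair (k \<cdot> cproj0 A B) (k \<cdot> cproj1 A B) \<cdot> inj_both A B"
proof -
  have [simp]: "k \<in> Arr X" "Dom X k = D" "Cod X k = classical_prod A B"
    using k by (auto simp: hom_iff)
  have [simp]: "D \<in> Obj X" using hom_Obj[OF k] by simp
  let ?q = "match (Z A (Prod S A B)) (Z B (Prod S A B)) (Ide X (Prod S A B))"
  have q: "Rst X (cproj0 A B) \<cdot> Rst X (cproj1 A B) = ?q \<cdot> inj_both A B"
    by (rule classical_prod_eqI[where A=A and B=B]) simp_all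
  have q0: "?q \<cdot> Proj0 S A B = Rst X (cproj1 A B) \<cdot> cproj0 A B"
    by (rule classical_prod_eqI[where A=A and B=B]) simp_all
  have q1: "?q \<cdot> Proj1 S A B = Rst X (cproj0 A B) \<cdot> cproj1 A B"
    by (rule classical_prod_eqI[where A=A and B=B]) simp_all
  have kq: "k \<cdot> ?q = rpair (k \<cdot> cproj0 A B) (k \<cdot> cproj1 A B)"
    by (rule rpair_eqI) (simp_all add: q0 q1 Comp_Rst_Comp)
  have "Rst X (k \<cdot> cproj0 A B) \<cdot> (Rst X (k \<cdot> cproj1 A B) \<cdot> k)
      = Rst X (k \<cdot> cproj0 A B) \<cdot> (k \<cdot> Rst X (cproj1 A B))"
    by (simp add: Comp_Rst[of k "cproj1 A B"])
  also have "\<dots> = k \<cdot> (Rst X (cproj0 A B) \<cdot> Rst X (cproj1 A B))"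
    by (rule Comp_Rst_Comp[symmetric]) simp_all
  also have "\<dots> = (k \<cdot> ?q) \<cdot> inj_both A B"
    unfolding q by simp
  finally show ?thesis unfolding kq .
qed

end

text \<open>Let \<open>c\<close> and \<open>c'\<close> be the complements of the domains of \<open>f\<close> and \<open>g\<close>. A map \<open>k\<close> with components \<open>f\<close>
  and \<open>g\<close> must be \<open>f\<close> in the first summand on \<open>c'\<close>, must be \<open>g\<close> in the second summand on \<open>c\<close>, and must
  be \<open>\<langle>f, g\<rangle>\<close> in the third summand on the intersection of the domains. These three cases
  cover \<open>D\<close>, which gives uniqueness, and gluing them gives existence.\<close>

theorem classical_products_if_classical:
  assumes "distributive_restriction_category X S" "classical_restriction_category X"
  shows "has_classical_products X S"
proof -
  interpret distributive_restriction_category X S by (rule assms)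
  interpret classical_restriction_category X by (rule assms)
  obtain Z where Z: "restriction_zeroes X Z"
    using relative_complements by blast
  interpret distributive_restriction_category_with_zeroes X S Z
    by standard (rule Z)
  have "is_product X A B (classical_prod A B) (cproj0 A B) (cproj1 A B)"
    if [simp]: "A \<in> Obj X" "B \<in> Obj X" for A B
  proof -
    let ?M = "classical_prod A B" and ?p = "cproj0 A B" and ?q = "cproj1 A B"
    have "\<exists>!h. h \<in> hom X D ?M \<and> h \<cdot>\<^bsub>X\<^esub> ?p = f \<and> h \<cdot>\<^bsub>X\<^esub> ?q = g"
      if f: "f \<in> hom X D A" and g: "g \<in> hom X D B" for f g D
    proof -
      have [simp]: "D \<in> Obj X" using hom_Obj[OF f] by simp
      have [simp]: "f \<in> Arr X" "Dom X f = D" "Cod X f = A" "g \<in> Arr X" "Dom X g = D" "Cod X g = B"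
        using f g by (auto simp: hom_iff)
      obtain c where c: "c \<in> hom X D D" "Rst X c = c" "c \<cdot>\<^bsub>X\<^esub> f = Z D A"
          "c \<cdot>\<^bsub>X\<^esub> Rst X f = Z D D" "Rst X f \<cdot>\<^bsub>X\<^esub> c = Z D D"
          "is_join X D D {c, Rst X f} (Ide X D)"
        using complement_exists[OF Z f] by blast
      obtain c' where c': "c' \<in> hom X D D" "Rst X c' = c'" "c' \<cdot>\<^bsub>X\<^esub> g = Z D B"
          "c' \<cdot>\<^bsub>X\<^esub> Rst X g = Z D D" "Rst X g \<cdot>\<^bsub>X\<^esub> c' = Z D D"
          "is_join X D D {c', Rst X g} (Ide X D)"
        using complement_exists[OF Z g] by blast
      have [simp]: "c \<in> Arr X" "Dom X c = D" "Cod X c = D" "c' \<in> Arr X" "Dom X c' = D" "Cod X c' = D"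
        using c(1) c'(1) by (auto simp: hom_iff)
      have Rhom: "Rst X f \<in> hom X D D" "Rst X g \<in> hom X D D" by (simp_all add: hom_iff)
      note eq_f = eq_on_cover[OF c(1,2) Rhom(1) _ c(6)]
        and eq_g = eq_on_cover[OF c'(1,2) Rhom(2) _ c'(6)]
      let ?both = "rpair f g \<cdot>\<^bsub>X\<^esub> inj_both A B" and ?l = "f \<cdot>\<^bsub>X\<^esub> inj_only0 A B"
        and ?r = "g \<cdot>\<^bsub>X\<^esub> inj_only1 A B"
      \<comment> \<open>First glue along the domain of \<open>g\<close>. The result \<open>w\<close> has the right components on the
        domain of \<open>f\<close>; outside it, \<open>h\<close> uses \<open>g\<close> alone.\<close>
      obtain w where w: "w \<in> hom X D ?M" "Rst X g \<cdot>\<^bsub>X\<^esub> w = Rst X g \<cdot>\<^bsub>X\<^esub> ?both"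
          "c' \<cdot>\<^bsub>X\<^esub> w = c' \<cdot>\<^bsub>X\<^esub> ?l"
        by (rule glue_on_cover[OF Z c'(1,2) Rhom(2) _ c'(6,4,5), of ?both ?M ?l])
          (simp_all add: hom_iff)
      obtain h where h: "h \<in> hom X D ?M" "Rst X f \<cdot>\<^bsub>X\<^esub> h = Rst X f \<cdot>\<^bsub>X\<^esub> w"
          "c \<cdot>\<^bsub>X\<^esub> h = c \<cdot>\<^bsub>X\<^esub> ?r"
        by (rule glue_on_cover[OF Z c(1,2) Rhom(1) _ c(6,4,5), of w ?M ?r])
          (use w in \<open>simp_all add: hom_iff\<close>)
      have [simp]: "w \<in> Arr X" "Dom X w = D" "Cod X w = ?M" "h \<in> Arr X" "Dom X h = D" "Cod X h = ?M"
        using w(1) h(1) by (auto simp: hom_iff)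
      have wp: "w \<cdot>\<^bsub>X\<^esub> ?p = f"
      proof (rule eq_g)
        show "c' \<cdot>\<^bsub>X\<^esub> (w \<cdot>\<^bsub>X\<^esub> ?p) = c' \<cdot>\<^bsub>X\<^esub> f"
          by (subst Comp_eq_Comp[OF w(3)]) simp_all
        show "Rst X g \<cdot>\<^bsub>X\<^esub> (w \<cdot>\<^bsub>X\<^esub> ?p) = Rst X g \<cdot>\<^bsub>X\<^esub> f"
          by (subst Comp_eq_Comp[OF w(2)]) simp_all
      qed (simp_all add: hom_iff)
      have wq: "w \<cdot>\<^bsub>X\<^esub> ?q = Rst X f \<cdot>\<^bsub>X\<^esub> g"
      proof (rule eq_g)
        have "c' \<cdot>\<^bsub>X\<^esub> (Rst X f \<cdot>\<^bsub>X\<^esub> g) = Rst X f \<cdot>\<^bsub>X\<^esub> (c' \<cdot>\<^bsub>X\<^esub> g)"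
          using Rst_commute_Comp[of c' f g] c'(2) by simp
        then show "c' \<cdot>\<^bsub>X\<^esub> (w \<cdot>\<^bsub>X\<^esub> ?q) = c' \<cdot>\<^bsub>X\<^esub> (Rst X f \<cdot>\<^bsub>X\<^esub> g)"
          by (subst Comp_eq_Comp[OF w(3)]) (simp_all add: c'(3))
        show "Rst X g \<cdot>\<^bsub>X\<^esub> (w \<cdot>\<^bsub>X\<^esub> ?q) = Rst X g \<cdot>\<^bsub>X\<^esub> (Rst X f \<cdot>\<^bsub>X\<^esub> g)"
          by (subst Comp_eq_Comp[OF w(2)]) simp_all
      qed (simp_all add: hom_iff)
      have hp: "h \<cdot>\<^bsub>X\<^esub> ?p = f"
      proof (rule eq_f)
        show "c \<cdot>\<^bsub>X\<^esub> (h \<cdot>\<^bsub>X\<^esub> ?p) = c \<cdot>\<^bsub>X\<^esub> f"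
          by (subst Comp_eq_Comp[OF h(3)]) (simp_all add: c(3))
        show "Rst X f \<cdot>\<^bsub>X\<^esub> (h \<cdot>\<^bsub>X\<^esub> ?p) = Rst X f \<cdot>\<^bsub>X\<^esub> f"
          by (subst Comp_eq_Comp[OF h(2)]) (simp_all add: wp)
      qed (simp_all add: hom_iff)
      have hq: "h \<cdot>\<^bsub>X\<^esub> ?q = g"
      proof (rule eq_f)
        show "c \<cdot>\<^bsub>X\<^esub> (h \<cdot>\<^bsub>X\<^esub> ?q) = c \<cdot>\<^bsub>X\<^esub> g"
          by (subst Comp_eq_Comp[OF h(3)]) simp_all
        show "Rst X f \<cdot>\<^bsub>X\<^esub> (h \<cdot>\<^bsub>X\<^esub> ?q) = Rst X f \<cdot>\<^bsub>X\<^esub> g"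
          by (subst Comp_eq_Comp[OF h(2)]) (simp_all add: wq)
      qed (simp_all add: hom_iff)
      \<comment> \<open>The three cases that determine a map with components \<open>f\<close> and \<open>g\<close>.\<close>
      have off_g: "c' \<cdot>\<^bsub>X\<^esub> k = c' \<cdot>\<^bsub>X\<^esub> ?l"
        and off_f: "c \<cdot>\<^bsub>X\<^esub> k = c \<cdot>\<^bsub>X\<^esub> ?r"
        and both: "Rst X f \<cdot>\<^bsub>X\<^esub> (Rst X g \<cdot>\<^bsub>X\<^esub> k) = ?both"
        if k: "k \<in> hom X D ?M" and kp: "k \<cdot>\<^bsub>X\<^esub> ?p = f" and kq: "k \<cdot>\<^bsub>X\<^esub> ?q = g" for k
      proof -
        have [simp]: "k \<in> Arr X" "Dom X k = D" "Cod X k = ?M" using k by (auto simp: hom_iff)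
        show "Rst X f \<cdot>\<^bsub>X\<^esub> (Rst X g \<cdot>\<^bsub>X\<^esub> k) = ?both"
          using on_both[OF k] kp kq by simp
        have "(c' \<cdot>\<^bsub>X\<^esub> k) \<cdot>\<^bsub>X\<^esub> Rst X ?q = Rst X (c' \<cdot>\<^bsub>X\<^esub> g) \<cdot>\<^bsub>X\<^esub> (c' \<cdot>\<^bsub>X\<^esub> k)"
          using Comp_Rst[of "c' \<cdot>\<^bsub>X\<^esub> k" ?q] by (simp add: kq)
        also have "\<dots> = Z D ?M" by (simp add: c'(3))
        finally have "(c' \<cdot>\<^bsub>X\<^esub> k) \<cdot>\<^bsub>X\<^esub> only0 A B = c' \<cdot>\<^bsub>X\<^esub> k"
          by (intro absorb_cover[OF Z _ _ _ _ join_only(1)]) (simp_all add: hom_iff)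
        then have "c' \<cdot>\<^bsub>X\<^esub> k = c' \<cdot>\<^bsub>X\<^esub> (k \<cdot>\<^bsub>X\<^esub> only0 A B)" by simp
        also have "\<dots> = (c' \<cdot>\<^bsub>X\<^esub> (k \<cdot>\<^bsub>X\<^esub> only0 A B)) \<cdot>\<^bsub>X\<^esub> (?p \<cdot>\<^bsub>X\<^esub> inj_only0 A B)"
          by (simp add: only_factor)
        also have "\<dots> = (c' \<cdot>\<^bsub>X\<^esub> k) \<cdot>\<^bsub>X\<^esub> (?p \<cdot>\<^bsub>X\<^esub> inj_only0 A B)"
          unfolding \<open>c' \<cdot>\<^bsub>X\<^esub> k = c' \<cdot>\<^bsub>X\<^esub> (k \<cdot>\<^bsub>X\<^esub> only0 A B)\<close>[symmetric] ..
        also have "\<dots> = c' \<cdot>\<^bsub>X\<^esub> ((k \<cdot>\<^bsub>X\<^esub> ?p) \<cdot>\<^bsub>X\<^esub> inj_only0 A B)" by simp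
        finally show "c' \<cdot>\<^bsub>X\<^esub> k = c' \<cdot>\<^bsub>X\<^esub> ?l" unfolding kp .
        have "(c \<cdot>\<^bsub>X\<^esub> k) \<cdot>\<^bsub>X\<^esub> Rst X ?p = Rst X (c \<cdot>\<^bsub>X\<^esub> f) \<cdot>\<^bsub>X\<^esub> (c \<cdot>\<^bsub>X\<^esub> k)"
          using Comp_Rst[of "c \<cdot>\<^bsub>X\<^esub> k" ?p] by (simp add: kp)
        also have "\<dots> = Z D ?M" by (simp add: c(3))
        finally have "(c \<cdot>\<^bsub>X\<^esub> k) \<cdot>\<^bsub>X\<^esub> only1 A B = c \<cdot>\<^bsub>X\<^esub> k"
          by (intro absorb_cover[OF Z _ _ _ _ join_only(2)]) (simp_all add: hom_iff)
        then have "c \<cdot>\<^bsub>X\<^esub> k = c \<cdot>\<^bsub>X\<^esub> (k \<cdot>\<^bsub>X\<^esub> only1 A B)" by simp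
        also have "\<dots> = (c \<cdot>\<^bsub>X\<^esub> (k \<cdot>\<^bsub>X\<^esub> only1 A B)) \<cdot>\<^bsub>X\<^esub> (?q \<cdot>\<^bsub>X\<^esub> inj_only1 A B)"
          by (simp add: only_factor)
        also have "\<dots> = (c \<cdot>\<^bsub>X\<^esub> k) \<cdot>\<^bsub>X\<^esub> (?q \<cdot>\<^bsub>X\<^esub> inj_only1 A B)"
          unfolding \<open>c \<cdot>\<^bsub>X\<^esub> k = c \<cdot>\<^bsub>X\<^esub> (k \<cdot>\<^bsub>X\<^esub> only1 A B)\<close>[symmetric] ..
        also have "\<dots> = c \<cdot>\<^bsub>X\<^esub> ((k \<cdot>\<^bsub>X\<^esub> ?q) \<cdot>\<^bsub>X\<^esub> inj_only1 A B)" by simp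
        finally show "c \<cdot>\<^bsub>X\<^esub> k = c \<cdot>\<^bsub>X\<^esub> ?r" unfolding kq .
      qed
      have "k = h" if k: "k \<in> hom X D ?M" "k \<cdot>\<^bsub>X\<^esub> ?p = f" "k \<cdot>\<^bsub>X\<^esub> ?q = g" for k
      proof (rule eq_g)
        have [simp]: "k \<in> Arr X" "Dom X k = D" "Cod X k = ?M" using k by (auto simp: hom_iff)
        show "c' \<cdot>\<^bsub>X\<^esub> k = c' \<cdot>\<^bsub>X\<^esub> h"
          unfolding off_g[OF k] off_g[OF h(1) hp hq] ..
        show "Rst X g \<cdot>\<^bsub>X\<^esub> k = Rst X g \<cdot>\<^bsub>X\<^esub> h"
        proof (rule eq_f)
          have "c \<cdot>\<^bsub>X\<^esub> (Rst X g \<cdot>\<^bsub>X\<^esub> k) = Rst X g \<cdot>\<^bsub>X\<^esub> (c \<cdot>\<^bsub>X\<^esub> k)"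
            "c \<cdot>\<^bsub>X\<^esub> (Rst X g \<cdot>\<^bsub>X\<^esub> h) = Rst X g \<cdot>\<^bsub>X\<^esub> (c \<cdot>\<^bsub>X\<^esub> h)"
            using Rst_commute_Comp[of c g k] Rst_commute_Comp[of c g h] c(2) by simp_all
          then show "c \<cdot>\<^bsub>X\<^esub> (Rst X g \<cdot>\<^bsub>X\<^esub> k) = c \<cdot>\<^bsub>X\<^esub> (Rst X g \<cdot>\<^bsub>X\<^esub> h)"
            unfolding off_f[OF k] off_f[OF h(1) hp hq] by simp
          show "Rst X f \<cdot>\<^bsub>X\<^esub> (Rst X g \<cdot>\<^bsub>X\<^esub> k) = Rst X f \<cdot>\<^bsub>X\<^esub> (Rst X g \<cdot>\<^bsub>X\<^esub> h)"
            unfolding both[OF k] both[OF h(1) hp hq] ..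
        qed (simp_all add: hom_iff)
      qed (use k h in simp_all)
      then show ?thesis using h(1) hp hq by blast
    qed
    moreover have "?M \<in> Obj X" "?p \<in> hom X ?M A" "?q \<in> hom X ?M B"
      by (simp_all add: hom_iff)
    ultimately show ?thesis unfolding is_product_def by blast
  qed
  then show ?thesis
    using Z unfolding has_classical_products_def cproj0_def cproj1_def by blast
qed

section \<open>Classifying maps from classical products\<close>

text \<open>The classical pairing \<open>h\<close> of \<open>f\<close> with the total map \<open>A \<longrightarrow> \<one>\<close> is total because its second component
  is, and it stays total when \<open>B \<oplus> (\<one> \<oplus> (B \<times> \<one>))\<close> is folded onto \<open>B \<oplus> \<one>\<close>. For uniqueness, the
  folding map has a section, along which every total \<open>t : A \<longrightarrow> B \<oplus> \<one>\<close> becomes a classical pairing of \<open>f\<close> with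
  a total map to \<open>\<one>\<close>; both pairings then agree.\<close>

theorem classified_if_classical_products:
  assumes "distributive_restriction_category X S" "has_classical_products X S"
  shows "classically_classified X S"
proof -
  interpret distributive_restriction_category X S by (rule assms)
  obtain Z where Z: "restriction_zeroes X Z"
    and prod: "\<And>A B. \<lbrakk>A \<in> Obj X; B \<in> Obj X\<rbrakk> \<Longrightarrow> is_product X A B
          (Coprod S A (Coprod S B (Prod S A B)))
          (copair X S (Ide X A) (copair X S (Z B A) (Proj0 S A B)))
          (copair X S (Z A B) (copair X S (Ide X B) (Proj1 S A B)))"
    using assms(2) unfolding has_classical_products_def by blast
  interpret distributive_restriction_category_with_zeroes X S Z
    by standard (rule Z)
  have "\<exists>!t. t \<in> hom X A (Coprod S B (Terminal S)) \<and> is_total X t \<and>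
      t \<cdot>\<^bsub>X\<^esub> copair X S (Ide X B) (Z (Terminal S) B) = f"
    if f: "f \<in> hom X A B" for A B f
  proof -
    let ?I = "Terminal S"
    let ?M = "classical_prod B ?I" and ?p = "cproj0 B ?I" and ?q = "cproj1 B ?I"
    let ?out = "copair X S (Ide X B) (Z ?I B)"
    have [simp]: "A \<in> Obj X" "B \<in> Obj X" using hom_Obj[OF f] by auto
    have [simp]: "f \<in> Arr X" "Dom X f = A" "Cod X f = B"
      using f by (auto simp: hom_iff)
    obtain s where s: "s \<in> hom X A ?I" "is_total X s"
      using total_to_Terminal[of A] by auto
    obtain r where r: "r \<in> hom X B ?I" "is_total X r"
      using total_to_Terminal[of B] by auto
    have [simp]: "s \<in> Arr X" "Dom X s = A" "Cod X s = ?I" "Rst X s = Ide X A"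
      "r \<in> Arr X" "Dom X r = B" "Cod X r = ?I" "Rst X r = Ide X B"
      using s r by (auto simp: hom_iff is_total_iff)
    have ex1: "\<exists>!h. h \<in> hom X A ?M \<and> h \<cdot>\<^bsub>X\<^esub> ?p = f \<and> h \<cdot>\<^bsub>X\<^esub> ?q = s"
      using prod[of B ?I] f s unfolding is_product_def cproj0_def cproj1_def by simp
    then obtain h where h: "h \<in> hom X A ?M" "h \<cdot>\<^bsub>X\<^esub> ?p = f" "h \<cdot>\<^bsub>X\<^esub> ?q = s"
      by blast
    have [simp]: "h \<in> Arr X" "Dom X h = A" "Cod X h = ?M" using h(1) by (auto simp: hom_iff)
    \<comment> \<open>The folding map and its section. The section sends \<open>B\<close> to the third summand, where both
      components are defined: the second component of a total map must be total.\<close>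
    let ?m = "match (Inj0 S B ?I) (Inj1 S B ?I) (Proj0 S B ?I \<cdot>\<^bsub>X\<^esub> Inj0 S B ?I)"
    let ?j = "copair X S (rpair (Ide X B) r \<cdot>\<^bsub>X\<^esub> inj_both B ?I) (inj_only1 B ?I)"
    have m_out: "?m \<cdot>\<^bsub>X\<^esub> ?out = ?p"
      by (rule classical_prod_eqI[where A=B and B="?I"]) simp_all
    have jm: "?j \<cdot>\<^bsub>X\<^esub> ?m = Ide X (Coprod S B ?I)"
      by (rule coproduct_eqI[where A=B and B="?I"]) simp_all
    have jp: "?j \<cdot>\<^bsub>X\<^esub> ?p = ?out"
      by (rule coproduct_eqI[where A=B and B="?I"]) simp_all
    have jq: "?j \<cdot>\<^bsub>X\<^esub> ?q = copair X S r (Ide X ?I)"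
      by (rule coproduct_eqI[where A=B and B="?I"]) simp_all
    have m: "is_total X ?m"
      unfolding match_def
      by (intro total_copair) (simp_all add: is_total_iff Rst_Comp_total)
    have h_total: "is_total X h"
      by (rule total_if_Comp_total[of h ?q]) (use h s in simp_all)
    show ?thesis
    proof (rule ex1I[of _ "h \<cdot>\<^bsub>X\<^esub> ?m"], intro conjI)
      show "h \<cdot>\<^bsub>X\<^esub> ?m \<in> hom X A (Coprod S B ?I)" by (simp add: hom_iff)
      show "is_total X (h \<cdot>\<^bsub>X\<^esub> ?m)" by (rule total_Comp[OF h_total m]) simp
      show "(h \<cdot>\<^bsub>X\<^esub> ?m) \<cdot>\<^bsub>X\<^esub> ?out = f" using h by (simp add: m_out)
    next
      fix t assume "t \<in> hom X A (Coprod S B ?I) \<and> is_total X t \<and> t \<cdot>\<^bsub>X\<^esub> ?out = f"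
      then have t: "t \<in> hom X A (Coprod S B ?I)" "is_total X t" "t \<cdot>\<^bsub>X\<^esub> ?out = f" by auto
      have [simp]: "t \<in> Arr X" "Dom X t = A" "Cod X t = Coprod S B ?I"
        using t(1) by (auto simp: hom_iff)
      have "is_total X (copair X S r (Ide X ?I))"
        by (intro total_copair) (simp_all add: r total_Ide)
      then have "is_total X (t \<cdot>\<^bsub>X\<^esub> copair X S r (Ide X ?I))"
        by (intro total_Comp) (simp_all add: t)
      then have "t \<cdot>\<^bsub>X\<^esub> copair X S r (Ide X ?I) = s"
        using s by (intro total_to_Terminal_unique[of _ A s]) (simp_all add: hom_iff)
      then have "(t \<cdot>\<^bsub>X\<^esub> ?j) \<cdot>\<^bsub>X\<^esub> ?q = s"
        using Comp_assoc_simp[of t ?j ?q] unfolding jq by simp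
      moreover have "(t \<cdot>\<^bsub>X\<^esub> ?j) \<cdot>\<^bsub>X\<^esub> ?p = f"
        using Comp_assoc_simp[of t ?j ?p] t(3) unfolding jp by simp
      moreover have "t \<cdot>\<^bsub>X\<^esub> ?j \<in> hom X A ?M" by (simp add: hom_iff)
      ultimately have "t \<cdot>\<^bsub>X\<^esub> ?j = h"
        using ex1 h by blast
      then have "h \<cdot>\<^bsub>X\<^esub> ?m = (t \<cdot>\<^bsub>X\<^esub> ?j) \<cdot>\<^bsub>X\<^esub> ?m" by simp
      also have "\<dots> = t \<cdot>\<^bsub>X\<^esub> (?j \<cdot>\<^bsub>X\<^esub> ?m)"
        by (rule Comp_assoc_simp) simp_all
      finally show "t = h \<cdot>\<^bsub>X\<^esub> ?m" unfolding jm by simp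
    qed
  qed
  then show ?thesis using Z unfolding classically_classified_def by blast
qed

section \<open>The distributive category of total maps\<close>

definition total_maps :: "('o, 'a, 'm) rcategory_scheme \<Rightarrow> ('o, 'a) category" where
  "total_maps X = \<lparr>Obj = Obj X, Arr = {f. is_total X f}, Dom = Dom X, Cod = Cod X,
    Ide = Ide X, Comp = Comp X\<rparr>"

lemma total_maps_simps:
  "Obj (total_maps X) = Obj X" "Arr (total_maps X) = {f. is_total X f}"
  "Dom (total_maps X) = Dom X" "Cod (total_maps X) = Cod X"
  "Ide (total_maps X) = Ide X" "Comp (total_maps X) = Comp X"
  by (simp_all add: total_maps_def)

lemma hom_total_maps: "f \<in> hom (total_maps X) A B \<longleftrightarrow> f \<in> hom X A B \<and> is_total X f"
  by (auto simp: hom_iff total_maps_simps is_total_def)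

context restriction_category
begin

lemma category_total_maps: "category (total_maps X)"
proof
  fix A assume "A \<in> Obj (total_maps X)"
  then show "Ide (total_maps X) A \<in> hom (total_maps X) A A"
    unfolding hom_total_maps total_maps_simps by (simp add: Ide_hom total_Ide)
next
  fix f g A B D assume "f \<in> hom (total_maps X) A B" "g \<in> hom (total_maps X) B D"
  then show "f \<cdot>\<^bsub>total_maps X\<^esub> g \<in> hom (total_maps X) A D"
    unfolding hom_total_maps total_maps_simps
    by (auto simp: hom_iff intro: total_Comp)
qed (auto simp: hom_total_maps total_maps_simps hom_iff is_total_iff)

text \<open>Isomorphisms are total, so the canonical maps stay invertible.\<close>

lemma iso_total_maps:
  assumes "is_iso X f"
  shows "is_iso (total_maps X) f" "inv_arrow (total_maps X) f = inv_arrow X f"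
proof -
  interpret T: category "total_maps X" by (rule category_total_maps)
  note f = inv_arrow_simps[OF assms]
  have "inverse_arrows X (inv_arrow X f) f"
    using f by (simp add: inverse_arrows_def hom_iff)
  then have "is_iso X (inv_arrow X f)"
    unfolding is_iso_def by blast
  then have "is_total X (inv_arrow X f)"
    by (rule total_iso)
  then have "inverse_arrows (total_maps X) f (inv_arrow X f)"
    using f total_iso[OF assms]
    by (simp add: inverse_arrows_def hom_total_maps total_maps_simps hom_iff)
  then show "is_iso (total_maps X) f" "inv_arrow (total_maps X) f = inv_arrow X f"
    by (auto simp: is_iso_def T.inv_arrow_eq)
qed

end

context distributive_restriction_category
begin

lemma finite_coproducts_total_maps: "finite_coproducts (total_maps X) S"
  unfolding finite_coproducts_def
proof (intro conjI ballI)
  have "is_total X z" if z: "z \<in> hom X (Initial S) A" for z A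
  proof -
    have "Rst X z \<in> hom X (Initial S) (Initial S)" using Rst_hom[OF z] .
    then have "Rst X z = Ide X (Initial S)"
      by (rule Initial_eqI) (simp add: hom_iff)
    then show ?thesis using z by (simp add: is_total_iff hom_iff)
  qed
  then show "is_initial (total_maps X) (Initial S)"
    using from_initial_hom Initial_eqI Initial_Obj
    unfolding is_initial_def hom_total_maps total_maps_simps by metis
next
  fix A B assume "A \<in> Obj (total_maps X)" "B \<in> Obj (total_maps X)"
  then have [simp]: "A \<in> Obj X" "B \<in> Obj X" by (simp_all add: total_maps_simps)
  have "\<exists>!h. h \<in> hom (total_maps X) (Coprod S A B) D \<and>
      Inj0 S A B \<cdot>\<^bsub>total_maps X\<^esub> h = f \<and> Inj1 S A B \<cdot>\<^bsub>total_maps X\<^esub> h = g"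
    if f: "f \<in> hom (total_maps X) A D" and g: "g \<in> hom (total_maps X) B D" for f g D
  proof -
    have fg: "f \<in> hom X A D" "is_total X f" "g \<in> hom X B D" "is_total X g"
      using f g by (simp_all add: hom_total_maps)
    then have "\<exists>!h. h \<in> hom X (Coprod S A B) D \<and> Inj0 S A B \<cdot> h = f \<and> Inj1 S A B \<cdot> h = g"
      using copair_ex1 by blast
    moreover have "copair X S f g \<in> hom X (Coprod S A B) D"
      "Inj0 S A B \<cdot> copair X S f g = f" "Inj1 S A B \<cdot> copair X S f g = g"
      "is_total X (copair X S f g)"
      using fg by (simp_all add: hom_iff total_copair)
    ultimately show ?thesis
      unfolding hom_total_maps total_maps_simps by blast
  qed
  moreover have "Coprod S A B \<in> Obj (total_maps X)"
    "Inj0 S A B \<in> hom (total_maps X) A (Coprod S A B)"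
    "Inj1 S A B \<in> hom (total_maps X) B (Coprod S A B)"
    unfolding hom_total_maps total_maps_simps by (simp_all add: hom_iff total_Inj0 total_Inj1)
  ultimately show "is_coproduct (total_maps X) A B (Coprod S A B) (Inj0 S A B) (Inj1 S A B)"
    unfolding is_coproduct_def by blast
qed

lemma finite_products_total_maps: "finite_products (total_maps X) S"
  unfolding finite_products_def
proof (intro conjI ballI)
  show "is_terminal (total_maps X) (Terminal S)"
    using restriction_terminal
    unfolding restriction_terminal_def is_terminal_def hom_total_maps total_maps_simps by blast
next
  fix A B assume "A \<in> Obj (total_maps X)" "B \<in> Obj (total_maps X)"
  then have [simp]: "A \<in> Obj X" "B \<in> Obj X" by (simp_all add: total_maps_simps)
  have "\<exists>!h. h \<in> hom (total_maps X) D (Prod S A B) \<and>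
      h \<cdot>\<^bsub>total_maps X\<^esub> Proj0 S A B = f \<and> h \<cdot>\<^bsub>total_maps X\<^esub> Proj1 S A B = g"
    if f: "f \<in> hom (total_maps X) D A" and g: "g \<in> hom (total_maps X) D B" for f g D
  proof -
    have fg: "f \<in> hom X D A" "is_total X f" "g \<in> hom X D B" "is_total X g"
      using f g by (simp_all add: hom_total_maps)
    have R: "Rst X g \<cdot> f = f" "Rst X f \<cdot> g = g"
      using fg by (simp_all add: is_total_iff hom_iff)
    have "\<exists>!h. h \<in> hom X D (Prod S A B) \<and> h \<cdot> Proj0 S A B = f \<and> h \<cdot> Proj1 S A B = g"
      using rpair_ex1[OF fg(1,3)] unfolding R .
    moreover have "rpair f g \<in> hom X D (Prod S A B)"
      "rpair f g \<cdot> Proj0 S A B = f" "rpair f g \<cdot> Proj1 S A B = g" "is_total X (rpair f g)"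
      using fg R by (simp_all add: hom_iff total_rpair)
    ultimately show ?thesis
      unfolding hom_total_maps total_maps_simps by blast
  qed
  moreover have "Prod S A B \<in> Obj (total_maps X)"
    "Proj0 S A B \<in> hom (total_maps X) (Prod S A B) A"
    "Proj1 S A B \<in> hom (total_maps X) (Prod S A B) B"
    unfolding hom_total_maps total_maps_simps by (simp_all add: hom_iff is_total_iff)
  ultimately show "is_product (total_maps X) A B (Prod S A B) (Proj0 S A B) (Proj1 S A B)"
    unfolding is_product_def by blast
qed

text \<open>The operations of the category of total maps are those of the restriction category: this is needed
  because the Kleisli category is formed with the former.\<close>

lemma copair_total_maps:
  assumes "is_total X f" "is_total X g" "Cod X f = Cod X g"
  shows "copair (total_maps X) S f g = copair X S f g"
proof -
  interpret T: category_with_coproducts "total_maps X" S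
    by (rule category_with_coproducts.intro[OF category_total_maps])
      (standard, rule finite_coproducts_total_maps)
  have "f \<in> Arr X" "g \<in> Arr X"
    using assms by (simp_all add: is_total_iff)
  then show ?thesis
    by (intro T.copair_eqI[of f g "copair X S f g", unfolded total_maps_simps])
      (simp_all add: assms total_copair)
qed

lemma pair_total_maps:
  assumes "is_total X f" "is_total X g" "Dom X f = Dom X g"
  shows "pair (total_maps X) S f g = rpair f g"
proof -
  have fg: "f \<in> Arr X" "g \<in> Arr X"
    using assms by (simp_all add: is_total_iff)
  have R: "Rst X g \<cdot> f = f" "Rst X f \<cdot> g = g"
    using assms by (simp_all add: is_total_iff)
  have "h = rpair f g" if h: "h \<in> hom X (Dom X f) (Prod S (Cod X f) (Cod X g))"
    "h \<cdot> Proj0 S (Cod X f) (Cod X g) = f" "h \<cdot> Proj1 S (Cod X f) (Cod X g) = g" for h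
  proof (rule rpair_eqI)
    show "h \<cdot> Proj0 S (Cod X f) (Cod X g) = Rst X g \<cdot> f" unfolding R by (rule h(2))
    show "h \<cdot> Proj1 S (Cod X f) (Cod X g) = Rst X f \<cdot> g" unfolding R by (rule h(3))
  qed (use fg h(1) assms(3) in \<open>simp_all add: hom_iff\<close>)
  moreover have "rpair f g \<in> hom X (Dom X f) (Prod S (Cod X f) (Cod X g))"
    "rpair f g \<cdot> Proj0 S (Cod X f) (Cod X g) = f" "rpair f g \<cdot> Proj1 S (Cod X f) (Cod X g) = g"
    using rpair_props[of f g, unfolded R] fg assms(3) by simp_all
  ultimately show ?thesis
    using total_rpair[OF assms]
    unfolding pair_def hom_total_maps total_maps_simps by (intro the_equality) blast+
qed

lemma total_Proj:
  assumes "A \<in> Obj X" "B \<in> Obj X"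
  shows "is_total X (Proj0 S A B)" "is_total X (Proj1 S A B)"
  using assms by (simp_all add: is_total_iff)

lemma distributor_total_maps:
  assumes "A \<in> Obj X" "B \<in> Obj X" "B' \<in> Obj X"
  shows "distributor (total_maps X) S (pair (total_maps X) S) A B B' = distributor X S rpair A B B'"
proof -
  note [simp] = assms total_Proj total_Inj0 total_Inj1 total_Comp total_rpair
  show ?thesis
    by (simp add: distributor_def total_maps_simps pair_total_maps copair_total_maps)
qed

lemma annihilator_total_maps:
  assumes "A \<in> Obj X"
  shows "annihilator (total_maps X) S (pair (total_maps X) S) A = annihilator X S rpair A"
proof -
  interpret T: category_with_coproducts "total_maps X" S
    by (rule category_with_coproducts.intro[OF category_total_maps])
      (standard, rule finite_coproducts_total_maps)
  have "from_initial (total_maps X) S A \<in> hom (total_maps X) (Initial S) A"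
    by (rule T.from_initial_hom) (simp add: total_maps_simps assms)
  then have z: "is_total X (from_initial (total_maps X) S A)"
      "from_initial (total_maps X) S A \<in> hom X (Initial S) A"
    by (simp_all add: hom_total_maps)
  have "from_initial (total_maps X) S A = from_initial X S A"
    by (rule Initial_eqI[OF z(2) from_initial_hom[OF assms]])
  then show ?thesis
    using z by (simp add: annihilator_def total_maps_simps pair_total_maps total_Ide hom_iff)
qed

theorem distributive_category_total_maps: "distributive_category (total_maps X) S"
proof -
  interpret T: category "total_maps X" by (rule category_total_maps)
  show ?thesis
  proof
    show "finite_products (total_maps X) S" by (rule finite_products_total_maps)
    show "finite_coproducts (total_maps X) S" by (rule finite_coproducts_total_maps)
  next
    fix A B B' assume "A \<in> Obj (total_maps X)" "B \<in> Obj (total_maps X)" "B' \<in> Obj (total_maps X)"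
    then have "A \<in> Obj X" "B \<in> Obj X" "B' \<in> Obj X" by (simp_all add: total_maps_simps)
    then show "is_iso (total_maps X) (distributor (total_maps X) S (pair (total_maps X) S) A B B')"
      using iso_total_maps(1)[OF distributor_iso] by (simp add: distributor_total_maps)
  next
    fix A assume "A \<in> Obj (total_maps X)"
    then have "A \<in> Obj X" by (simp add: total_maps_simps)
    then show "is_iso (total_maps X) (annihilator (total_maps X) S (pair (total_maps X) S) A)"
      using iso_total_maps(1)[OF annihilator_iso] by (simp add: annihilator_total_maps)
  qed
qed

end

section \<open>Classification identifies a category with a Kleisli category\<close>

locale classified_restriction_category = distributive_restriction_category_with_zeroes X S Z
  for X :: "('o, 'a, 'm) rcategory_scheme" (structure)
    and S :: "('o, 'a) prod_coprod" and Z :: "'o \<Rightarrow> 'o \<Rightarrow> 'a" +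
  assumes classified: "f \<in> hom X A B \<Longrightarrow>
    \<exists>!t. t \<in> hom X A (Coprod S B (Terminal S)) \<and> is_total X t \<and>
      t \<cdot> copair X S (Ide X B) (Z (Terminal S) B) = f"
begin

text \<open>The partial inverse \<open>[1, 0]\<close> of \<open>\<iota>\<^sub>0 : B \<longrightarrow> B \<oplus> \<one>\<close>.\<close>

definition defined_part where "defined_part B = copair X S (Ide X B) (Z (Terminal S) B)"

definition classifier where "classifier f = (THE t.
  t \<in> hom X (Dom X f) (Coprod S (Cod X f) (Terminal S)) \<and> is_total X t \<and>
  t \<cdot> defined_part (Cod X f) = f)"

lemma defined_part_simps [simp]:
  assumes "B \<in> Obj X"
  shows "defined_part B \<in> Arr X" "Dom X (defined_part B) = Coprod S B (Terminal S)"
    "Cod X (defined_part B) = B"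
    "Inj0 S B (Terminal S) \<cdot> defined_part B = Ide X B"
    "Inj1 S B (Terminal S) \<cdot> defined_part B = Z (Terminal S) B"
  using assms by (simp_all add: defined_part_def)

lemma classifier_ex1:
  assumes "f \<in> Arr X"
  shows "\<exists>!t. t \<in> hom X (Dom X f) (Coprod S (Cod X f) (Terminal S)) \<and> is_total X t \<and>
    t \<cdot> defined_part (Cod X f) = f"
  unfolding defined_part_def by (rule classified) (use assms in \<open>simp add: hom_iff\<close>)

lemma classifier_simps [simp]:
  assumes "f \<in> Arr X"
  shows "classifier f \<in> Arr X" "Dom X (classifier f) = Dom X f"
    "Cod X (classifier f) = Coprod S (Cod X f) (Terminal S)"
    "is_total X (classifier f)" "Rst X (classifier f) = Ide X (Dom X f)"
  using theI'[OF classifier_ex1[OF assms]]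
  unfolding classifier_def[symmetric] by (simp_all add: hom_iff is_total_iff)

lemma classifier_defined_part:
  assumes "f \<in> Arr X" "Cod X f = B"
  shows "classifier f \<cdot> defined_part B = f"
  using theI'[OF classifier_ex1[OF assms(1)]] assms(2)
  unfolding classifier_def[symmetric] by simp

lemma classifier_defined_part_Comp:
  assumes "f \<in> Arr X" "Cod X f = B" "g \<in> Arr X" "Dom X g = B"
  shows "classifier f \<cdot> (defined_part B \<cdot> g) = f \<cdot> g"
proof -
  have "B \<in> Obj X" using assms by auto
  then have "(classifier f \<cdot> defined_part B) \<cdot> g = classifier f \<cdot> (defined_part B \<cdot> g)"
    by (intro Comp_assoc_simp) (use assms in simp_all)
  then show ?thesis using classifier_defined_part[OF assms(1,2)] by simp
qed

lemma classifier_eqI: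
  assumes "is_total X t" "Cod X t = Coprod S B (Terminal S)" "B \<in> Obj X"
    and "t \<cdot> defined_part B = f"
  shows "classifier f = t"
proof -
  have f: "f \<in> Arr X" "Dom X f = Dom X t" "Cod X f = B"
    using assms by (auto simp: is_total_iff)
  have "t \<in> hom X (Dom X f) (Coprod S (Cod X f) (Terminal S))"
    using assms f by (simp add: hom_iff is_total_iff)
  then show ?thesis
    using the1_equality[OF classifier_ex1[OF f(1)], of t] assms f
    unfolding classifier_def by simp
qed

lemma classifier_Ide:
  assumes "A \<in> Obj X"
  shows "classifier (Ide X A) = Inj0 S A (Terminal S)"
  by (rule classifier_eqI[where B=A]) (use assms total_Inj0 in simp_all)

lemma classifier_Comp:
  assumes "f \<in> Arr X" "g \<in> Arr X" "Cod X f = Dom X g" "Cod X g = B"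
  shows "classifier (f \<cdot> g) = classifier f \<cdot> copair X S (classifier g) (Inj1 S B (Terminal S))"
proof (rule classifier_eqI[where B=B])
  have [simp]: "B \<in> Obj X" using assms by auto
  let ?c = "copair X S (classifier g) (Inj1 S B (Terminal S))"
  show "is_total X (classifier f \<cdot> ?c)"
    by (intro total_Comp total_copair) (use assms total_Inj1 in simp_all)
  have "?c \<cdot> defined_part B = defined_part (Dom X g) \<cdot> g"
    by (rule coproduct_eqI[where A="Dom X g" and B="Terminal S"])
      (use assms in \<open>simp_all add: classifier_defined_part flip: Comp_assoc_simp\<close>)
  then show "(classifier f \<cdot> ?c) \<cdot> defined_part B = f \<cdot> g"
    using assms by (simp add: classifier_defined_part_Comp)
qed (use assms in auto)

text \<open>The right-hand side is the restriction of the Kleisli map \<open>classifier f\<close>. It is total, so only its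
  composite with \<open>defined_part A\<close> has to be computed.\<close>

lemma classifier_Rst:
  assumes "f \<in> Arr X" "Dom X f = A" "Cod X f = B"
  shows "classifier (Rst X f) = rpair (Ide X A) (classifier f) \<cdot>
    (inv_arrow X (distributor X S rpair A B (Terminal S)) \<cdot>
      copair X S (Proj0 S A B \<cdot> Inj0 S A (Terminal S))
        (Proj1 S A (Terminal S) \<cdot> Inj1 S A (Terminal S)))"
proof (rule classifier_eqI[where B=A])
  let ?I = "Terminal S"
  have [simp]: "A \<in> Obj X" "B \<in> Obj X" using assms by auto
  let ?d = "distributor X S rpair A B ?I"
  let ?k = "copair X S (Proj0 S A B \<cdot> Inj0 S A ?I) (Proj1 S A ?I \<cdot> Inj1 S A ?I)"
  let ?P = "Prod S A (Coprod S B ?I)"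
  have iso: "is_iso X ?d" by (rule distributor_iso) simp_all
  have d: "?d \<in> Arr X" "Dom X ?d = Coprod S (Prod S A B) (Prod S A ?I)" "Cod X ?d = ?P"
    by (simp_all add: distributor_def)
  note i = inv_arrow_simps[OF iso, unfolded d]
  have "inverse_arrows X (inv_arrow X ?d) ?d"
    using i by (simp add: inverse_arrows_def hom_iff d)
  then have "is_iso X (inv_arrow X ?d)"
    unfolding is_iso_def by blast
  then have i_total: "is_total X (inv_arrow X ?d)"
    by (rule total_iso)
  show "is_total X (rpair (Ide X A) (classifier f) \<cdot> (inv_arrow X ?d \<cdot> ?k))"
    by (intro total_Comp total_rpair total_copair i_total)
      (use assms i in \<open>simp_all add: total_Ide total_Proj total_Inj0 total_Inj1\<close>)
  show "Cod X (rpair (Ide X A) (classifier f) \<cdot> (inv_arrow X ?d \<cdot> ?k)) = Coprod S A ?I"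
    using assms i by simp
  \<comment> \<open>The first projection restricted to the pairs whose second component lies in \<open>B\<close>. Through
    the distributor it becomes \<open>[\<pi>\<^sub>0, 0]\<close>.\<close>
  let ?e = "Rst X (Proj1 S A (Coprod S B ?I) \<cdot> defined_part B) \<cdot> Proj0 S A (Coprod S B ?I)"
  have e: "?d \<cdot> ?e = ?k \<cdot> defined_part A"
    by (rule coproduct_eqI[where A="Prod S A B" and B="Prod S A ?I"])
      (simp_all add: distributor_def Comp_Rst_Comp Rst_Comp_total total_Inj0)
  have "inv_arrow X ?d \<cdot> (?k \<cdot> defined_part A) = inv_arrow X ?d \<cdot> (?d \<cdot> ?e)"
    unfolding e ..
  also have "\<dots> = (inv_arrow X ?d \<cdot> ?d) \<cdot> ?e"
    by (rule Comp_assoc_simp[symmetric]) (use i d in simp_all)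
  also have "\<dots> = ?e" unfolding i by simp
  finally have "rpair (Ide X A) (classifier f) \<cdot> (inv_arrow X ?d \<cdot> (?k \<cdot> defined_part A))
      = rpair (Ide X A) (classifier f) \<cdot> ?e" by simp
  also have "\<dots> = Rst X f"
    using assms by (simp add: Comp_Rst_Comp classifier_defined_part)
  finally show "(rpair (Ide X A) (classifier f) \<cdot> (inv_arrow X ?d \<cdot> ?k)) \<cdot> defined_part A = Rst X f"
    using assms i by simp
qed (use assms in auto)

end

text \<open>The axioms of a restriction category are transported to \<open>Y\<close> along with the equivalence, so that
  they need not be checked for \<open>Y\<close> separately.\<close>

lemma restriction_equivalent_if_isomorphic:
  assumes X: "restriction_category X"
    and Obj: "Obj Y = Obj X"
    and bij: "bij_betw F (Arr X) (Arr Y)"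
    and Dom: "\<And>f. f \<in> Arr X \<Longrightarrow> Dom Y (F f) = Dom X f"
    and Cod: "\<And>f. f \<in> Arr X \<Longrightarrow> Cod Y (F f) = Cod X f"
    and Ide: "\<And>A. A \<in> Obj X \<Longrightarrow> F (Ide X A) = Ide Y A"
    and Comp: "\<And>f g. \<lbrakk>f \<in> Arr X; g \<in> Arr X; Cod X f = Dom X g\<rbrakk>
      \<Longrightarrow> F (f \<cdot>\<^bsub>X\<^esub> g) = F f \<cdot>\<^bsub>Y\<^esub> F g"
    and Rst: "\<And>f. f \<in> Arr X \<Longrightarrow> F (Rst X f) = Rst Y (F f)"
  shows "restriction_equivalent X Y"
proof -
  interpret X: restriction_category X by (rule X)
  have F_hom: "F f \<in> hom Y A B" if "f \<in> hom X A B" for f A B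
    using that Dom Cod bij by (auto simp: hom_iff bij_betw_def)
  have Y_hom: "\<exists>f \<in> hom X A B. F f = g" if "g \<in> hom Y A B" for g A B
  proof -
    have "g \<in> F ` Arr X"
      using that bij by (simp add: bij_betw_def hom_iff)
    then obtain f where "f \<in> Arr X" "F f = g" by blast
    then show ?thesis using that Dom Cod by (auto simp: hom_iff)
  qed
  have FC: "F f \<cdot>\<^bsub>Y\<^esub> F g = F (f \<cdot>\<^bsub>X\<^esub> g)" if "f \<in> hom X A B" "g \<in> hom X B D" for f g A B D
    using that Comp by (simp add: hom_iff)
  have FR: "Rst Y (F f) = F (Rst X f)" if "f \<in> hom X A B" for f A B
    using that Rst by (simp add: hom_iff)
  have Y: "restriction_category Y"
  proof
    fix f assume "f \<in> Arr Y"
    then have "f \<in> hom Y (Dom Y f) (Cod Y f)" by (simp add: hom_iff)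
    then obtain f' where "f' \<in> hom X (Dom Y f) (Cod Y f)" using Y_hom by blast
    then show "Dom Y f \<in> Obj Y" "Cod Y f \<in> Obj Y"
      using X.hom_Obj Obj by auto
  next
    fix A assume "A \<in> Obj Y"
    then show "Ide Y A \<in> hom Y A A"
      using F_hom[OF X.Ide_hom] Ide Obj by simp
  next
    fix f g A B D assume fg: "f \<in> hom Y A B" "g \<in> hom Y B D"
    obtain f' g' where f': "f' \<in> hom X A B" "F f' = f" and g': "g' \<in> hom X B D" "F g' = g"
      using Y_hom[OF fg(1)] Y_hom[OF fg(2)] by blast
    show "f \<cdot>\<^bsub>Y\<^esub> g \<in> hom Y A D"
      using FC[OF f'(1) g'(1)] F_hom[OF X.Comp_hom[OF f'(1) g'(1)]] f' g' by simp
    show "f \<cdot>\<^bsub>Y\<^esub> Rst Y g = Rst Y (f \<cdot>\<^bsub>Y\<^esub> g) \<cdot>\<^bsub>Y\<^esub> f"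
      unfolding f'(2)[symmetric] g'(2)[symmetric] FC[OF f'(1) g'(1)] FR[OF g'(1)]
        FR[OF X.Comp_hom[OF f'(1) g'(1)]] FC[OF f'(1) X.Rst_hom[OF g'(1)]]
        FC[OF X.Rst_hom[OF X.Comp_hom[OF f'(1) g'(1)]] f'(1)] X.R4[OF f'(1) g'(1)] ..
  next
    fix f A B assume f: "f \<in> hom Y A B"
    obtain f' where f': "f' \<in> hom X A B" "F f' = f" using Y_hom[OF f] by blast
    have AB: "A \<in> Obj X" "B \<in> Obj X" using X.hom_Obj[OF f'(1)] by auto
    show "Ide Y A \<cdot>\<^bsub>Y\<^esub> f = f" "f \<cdot>\<^bsub>Y\<^esub> Ide Y B = f"
      unfolding f'(2)[symmetric] Ide[OF AB(1), symmetric] Ide[OF AB(2), symmetric]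
        FC[OF X.Ide_hom[OF AB(1)] f'(1)] FC[OF f'(1) X.Ide_hom[OF AB(2)]]
        X.Ide_Comp[OF f'(1)] X.Comp_Ide[OF f'(1)] by (rule refl)+
    show "Rst Y f \<in> hom Y A A"
      unfolding f'(2)[symmetric] FR[OF f'(1)] by (rule F_hom[OF X.Rst_hom[OF f'(1)]])
    show "Rst Y f \<cdot>\<^bsub>Y\<^esub> f = f"
      unfolding f'(2)[symmetric] FR[OF f'(1)] FC[OF X.Rst_hom[OF f'(1)] f'(1)] X.R1[OF f'(1)] ..
  next
    fix f g h A B D E assume fgh: "f \<in> hom Y A B" "g \<in> hom Y B D" "h \<in> hom Y D E"
    obtain f' g' h' where f': "f' \<in> hom X A B" "F f' = f" and g': "g' \<in> hom X B D" "F g' = g"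
      and h': "h' \<in> hom X D E" "F h' = h"
      using Y_hom[OF fgh(1)] Y_hom[OF fgh(2)] Y_hom[OF fgh(3)] by blast
    show "(f \<cdot>\<^bsub>Y\<^esub> g) \<cdot>\<^bsub>Y\<^esub> h = f \<cdot>\<^bsub>Y\<^esub> (g \<cdot>\<^bsub>Y\<^esub> h)"
      unfolding f'(2)[symmetric] g'(2)[symmetric] h'(2)[symmetric]
        FC[OF f'(1) g'(1)] FC[OF g'(1) h'(1)] FC[OF X.Comp_hom[OF f'(1) g'(1)] h'(1)]
        FC[OF f'(1) X.Comp_hom[OF g'(1) h'(1)]] X.Comp_assoc[OF f'(1) g'(1) h'(1)] ..
  next
    fix f g A B D assume fg: "f \<in> hom Y A B" "g \<in> hom Y A D"
    obtain f' g' where f': "f' \<in> hom X A B" "F f' = f" and g': "g' \<in> hom X A D" "F g' = g"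
      using Y_hom[OF fg(1)] Y_hom[OF fg(2)] by blast
    note R = X.Rst_hom[OF f'(1)] X.Rst_hom[OF g'(1)]
    show "Rst Y f \<cdot>\<^bsub>Y\<^esub> Rst Y g = Rst Y g \<cdot>\<^bsub>Y\<^esub> Rst Y f"
      unfolding f'(2)[symmetric] g'(2)[symmetric] FR[OF f'(1)] FR[OF g'(1)]
        FC[OF R(1,2)] FC[OF R(2,1)] X.R2[OF f'(1) g'(1)] ..
    show "Rst Y (Rst Y g \<cdot>\<^bsub>Y\<^esub> f) = Rst Y g \<cdot>\<^bsub>Y\<^esub> Rst Y f"
      unfolding f'(2)[symmetric] g'(2)[symmetric] FR[OF f'(1)] FR[OF g'(1)]
        FC[OF R(2) f'(1)] FC[OF R(2,1)] FR[OF X.Comp_hom[OF R(2) f'(1)]] X.R3[OF f'(1) g'(1)] ..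
  qed
  interpret Y: restriction_category Y by (rule Y)
  define G where "G = inv_into (Arr X) F"
  have GF: "G (F f) = f" if "f \<in> Arr X" for f
    using bij that by (auto simp: G_def bij_betw_def)
  have FG: "F (G g) = g" "G g \<in> Arr X" if "g \<in> Arr Y" for g
    using bij that f_inv_into_f[of g F "Arr X"] inv_into_into[of g F "Arr X"]
    by (auto simp: G_def bij_betw_def)
  have G_hom: "G g \<in> hom X A B" if "g \<in> hom Y A B" for g A B
    using Y_hom[OF that] GF by (auto simp: hom_iff)
  have F_functor: "is_restriction_functor X Y (\<lambda>A. A) F"
    unfolding is_restriction_functor_def is_functor_def
    using Obj Ide F_hom FC Rst by auto
  have "G (f \<cdot>\<^bsub>Y\<^esub> g) = G f \<cdot>\<^bsub>X\<^esub> G g" if fg: "f \<in> hom Y A B" "g \<in> hom Y B D" for f g A B D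
  proof -
    have "f \<cdot>\<^bsub>Y\<^esub> g = F (G f \<cdot>\<^bsub>X\<^esub> G g)"
      using FC[OF G_hom[OF fg(1)] G_hom[OF fg(2)]] FG fg by (simp add: hom_iff)
    moreover have "G f \<cdot>\<^bsub>X\<^esub> G g \<in> Arr X"
      using X.Comp_hom[OF G_hom[OF fg(1)] G_hom[OF fg(2)]] by (simp add: hom_iff)
    ultimately show ?thesis using GF by simp
  qed
  moreover have "G (Rst Y g) = Rst X (G g)" if "g \<in> Arr Y" for g
    using Rst[OF FG(2)[OF that]] FG[OF that] GF[of "Rst X (G g)"] by simp
  moreover have "G (Ide Y A) = Ide X A" if "A \<in> Obj Y" for A
    using that Ide[of A] GF[of "Ide X A"] Obj by simp
  ultimately have G_functor: "is_restriction_functor Y X (\<lambda>A. A) G"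
    unfolding is_restriction_functor_def is_functor_def
    using Obj G_hom by auto
  have iso: "is_iso X (Ide X A)" "is_iso Y (Ide Y A)" if "A \<in> Obj X" for A
    using that Obj X.Ide_hom[OF that] Y.Ide_hom[of A]
    unfolding is_iso_def inverse_arrows_def
    by (auto intro!: exI[of _ "Ide X A"] exI[of _ "Ide Y A"])
  have "is_natural_iso X X (\<lambda>A. A) (\<lambda>f. f) (\<lambda>A. A) (\<lambda>f. G (F f)) (Ide X)"
    using iso X.Ide_hom GF by (auto simp: is_natural_iso_def hom_iff)
  moreover have "is_natural_iso Y Y (\<lambda>B. B) (\<lambda>g. F (G g)) (\<lambda>B. B) (\<lambda>g. g) (Ide Y)"
    using iso Y.Ide_hom FG Obj by (auto simp: is_natural_iso_def hom_iff)
  moreover have "\<forall>A \<in> Obj X. is_total X (Ide X A)" "\<forall>B \<in> Obj Y. is_total Y (Ide Y B)"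
    by (simp_all add: X.total_Ide Y.total_Ide)
  ultimately show ?thesis
    unfolding restriction_equivalent_def using X Y F_functor G_functor by blast
qed

context classified_restriction_category
begin

text \<open>By \<open>classifier_Comp\<close> the classifying map of a composite is the Kleisli composite, and every total map
  into \<open>B \<oplus> \<one>\<close> classifies its composite with \<open>defined_part B\<close>.\<close>

theorem equivalent_exception_kleisli:
  "restriction_equivalent X (exception_kleisli (total_maps X) S)"
proof (rule restriction_equivalent_if_isomorphic)
  interpret D: distributive_category "total_maps X" S
    by (rule distributive_category_total_maps)
  let ?Y = "exception_kleisli (total_maps X) S"
  let ?F = "\<lambda>f. (Dom X f, classifier f, Cod X f)"
  show "restriction_category X" by unfold_locales
  show "Obj ?Y = Obj X" by (simp add: total_maps_simps)
  show "bij_betw ?F (Arr X) (Arr ?Y)"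
    unfolding bij_betw_def
  proof
    show "inj_on ?F (Arr X)"
      by (rule inj_onI) (metis classifier_defined_part prod.inject)
    show "?F ` Arr X = Arr ?Y"
    proof (intro equalityI subsetI)
      fix y assume "y \<in> ?F ` Arr X"
      then show "y \<in> Arr ?Y"
        by (auto simp: D.Arr_Kl hom_total_maps total_maps_simps hom_iff)
    next
      fix y assume "y \<in> Arr ?Y"
      then obtain A t B where y: "y = (A, t, B)" "A \<in> Obj X" "B \<in> Obj X" "is_total X t"
        "t \<in> hom X A (Coprod S B (Terminal S))"
        by (cases y) (auto simp: D.Arr_Kl hom_total_maps total_maps_simps)
      have "classifier (t \<cdot> defined_part B) = t"
        by (rule classifier_eqI) (use y in \<open>simp_all add: hom_iff\<close>)
      then have "y = ?F (t \<cdot> defined_part B)" "t \<cdot> defined_part B \<in> Arr X"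
        using y by (simp_all add: hom_iff)
      then show "y \<in> ?F ` Arr X" by blast
    qed
  qed
  show "?F (Ide X A) = Ide ?Y A" if "A \<in> Obj X" for A
    using that by (simp add: classifier_Ide)
  show "?F (f \<cdot> g) = ?F f \<cdot>\<^bsub>?Y\<^esub> ?F g" if "f \<in> Arr X" "g \<in> Arr X" "Cod X f = Dom X g" for f g
    using that
    by (simp add: classifier_Comp total_maps_simps copair_total_maps total_Inj1)
  show "?F (Rst X f) = Rst ?Y (?F f)" if "f \<in> Arr X" for f
  proof -
    let ?A = "Dom X f" and ?B = "Cod X f" and ?I = "Terminal S"
    have obj: "?A \<in> Obj X" "?B \<in> Obj X" "?I \<in> Obj X" using that by simp_all
    have "coprod_map (total_maps X) S (Proj0 S ?A ?B) (Proj1 S ?A ?I)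
        = copair X S (Proj0 S ?A ?B \<cdot> Inj0 S ?A ?I) (Proj1 S ?A ?I \<cdot> Inj1 S ?A ?I)"
      using obj by (simp add: coprod_map_def total_maps_simps copair_total_maps
          total_Comp total_Proj total_Inj0 total_Inj1)
    moreover have "inv_arrow (total_maps X)
        (distributor (total_maps X) S (pair (total_maps X) S) ?A ?B ?I)
        = inv_arrow X (distributor X S rpair ?A ?B ?I)"
      using obj by (simp add: distributor_total_maps iso_total_maps distributor_iso)
    moreover have "pair (total_maps X) S (Ide X ?A) (classifier f)
        = rpair (Ide X ?A) (classifier f)"
      using that by (simp add: pair_total_maps total_Ide)
    moreover note inv_arrow_simps[OF distributor_iso[OF obj]]
    moreover have "Dom X (distributor X S rpair ?A ?B ?I) = Coprod S (Prod S ?A ?B) (Prod S ?A ?I)"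
      "Cod X (distributor X S rpair ?A ?B ?I) = Prod S ?A (Coprod S ?B ?I)"
      using obj by (simp_all add: distributor_def)
    ultimately show ?thesis
      using that obj
      by (simp add: exception_kleisli_def Let_def total_maps_simps classifier_Rst)
  qed
qed (simp_all add: exception_kleisli_def Let_def)

end

theorem equivalent_exception_kleisli_if_classified:
  assumes "distributive_restriction_category X S" "classically_classified X S"
  shows "restriction_equivalent X (exception_kleisli (total_maps X) S)"
proof -
  interpret distributive_restriction_category X S by (rule assms)
  obtain Z where Z: "restriction_zeroes X Z"
    and cl: "\<And>A B f. \<lbrakk>A \<in> Obj X; B \<in> Obj X; f \<in> hom X A B\<rbrakk> \<Longrightarrow>
      \<exists>!t. t \<in> hom X A (Coprod S B (Terminal S)) \<and> is_total X t \<and>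
        t \<cdot>\<^bsub>X\<^esub> copair X S (Ide X B) (Z (Terminal S) B) = f"
    using assms(2) unfolding classically_classified_def by blast
  interpret classified_restriction_category X S Z
    by standard (use Z cl hom_Obj in blast)+
  show ?thesis by (rule equivalent_exception_kleisli)
qed

section \<open>The four characterisations\<close>

theorem theorem7p16:
  fixes X :: "('o, 'a) rcategory" and S :: "('o, 'a) prod_coprod"
  assumes "distributive_restriction_category X S"
  shows "(classical_restriction_category X \<longleftrightarrow> has_classical_products X S)
    \<and> (classical_restriction_category X \<longleftrightarrow> classically_classified X S)
    \<and> (classical_restriction_category X \<longleftrightarrow>
        (\<exists>(D :: ('o, 'a) category) (T :: ('o, 'a) prod_coprod).
          distributive_category D T \<and> restriction_equivalent X (exception_kleisli D T)))
    \<and> (\<forall>(D :: ('p, 'b) category) (T :: ('p, 'b) prod_coprod).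
        distributive_category D T \<and> restriction_equivalent X (exception_kleisli D T)
          \<longrightarrow> classical_restriction_category X)"
proof -
  have i_ii: "classical_restriction_category X \<Longrightarrow> has_classical_products X S"
    by (rule classical_products_if_classical[OF assms])
  have ii_iii: "has_classical_products X S \<Longrightarrow> classically_classified X S"
    by (rule classified_if_classical_products[OF assms])
  have iii_iv: "classically_classified X S \<Longrightarrow>
      distributive_category (total_maps X) S \<and>
      restriction_equivalent X (exception_kleisli (total_maps X) S)"
    using distributive_restriction_category.distributive_category_total_maps[OF assms]
      equivalent_exception_kleisli_if_classified[OF assms] by blast
  have iv_i: "classical_restriction_category X"
    if "distributive_category D T \<and> restriction_equivalent X (exception_kleisli D T)"
    for D :: "('o, 'a) category" and T :: "('o, 'a) prod_coprod"
    using that classical_if_equivalent_exception_kleisli by blast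
  have iv_i': "classical_restriction_category X"
    if "distributive_category D T \<and> restriction_equivalent X (exception_kleisli D T)"
    for D :: "('p, 'b) category" and T :: "('p, 'b) prod_coprod"
    using that classical_if_equivalent_exception_kleisli by blast
  show ?thesis
    using i_ii ii_iii iii_iv iv_i iv_i' by blast
qed

end
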